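(* Let $k$ be a field, $A$ a connected graded $k$-algebra and $\sigma$ a graded automorphism of $A$. Let $B=A[z;\sigma]$ be the graded skew extension of $A$, where $z$ has degree $l\ge 1$. Let $E(A)$, $E(k[z])$ and $E(B)$ be the Ext-algebras of $A$, $k[z]$ (with $\deg z=l$) and $B$, respectively. Then there is a normal $k$-linear isomorphism of bigraded vector spaces $R_E: E(A)\otimes E(k[z])\to E(k[z])\otimes E(A)$ satisfying $$R_E(f\otimes g)=(-1)^i\, g\otimes \tau(f)\qquad\text{for all } i\ge 0,\ f\in E^{i}(A),\ g\in E^1(k[z]),$$ where $\tau$ is the bigraded algebra automorphism of $E(A)$ induced by $\sigma$ (defined in the context), such that $E(k[z])\#_{R_E}E(A)$ and $E(A)\#_{R_E^{-1}}E(k[z])$ are $R$-smash products and, as bigraded algebras, $$E(B)\cong E(k[z])\#_{R_E}E(A)\cong E(A)\#_{R_{E}^{-1}}E(k[z]).$$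
   Context: All algebras are over the field $k$, and $\otimes=\otimes_k$. A $\mathbb{Z}$-graded algebra $A=\bigoplus_i A_i$ is connected if $A_i=0$ for $i<0$ and $A_0=k$; $\varepsilon_A:A\to k$ is the canonical augmentation, and $k$ is a graded left $A$-module via $\varepsilon_A$. For a graded automorphism $\sigma$ of $A$ and $z$ of degree $l\geq 1$, the graded skew extension $A[z;\sigma]$ is the free left $A$-module on $1,z,z^2,\dots$ with multiplication determined by $za=\sigma(a)z$ for $a\in A$. For a graded module $M$, the shift $M(i)$ is given by $M(i)_j=M_{i+j}$. For graded left $A$-modules $M,N$, $\underline{\mathrm{Hom}}_A(M,N)=\bigoplus_{i}\mathrm{Hom}_{\mathrm{Gr}A}(M,N(i))$ (degree-zero homomorphisms on the right), with derived functors $\underline{\mathrm{Ext}}^n_A(M,N)$. Complexes are cohomologically graded; $X[i]^n=X^{n+i}$ with differential $(-1)^i d_X$. Ext-algebra: let $P^\bullet$ be a minimal graded free resolution of ${}_Ak$, with $P^{-n}=A\otimes V_n$, $V_n$ a graded vector space, $V_0=k$, augmentation $\varepsilon_A:P^0=A\to k$, and $\mathrm{Im}\,d^{-n}\subseteq A_{\ge1}\otimes V_{n-1}$. Then $E^n(A)=\underline{\mathrm{Ext}}^n_A(k,k)=\underline{\mathrm{Hom}}_A(P^{-n},k)\cong V_n^*$ (graded dual), where $f\in (V_n^* )_{-t}$ corresponds to $\varepsilon_A\otimes f:A\otimes V_n\to k(-t)$. The bigraded space $E(A)=\bigoplus_{n,i}\underline{\mathrm{Ext}}^n_A(k,k)_i$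 is a bigraded algebra under the Yoneda product: for $\alpha\in E^i(A)_s$, $\beta\in E^j(A)_t$, viewed as cochain maps $\alpha:P^\bullet\to k(s)[i]$, $\beta:P^\bullet\to k(t)[j]$, choose a cochain map $\widetilde\alpha:P^\bullet\to P^\bullet(s)[i]$ with $\varepsilon_A[i]\circ\widetilde\alpha=\alpha$; then $\beta\cdot\alpha=\beta[i]\circ\widetilde\alpha$ (shifting a map introduces no sign). Automorphism $\tau$: let ${}^{\sigma^{-1}}P^\bullet$ be $P^\bullet$ with $A$-action $a*p=\sigma^{-1}(a)p$, and let $\widetilde\sigma:{}^{\sigma^{-1}}P^\bullet\to P^\bullet$ be an isomorphism of complexes of graded left $A$-modules lifting the identity of $k$ (equivalently, $\widetilde\sigma$ is a bijective degree-preserving additive cochain map $P^\bullet\to P^\bullet$ with $\widetilde\sigma(ap)=\sigma(a)\widetilde\sigma(p)$ and $\varepsilon_A\circ\widetilde\sigma=\varepsilon_A$). For $h\in V_j^*=E^j(A)$ define $\tau(h)\in V_j^*$ by $\tau(h)(v)=(\varepsilon_A\otimes h)(\widetilde\sigma^{-j}(1\otimes v))$, where $\widetilde\sigma^{-j}$ denotes the component of $\widetilde\sigma$ in cohomological degree $-j$. This is a well-defined bigraded algebra automorphism of $E(A)$. $R$-smash product: for bigraded algebras $C,D$ and a bigraded linear map $R:D\otimes C\to C\otimes D$, $C\#_RD$ is $C\otimes D$ with multiplication $(m_C\otimes m_D)(\mathrm{id}_C\otimes R\otimes \mathrm{id}_D)$; it is called an $R$-smash product if this multiplication is associative with unit $1_C\otimes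 1_D$. $R$ is normal if $R(1_D\otimes c)=c\otimes 1_D$ and $R(d\otimes 1_C)=1_C\otimes d$ for all $c\in C$, $d\in D$. *)

theory Defs
  imports
    Complex_Main
    "HOL-Library.Poly_Mapping"
    "HOL-Library.Function_Algebras"
    "HOL-Library.Product_Plus"
    "HOL-Computational_Algebra.Polynomial"
begin

section \<open>Graded vector spaces and graded algebras\<close>

text \<open>
  A graded vector space is a family of subspaces \<open>gcomp V g\<close> of an ambient \<open>'k\<close>-vector space
  structure on the whole type \<open>'v\<close>; the space itself is their sum \<open>gtotal V\<close>, which may be smaller
  than the type. The index type is \<open>int\<close> for graded algebras and \<open>nat \<times> int\<close> (cohomological degree,
  internal degree) for bigraded ones. Nothing is required of \<open>gmult\<close> outside \<open>gtotal\<close>.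
\<close>

record ('g, 'k, 'v) gspace =
  gscale :: "'k \<Rightarrow> 'v \<Rightarrow> 'v"
  gcomp :: "'g \<Rightarrow> 'v set"

record ('g, 'k, 'v) galgebra = "('g, 'k, 'v) gspace" +
  gmult :: "'v \<Rightarrow> 'v \<Rightarrow> 'v"
  gone :: 'v

definition gtotal :: "('g, 'k::field, 'v::ab_group_add, 'z) gspace_scheme \<Rightarrow> 'v set" where
  "gtotal V = module.span (gscale V) (\<Union>g. gcomp V g)"

definition graded_space :: "('g, 'k::field, 'v::ab_group_add, 'z) gspace_scheme \<Rightarrow> bool" where
  "graded_space V \<longleftrightarrow>
     vector_space (gscale V) \<and>
     (\<forall>g. module.subspace (gscale V) (gcomp V g)) \<and>
     (\<forall>f :: 'g \<Rightarrow>\<^sub>0 'v. (\<forall>g. Poly_Mapping.lookup f g \<in> gcomp V g) \<longrightarrow>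
        (\<Sum>g\<in>Poly_Mapping.keys f. Poly_Mapping.lookup f g) = 0 \<longrightarrow> f = 0)"

definition graded_algebra ::
    "('g::comm_monoid_add, 'k::field, 'v::ab_group_add, 'z) galgebra_scheme \<Rightarrow> bool" where
  "graded_algebra A \<longleftrightarrow>
     graded_space A \<and>
     gone A \<in> gcomp A 0 \<and>
     (\<forall>g h. \<forall>x\<in>gcomp A g. \<forall>y\<in>gcomp A h. gmult A x y \<in> gcomp A (g + h)) \<and>
     (\<forall>x\<in>gtotal A. \<forall>y\<in>gtotal A. \<forall>z\<in>gtotal A.
        gmult A (gmult A x y) z = gmult A x (gmult A y z) \<and>
        gmult A (x + y) z = gmult A x z + gmult A y z \<and>
        gmult A x (y + z) = gmult A x y + gmult A x z) \<and>
     (\<forall>c. \<forall>x\<in>gtotal A. \<forall>y\<in>gtotal A.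
        gmult A (gscale A c x) y = gscale A c (gmult A x y) \<and>
        gmult A x (gscale A c y) = gscale A c (gmult A x y)) \<and>
     (\<forall>x\<in>gtotal A. gmult A (gone A) x = x \<and> gmult A x (gone A) = x)"

text \<open>The algebras whose Ext-algebras are formed occupy the whole type.\<close>

definition connected_graded_algebra ::
    "(int, 'k::field, 'a::ab_group_add) galgebra \<Rightarrow> bool" where
  "connected_graded_algebra A \<longleftrightarrow>
     graded_algebra A \<and> gtotal A = UNIV \<and>
     (\<forall>i<0. gcomp A i = {0}) \<and>
     gcomp A 0 = range (\<lambda>c. gscale A c (gone A)) \<and> gone A \<noteq> 0"

definition graded_linear ::
    "('g, 'k::field, 'v::ab_group_add, 'z) gspace_scheme \<Rightarrow>
     ('g, 'k, 'w::ab_group_add, 'y) gspace_scheme \<Rightarrow> ('v \<Rightarrow> 'w) \<Rightarrow> bool" where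
  "graded_linear V W f \<longleftrightarrow>
     (\<forall>x\<in>gtotal V. \<forall>y\<in>gtotal V. f (x + y) = f x + f y) \<and>
     (\<forall>c. \<forall>x\<in>gtotal V. f (gscale V c x) = gscale W c (f x)) \<and>
     (\<forall>g. \<forall>x\<in>gcomp V g. f x \<in> gcomp W g)"

definition graded_linear_iso ::
    "('g, 'k::field, 'v::ab_group_add, 'z) gspace_scheme \<Rightarrow>
     ('g, 'k, 'w::ab_group_add, 'y) gspace_scheme \<Rightarrow> ('v \<Rightarrow> 'w) \<Rightarrow> bool" where
  "graded_linear_iso V W f \<longleftrightarrow>
     graded_linear V W f \<and> bij_betw f (gtotal V) (gtotal W) \<and>
     (\<forall>g. f ` gcomp V g = gcomp W g)"

definition graded_algebra_iso ::
    "('g, 'k::field, 'v::ab_group_add, 'z) galgebra_scheme \<Rightarrow>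
     ('g, 'k, 'w::ab_group_add, 'y) galgebra_scheme \<Rightarrow> ('v \<Rightarrow> 'w) \<Rightarrow> bool" where
  "graded_algebra_iso A B f \<longleftrightarrow>
     graded_linear_iso A B f \<and> f (gone A) = gone B \<and>
     (\<forall>x\<in>gtotal A. \<forall>y\<in>gtotal A. f (gmult A x y) = gmult B (f x) (f y))"

definition isomorphic_graded_algebras ::
    "('g, 'k::field, 'v::ab_group_add, 'z) galgebra_scheme \<Rightarrow>
     ('g, 'k, 'w::ab_group_add, 'y) galgebra_scheme \<Rightarrow> bool" where
  "isomorphic_graded_algebras A B \<longleftrightarrow> (\<exists>f. graded_algebra_iso A B f)"


section \<open>Polynomial algebras and skew extensions\<close>

definition poly_algebra :: "nat \<Rightarrow> (int, 'k::field, 'k poly) galgebra" where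
  "poly_algebra l =
     \<lparr>gscale = smult,
      gcomp = (\<lambda>m. {p. \<forall>n. coeff p n \<noteq> 0 \<longrightarrow> int l * int n = m}),
      gmult = (*),
      gone = 1\<rparr>"

text \<open>
  The element \<open>\<Sum>n. a\<^sub>n z\<^sup>n\<close> of the free left module on the powers of \<open>z\<close> is the polynomial with
  coefficients \<open>a\<^sub>n\<close>. The rule \<open>z a = \<sigma>(a) z\<close> gives \<open>(a z\<^sup>i) (b z\<^sup>j) = a \<sigma>\<^sup>i(b) z\<^sup>i\<^sup>+\<^sup>j\<close>.
\<close>

definition skew_extension ::
    "(int, 'k::field, 'a::ab_group_add) galgebra \<Rightarrow> ('a \<Rightarrow> 'a) \<Rightarrow> nat \<Rightarrow>
     (int, 'k, 'a poly) galgebra" where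
  "skew_extension A \<sigma> l =
     \<lparr>gscale = (\<lambda>c. map_poly (gscale A c)),
      gcomp = (\<lambda>m. {p. \<forall>n. coeff p n \<in> gcomp A (m - int l * int n)}),
      gmult = (\<lambda>p q. \<Sum>i\<le>degree p. \<Sum>j\<le>degree q.
         monom (gmult A (coeff p i) ((\<sigma> ^^ i) (coeff q j))) (i + j)),
      gone = monom (gone A) 0\<rparr>"


section \<open>Tensor products\<close>

text \<open>
  The tensor product is realised inside the dual of the space of bilinear forms: \<open>x \<otimes> y\<close> is
  evaluation at \<open>(x, y)\<close>. Over a field this is faithful: bilinear forms separate the elements of
  the algebraic tensor product, and every bilinear form on a pair of subspaces extends to the
  ambient spaces, so only the ambient scalar multiplications enter. Lemma \<open>tensor_lift_sum\<close> below
  is the resulting universal property.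
\<close>

definition bilinear_form ::
    "('g, 'k::field, 'v::ab_group_add, 'z) gspace_scheme \<Rightarrow>
     ('g, 'k, 'w::ab_group_add, 'y) gspace_scheme \<Rightarrow> ('v \<Rightarrow> 'w \<Rightarrow> 'k) \<Rightarrow> bool" where
  "bilinear_form V W b \<longleftrightarrow>
     (\<forall>y. Vector_Spaces.linear (gscale V) (*) (\<lambda>x. b x y)) \<and>
     (\<forall>x. Vector_Spaces.linear (gscale W) (*) (b x))"

definition tensor ::
    "('g, 'k::field, 'v::ab_group_add, 'z) gspace_scheme \<Rightarrow>
     ('g, 'k, 'w::ab_group_add, 'y) gspace_scheme \<Rightarrow>
     'v \<Rightarrow> 'w \<Rightarrow> (('v \<Rightarrow> 'w \<Rightarrow> 'k) \<Rightarrow> 'k)" where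
  "tensor V W x y = (\<lambda>b. if bilinear_form V W b then b x y else 0)"

definition tensor_scale :: "'k::field \<Rightarrow> ('b \<Rightarrow> 'k) \<Rightarrow> ('b \<Rightarrow> 'k)" where
  "tensor_scale c t = (\<lambda>b. c * t b)"

definition tensor_space ::
    "('g::comm_monoid_add, 'k::field, 'v::ab_group_add, 'z) gspace_scheme \<Rightarrow>
     ('g, 'k, 'w::ab_group_add, 'y) gspace_scheme \<Rightarrow>
     ('g, 'k, ('v \<Rightarrow> 'w \<Rightarrow> 'k) \<Rightarrow> 'k) gspace" where
  "tensor_space V W =
     \<lparr>gscale = tensor_scale,
      gcomp = (\<lambda>m. module.span tensor_scale
         {tensor V W x y | x y g h. x \<in> gcomp V g \<and> y \<in> gcomp W h \<and> g + h = m})\<rparr>"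

text \<open>
  The linear map on \<open>V \<otimes> W\<close> induced by a map \<open>f\<close> that is bilinear on \<open>gtotal V \<times> gtotal W\<close>; the
  value does not depend on the chosen representation as a sum of pure tensors.
\<close>

definition tensor_lift ::
    "('g, 'k::field, 'v::ab_group_add, 'z) gspace_scheme \<Rightarrow>
     ('g, 'k, 'w::ab_group_add, 'y) gspace_scheme \<Rightarrow>
     ('v \<Rightarrow> 'w \<Rightarrow> 'u::ab_group_add) \<Rightarrow> (('v \<Rightarrow> 'w \<Rightarrow> 'k) \<Rightarrow> 'k) \<Rightarrow> 'u" where
  "tensor_lift V W f t =
     (let ps = (SOME ps. set ps \<subseteq> gtotal V \<times> gtotal W \<and>
                         t = (\<Sum>(x, y)\<leftarrow>ps. tensor V W x y))
      in (\<Sum>(x, y)\<leftarrow>ps. f x y))"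

lemma tensor_lift_sum:
  fixes V :: "('g, 'k::field, 'v::ab_group_add, 'z) gspace_scheme"
    and W :: "('g, 'k, 'w::ab_group_add, 'y) gspace_scheme"
    and f :: "'v \<Rightarrow> 'w \<Rightarrow> 'u::ab_group_add"
  assumes V: "vector_space (gscale V)" and W: "vector_space (gscale W)" and U: "vector_space sU"
    and add1: "\<And>x x' y. x \<in> gtotal V \<Longrightarrow> x' \<in> gtotal V \<Longrightarrow> y \<in> gtotal W \<Longrightarrow> f (x + x') y = f x y + f x' y"
    and add2: "\<And>x y y'. x \<in> gtotal V \<Longrightarrow> y \<in> gtotal W \<Longrightarrow> y' \<in> gtotal W \<Longrightarrow> f x (y + y') = f x y + f x y'"
    and scale1: "\<And>c x y. x \<in> gtotal V \<Longrightarrow> y \<in> gtotal W \<Longrightarrow> f (gscale V c x) y = sU c (f x y)"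
    and scale2: "\<And>c x y. x \<in> gtotal V \<Longrightarrow> y \<in> gtotal W \<Longrightarrow> f x (gscale W c y) = sU c (f x y)"
    and ps: "set ps \<subseteq> gtotal V \<times> gtotal W"
  shows "tensor_lift V W f (\<Sum>(x, y)\<leftarrow>ps. tensor V W x y) = (\<Sum>(x, y)\<leftarrow>ps. f x y)"
proof -
  have proj: "\<exists>p. Vector_Spaces.linear s s p \<and> range p \<subseteq> S \<and> (\<forall>x\<in>S. p x = x)"
    if "vector_space s" "module.subspace s S" for s :: "'k \<Rightarrow> 'b::ab_group_add \<Rightarrow> 'b" and S
  proof -
    interpret vs: vector_space s by fact
    interpret vp: vector_space_pair s s by unfold_locales
    have "Vector_Spaces.linear s s id" by (rule vs.linear_id)
    from vp.linear_exists_left_inverse_on[OF this that(2), of ] show ?thesis by auto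
  qed
  interpret V: vector_space "gscale V" by fact
  interpret W: vector_space "gscale W" by fact
  interpret U: vector_space sU by fact
  have sub: "V.subspace (gtotal V)" "W.subspace (gtotal W)"
    by (simp_all add: gtotal_def)
  obtain p where p: "Vector_Spaces.linear (gscale V) (gscale V) p" "range p \<subseteq> gtotal V"
      "\<And>x. x \<in> gtotal V \<Longrightarrow> p x = x"
    using proj[OF V sub(1)] by blast
  obtain q where q: "Vector_Spaces.linear (gscale W) (gscale W) q" "range q \<subseteq> gtotal W"
      "\<And>x. x \<in> gtotal W \<Longrightarrow> q x = x"
    using proj[OF W sub(2)] by blast
  interpret p: Vector_Spaces.linear "gscale V" "gscale V" p by fact
  interpret q: Vector_Spaces.linear "gscale W" "gscale W" q by fact
  interpret K: vector_space "(*) :: 'k \<Rightarrow> 'k \<Rightarrow> 'k"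
    by unfold_locales (auto simp: algebra_simps)
  interpret UK: vector_space_pair sU "(*) :: 'k \<Rightarrow> 'k \<Rightarrow> 'k" by unfold_locales
  have wd: "(\<Sum>(x, y)\<leftarrow>ps. f x y) = (\<Sum>(x, y)\<leftarrow>qs. f x y)"
    if qs: "set qs \<subseteq> gtotal V \<times> gtotal W"
      and eq: "(\<Sum>(x, y)\<leftarrow>ps. tensor V W x y) = (\<Sum>(x, y)\<leftarrow>qs. tensor V W x y)" for qs
  proof (rule ccontr)
    let ?u = "(\<Sum>(x, y)\<leftarrow>ps. f x y) - (\<Sum>(x, y)\<leftarrow>qs. f x y)"
    assume "\<not> ?thesis"
    then have "?u \<noteq> 0" by simp
    then have "U.independent {?u}" by simp
    from UK.linear_independent_extend[OF this, of "\<lambda>_. 1"]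
    obtain h where h: "Vector_Spaces.linear sU (*) h" "h ?u = 1" by auto
    interpret h: Vector_Spaces.linear sU "(*) :: 'k \<Rightarrow> 'k \<Rightarrow> 'k" h by fact
    define b where "b = (\<lambda>x y. h (f (p x) (q y)))"
    have pr: "p x \<in> gtotal V" "q y \<in> gtotal W" for x y using p(2) q(2) by auto
    have b: "bilinear_form V W b"
      unfolding bilinear_form_def b_def
      by (intro conjI allI; unfold_locales)
         (simp_all add: p.add q.add p.scale q.scale add1 add2 scale1 scale2 pr h.add h.scale)
    have ev: "(\<Sum>(x, y)\<leftarrow>rs. tensor V W x y) b = h (\<Sum>(x, y)\<leftarrow>rs. f x y)"
      if "set rs \<subseteq> gtotal V \<times> gtotal W" for rs
      using that by (induction rs) (auto simp: h.add h.zero tensor_def b, simp add: b_def p(3) q(3))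
    have "h (\<Sum>(x, y)\<leftarrow>ps. f x y) = h (\<Sum>(x, y)\<leftarrow>qs. f x y)"
      using ev[OF ps] ev[OF qs] eq by simp
    with h(2) show False by (simp add: h.diff)
  qed
  let ?t = "\<Sum>(x, y)\<leftarrow>ps. tensor V W x y"
  define rs where "rs = (SOME rs. set rs \<subseteq> gtotal V \<times> gtotal W \<and> ?t = (\<Sum>(x, y)\<leftarrow>rs. tensor V W x y))"
  have "set rs \<subseteq> gtotal V \<times> gtotal W \<and> ?t = (\<Sum>(x, y)\<leftarrow>rs. tensor V W x y)"
    unfolding rs_def by (rule someI[of _ ps]) (use ps in simp)
  then have "(\<Sum>(x, y)\<leftarrow>ps. f x y) = (\<Sum>(x, y)\<leftarrow>rs. f x y)" using wd[of rs] by blast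
  then show ?thesis by (simp add: tensor_lift_def rs_def)
qed


section \<open>R-smash products\<close>

text \<open>
  \<open>(m\<^sub>C \<otimes> m\<^sub>D) (id \<otimes> R \<otimes> id)\<close>: the product of \<open>c \<otimes> d\<close> and \<open>c' \<otimes> d'\<close> is obtained from
  \<open>R (d \<otimes> c')\<close> by applying \<open>u \<otimes> v \<mapsto> c u \<otimes> v d'\<close>.
\<close>

definition smash ::
    "('g::comm_monoid_add, 'k::field, 'v::ab_group_add) galgebra \<Rightarrow>
     ('g, 'k, 'w::ab_group_add) galgebra \<Rightarrow>
     ((('w \<Rightarrow> 'v \<Rightarrow> 'k) \<Rightarrow> 'k) \<Rightarrow> (('v \<Rightarrow> 'w \<Rightarrow> 'k) \<Rightarrow> 'k)) \<Rightarrow>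
     ('g, 'k, ('v \<Rightarrow> 'w \<Rightarrow> 'k) \<Rightarrow> 'k) galgebra" where
  "smash C D R =
     \<lparr>gscale = gscale (tensor_space C D),
      gcomp = gcomp (tensor_space C D),
      gmult = (\<lambda>s t.
         tensor_lift C D (\<lambda>c d.
           tensor_lift C D (\<lambda>c' d'.
             tensor_lift C D (\<lambda>u v. tensor C D (gmult C c u) (gmult D v d'))
               (R (tensor D C d c'))) t) s),
      gone = tensor C D (gone C) (gone D)\<rparr>"

definition is_smash_product ::
    "('g::comm_monoid_add, 'k::field, 'v::ab_group_add) galgebra \<Rightarrow>
     ('g, 'k, 'w::ab_group_add) galgebra \<Rightarrow>
     ((('w \<Rightarrow> 'v \<Rightarrow> 'k) \<Rightarrow> 'k) \<Rightarrow> (('v \<Rightarrow> 'w \<Rightarrow> 'k) \<Rightarrow> 'k)) \<Rightarrow> bool" where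
  "is_smash_product C D R \<longleftrightarrow>
     graded_linear (tensor_space D C) (tensor_space C D) R \<and>
     (\<forall>x\<in>gtotal (smash C D R). \<forall>y\<in>gtotal (smash C D R). \<forall>z\<in>gtotal (smash C D R).
        gmult (smash C D R) (gmult (smash C D R) x y) z =
        gmult (smash C D R) x (gmult (smash C D R) y z)) \<and>
     (\<forall>x\<in>gtotal (smash C D R).
        gmult (smash C D R) (gone (smash C D R)) x = x \<and>
        gmult (smash C D R) x (gone (smash C D R)) = x)"

definition normal_twist ::
    "('g, 'k::field, 'v::ab_group_add) galgebra \<Rightarrow>
     ('g, 'k, 'w::ab_group_add) galgebra \<Rightarrow>
     ((('w \<Rightarrow> 'v \<Rightarrow> 'k) \<Rightarrow> 'k) \<Rightarrow> (('v \<Rightarrow> 'w \<Rightarrow> 'k) \<Rightarrow> 'k)) \<Rightarrow> bool" where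
  "normal_twist C D R \<longleftrightarrow>
     (\<forall>c\<in>gtotal C. R (tensor D C (gone D) c) = tensor C D c (gone D)) \<and>
     (\<forall>d\<in>gtotal D. R (tensor D C d (gone C)) = tensor C D (gone C) d)"


section \<open>Minimal graded free resolutions of the trivial module\<close>

definition positive_part :: "(int, 'k::field, 'a::ab_group_add) galgebra \<Rightarrow> 'a set" where
  "positive_part A = module.span (gscale A) (\<Union>i\<in>{1..}. gcomp A i)"

definition augmentation :: "(int, 'k::field, 'a::ab_group_add) galgebra \<Rightarrow> 'a \<Rightarrow> 'k" where
  "augmentation A a = (THE c. a - gscale A c (gone A) \<in> positive_part A)"

text \<open>
  A resolution \<open>P\<close> is given by homogeneous bases of all the \<open>V\<^sub>n\<close> at once: \<open>rbasis\<close> is the disjoint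
  union of these bases, \<open>hdeg x\<close> is the \<open>n\<close> with \<open>x \<in> V\<^sub>n\<close> and \<open>ideg x\<close> is the internal degree of
  \<open>x\<close>. An element of \<open>P = \<Oplus>\<^sub>n A \<otimes> V\<^sub>n\<close> is a finitely supported family of coefficients in \<open>A\<close> with
  support in \<open>rbasis\<close>, so \<open>1 \<otimes> x\<close> is \<open>single x 1\<close>, and \<open>rdiff\<close> is the differential on all of \<open>P\<close>.
\<close>

record (overloaded) ('x, 'a) resolution =
  rbasis :: "'x set"
  hdeg :: "'x \<Rightarrow> nat"
  ideg :: "'x \<Rightarrow> int"
  rdiff :: "('x \<Rightarrow>\<^sub>0 'a) \<Rightarrow> ('x \<Rightarrow>\<^sub>0 'a)"

definition rmodule :: "('x, 'a::ab_group_add) resolution \<Rightarrow> ('x \<Rightarrow>\<^sub>0 'a) set" where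
  "rmodule P = {p. Poly_Mapping.keys p \<subseteq> rbasis P}"

text \<open>Cohomological degree \<open>j\<close>; this is \<open>0\<close> for \<open>j > 0\<close>.\<close>

definition rdegree :: "('x, 'a::ab_group_add) resolution \<Rightarrow> int \<Rightarrow> ('x \<Rightarrow>\<^sub>0 'a) set" where
  "rdegree P j = {p. Poly_Mapping.keys p \<subseteq> {x \<in> rbasis P. - int (hdeg P x) = j}}"

definition rbidegree ::
    "(int, 'k::field, 'a::ab_group_add) galgebra \<Rightarrow> ('x, 'a) resolution \<Rightarrow> int \<Rightarrow> int \<Rightarrow>
     ('x \<Rightarrow>\<^sub>0 'a) set" where
  "rbidegree A P j m =
     {p \<in> rdegree P j. \<forall>x\<in>Poly_Mapping.keys p. Poly_Mapping.lookup p x \<in> gcomp A (m - ideg P x)}"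

definition raction ::
    "(int, 'k::field, 'a::ab_group_add) galgebra \<Rightarrow> 'a \<Rightarrow> ('x \<Rightarrow>\<^sub>0 'a) \<Rightarrow> ('x \<Rightarrow>\<^sub>0 'a)" where
  "raction A a p = Poly_Mapping.map (gmult A a) p"

text \<open>Additive and semilinear along \<open>\<sigma>\<close>; \<open>\<sigma> = id\<close> gives left \<open>A\<close>-linear maps.\<close>

definition semilinear_on_resolution ::
    "(int, 'k::field, 'a::ab_group_add) galgebra \<Rightarrow> ('a \<Rightarrow> 'a) \<Rightarrow> ('x, 'a) resolution \<Rightarrow>
     (('x \<Rightarrow>\<^sub>0 'a) \<Rightarrow> ('x \<Rightarrow>\<^sub>0 'a)) \<Rightarrow> bool" where
  "semilinear_on_resolution A \<sigma> P \<phi> \<longleftrightarrow>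
     (\<forall>p\<in>rmodule P. \<forall>q\<in>rmodule P. \<phi> (p + q) = \<phi> p + \<phi> q) \<and>
     (\<forall>a. \<forall>p\<in>rmodule P. \<phi> (raction A a p) = raction A (\<sigma> a) (\<phi> p))"

definition shifts_bidegree ::
    "(int, 'k::field, 'a::ab_group_add) galgebra \<Rightarrow> ('x, 'a) resolution \<Rightarrow> int \<Rightarrow> int \<Rightarrow>
     (('x \<Rightarrow>\<^sub>0 'a) \<Rightarrow> ('x \<Rightarrow>\<^sub>0 'a)) \<Rightarrow> bool" where
  "shifts_bidegree A P i s \<phi> \<longleftrightarrow>
     (\<forall>j m. \<forall>p\<in>rbidegree A P j m. \<phi> p \<in> rbidegree A P (j + i) (m + s))"

text \<open>
  For a function \<open>f\<close> on the basis, \<open>pairing A f\<close> is \<open>\<epsilon>\<^sub>A \<otimes> f\<close>, with \<open>f\<close> extended linearly.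
\<close>

definition pairing ::
    "(int, 'k::field, 'a::ab_group_add) galgebra \<Rightarrow> ('x \<Rightarrow> 'k) \<Rightarrow> ('x \<Rightarrow>\<^sub>0 'a) \<Rightarrow> 'k" where
  "pairing A f p =
     (\<Sum>x\<in>Poly_Mapping.keys p. augmentation A (Poly_Mapping.lookup p x) * f x)"

text \<open>
  \<open>V\<^sub>0 = k\<close> has a single basis element, in internal degree \<open>0\<close> and identified with \<open>1 \<in> k\<close>. So the
  augmentation \<open>P\<^sup>0 = A \<rightarrow> k\<close> is \<open>\<epsilon>\<^sub>A \<otimes> f\<close> for the function \<open>f\<close> that is \<open>1\<close> there.
\<close>

definition unit_class :: "('x, 'a) resolution \<Rightarrow> 'x \<Rightarrow> 'k::field" where
  "unit_class P x = (if x \<in> rbasis P \<and> hdeg P x = 0 then 1 else 0)"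

definition raugmentation ::
    "(int, 'k::field, 'a::ab_group_add) galgebra \<Rightarrow> ('x, 'a) resolution \<Rightarrow> ('x \<Rightarrow>\<^sub>0 'a) \<Rightarrow> 'k" where
  "raugmentation A P = pairing A (unit_class P)"

definition minimal_resolution ::
    "(int, 'k::field, 'a::ab_group_add) galgebra \<Rightarrow> ('x, 'a) resolution \<Rightarrow> bool" where
  "minimal_resolution A P \<longleftrightarrow>
     semilinear_on_resolution A id P (rdiff P) \<and>
     shifts_bidegree A P 1 0 (rdiff P) \<and>
     (\<exists>x. {x \<in> rbasis P. hdeg P x = 0} = {x} \<and> ideg P x = 0) \<and>
     (\<forall>j<0. {p \<in> rdegree P j. rdiff P p = 0} = rdiff P ` rdegree P (j - 1)) \<and>
     {p \<in> rdegree P 0. raugmentation A P p = 0} = rdiff P ` rdegree P (- 1) \<and>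
     (\<forall>p\<in>rmodule P. \<forall>x. Poly_Mapping.lookup (rdiff P p) x \<in> positive_part A)"


section \<open>The Ext-algebra\<close>

text \<open>
  \<open>E\<^sup>n\<close> is the graded dual of \<open>V\<^sub>n\<close>, so an element of \<open>E(A)\<close> is a function on the basis that is
  supported in finitely many bidegrees. A functional on \<open>(V\<^sub>n)\<^sub>t\<close> has bidegree \<open>(n, -t)\<close>.
\<close>

definition ext_bidegree :: "('x, 'a) resolution \<Rightarrow> 'x \<Rightarrow> nat \<times> int" where
  "ext_bidegree P x = (hdeg P x, - ideg P x)"

definition ext_component ::
    "('x, 'a) resolution \<Rightarrow> nat \<times> int \<Rightarrow> ('x \<Rightarrow> 'k::field) \<Rightarrow> 'x \<Rightarrow> 'k" where
  "ext_component P g f x = (if x \<in> rbasis P \<and> ext_bidegree P x = g then f x else 0)"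

text \<open>
  A cochain map \<open>P \<rightarrow> P(s)[i]\<close> lifting \<open>\<alpha>\<close>; the sign of \<open>rdiff\<close> for odd \<open>i\<close> is that of
  the differential of \<open>P(s)[i]\<close>. The condition \<open>\<epsilon>\<^sub>A[i] \<circ> \<phi> = \<alpha>\<close> only concerns \<open>P\<^sup>-\<^sup>i\<close>.
\<close>

definition yoneda_lift ::
    "(int, 'k::field, 'a::ab_group_add) galgebra \<Rightarrow> ('x, 'a) resolution \<Rightarrow> nat \<Rightarrow> int \<Rightarrow>
     ('x \<Rightarrow> 'k) \<Rightarrow> (('x \<Rightarrow>\<^sub>0 'a) \<Rightarrow> ('x \<Rightarrow>\<^sub>0 'a)) \<Rightarrow> bool" where
  "yoneda_lift A P i s \<alpha> \<phi> \<longleftrightarrow>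
     semilinear_on_resolution A id P \<phi> \<and> shifts_bidegree A P (int i) s \<phi> \<and>
     (\<forall>p\<in>rmodule P. (if even i then rdiff P (\<phi> p) else - rdiff P (\<phi> p)) = \<phi> (rdiff P p)) \<and>
     (\<forall>p\<in>rdegree P (- int i). raugmentation A P (\<phi> p) = pairing A \<alpha> p)"

text \<open>\<open>\<beta> \<cdot> \<alpha> = \<beta>[i] \<circ> \<phi>\<close> for \<open>\<alpha>\<close> of bidegree \<open>(i, s)\<close> with lift \<open>\<phi>\<close>, evaluated on the \<open>1 \<otimes> x\<close>.\<close>

definition yoneda_homogeneous ::
    "(int, 'k::field, 'a::ab_group_add) galgebra \<Rightarrow> ('x, 'a) resolution \<Rightarrow>
     ('x \<Rightarrow> 'k) \<Rightarrow> nat \<times> int \<Rightarrow> ('x \<Rightarrow> 'k) \<Rightarrow> 'x \<Rightarrow> 'k" where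
  "yoneda_homogeneous A P \<beta> g \<alpha> =
     (let \<phi> = (SOME \<phi>. yoneda_lift A P (fst g) (snd g) \<alpha> \<phi>)
      in (\<lambda>x. if x \<in> rbasis P then pairing A \<beta> (\<phi> (Poly_Mapping.single x (gone A))) else 0))"

definition yoneda_product ::
    "(int, 'k::field, 'a::ab_group_add) galgebra \<Rightarrow> ('x, 'a) resolution \<Rightarrow>
     ('x \<Rightarrow> 'k) \<Rightarrow> ('x \<Rightarrow> 'k) \<Rightarrow> 'x \<Rightarrow> 'k" where
  "yoneda_product A P \<beta> \<alpha> =
     (\<Sum>g \<in> ext_bidegree P ` {x \<in> rbasis P. \<alpha> x \<noteq> 0}.
        yoneda_homogeneous A P \<beta> g (ext_component P g \<alpha>))"

definition ext_algebra ::
    "(int, 'k::field, 'a::ab_group_add) galgebra \<Rightarrow> ('x, 'a) resolution \<Rightarrow>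
     (nat \<times> int, 'k, 'x \<Rightarrow> 'k) galgebra" where
  "ext_algebra A P =
     \<lparr>gscale = (\<lambda>c f x. c * f x),
      gcomp = (\<lambda>g. {f. \<forall>x. f x \<noteq> 0 \<longrightarrow> x \<in> rbasis P \<and> ext_bidegree P x = g}),
      gmult = yoneda_product A P,
      gone = unit_class P\<rparr>"

definition cohomological_part ::
    "(nat \<times> int, 'k::field, 'v::ab_group_add, 'z) gspace_scheme \<Rightarrow> nat \<Rightarrow> 'v set" where
  "cohomological_part E n = module.span (gscale E) (\<Union>i. gcomp E (n, i))"


section \<open>The automorphism of the Ext-algebra induced by a graded automorphism\<close>

definition resolution_twist ::
    "(int, 'k::field, 'a::ab_group_add) galgebra \<Rightarrow> ('a \<Rightarrow> 'a) \<Rightarrow> ('x, 'a) resolution \<Rightarrow>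
     (('x \<Rightarrow>\<^sub>0 'a) \<Rightarrow> ('x \<Rightarrow>\<^sub>0 'a)) \<Rightarrow> bool" where
  "resolution_twist A \<sigma> P \<phi> \<longleftrightarrow>
     semilinear_on_resolution A \<sigma> P \<phi> \<and> shifts_bidegree A P 0 0 \<phi> \<and>
     bij_betw \<phi> (rmodule P) (rmodule P) \<and>
     (\<forall>p\<in>rmodule P. rdiff P (\<phi> p) = \<phi> (rdiff P p)) \<and>
     (\<forall>p\<in>rdegree P 0. raugmentation A P (\<phi> p) = raugmentation A P p)"

definition ext_twist ::
    "(int, 'k::field, 'a::ab_group_add) galgebra \<Rightarrow> ('a \<Rightarrow> 'a) \<Rightarrow> ('x, 'a) resolution \<Rightarrow>
     ('x \<Rightarrow> 'k) \<Rightarrow> 'x \<Rightarrow> 'k" where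
  "ext_twist A \<sigma> P h =
     (let \<phi> = (SOME \<phi>. resolution_twist A \<sigma> P \<phi>)
      in (\<lambda>x. if x \<in> rbasis P then pairing A h (\<phi> (Poly_Mapping.single x (gone A))) else 0))"

end

theory Submission
  imports Defs
begin

text \<open>
  Let \<open>\<phi>\<close> be the lift of \<open>\<sigma>\<close> to the minimal resolution \<open>P\<close> of \<open>k\<close> over \<open>A\<close> from which \<open>\<tau>\<close> is
  computed. The cone of right multiplication by \<open>z\<close> on \<open>B \<otimes>\<^sub>A P\<close>, twisted by \<open>\<phi>\<inverse>\<close>, is a minimal
  resolution of \<open>k\<close> over \<open>B\<close>, so \<open>E(B)\<close> is two shifted copies of \<open>E(A)\<close>. A lift \<open>\<alpha>'\<close> of a class
  \<open>\<alpha> \<in> E\<^sup>i(A)\<close> extends to the cone as \<open>\<alpha>'\<close> on the unshifted copy and \<open>(-1)\<^sup>i \<phi> \<alpha>' \<phi>\<inverse>\<close> on the shifted one,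
  and the generator \<open>\<omega>\<close> of the second copy lifts to the map from the shifted to the unshifted copy.
  Hence \<open>E(A)\<close> and \<open>E(k[z]) = k \<oplus> k\<omega>\<close> are subalgebras of \<open>E(B)\<close> with \<open>\<alpha> \<omega> = (-1)\<^sup>i \<omega> \<tau>(\<alpha>)\<close>, and both
  multiplication maps \<open>E(k[z]) \<otimes> E(A) \<rightarrow> E(B) \<leftarrow> E(A) \<otimes> E(k[z])\<close> are bijective. Whenever an algebra
  factors in this way, the composite of one multiplication map with the inverse of the other is a
  normal twist whose smash product is the algebra.
\<close>

text \<open>Tensors are functions, and the simplifier should not evaluate their sums pointwise.\<close>

declare plus_fun_apply [simp del] zero_fun_apply [simp del]

section \<open>Linear maps on graded spaces and tensor products\<close>

text \<open>Right multiplication by \<open>z\<close> alone does not respect the tensor product over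
  \<open>A\<close>: since \<open>a z = z \<sigma>\<inverse>(a)\<close>, the elements
  \<open>b a \<otimes> p\<close> and \<open>b \<otimes> a p\<close> get the same image only if
  \<open>p\<close> is moved by a \<open>\<sigma>\<inverse>\<close>-semilinear map as well. This map
  has to be a strict inverse of \<open>\<phi>\<close>, not one up to homotopy, because lifts on the
  shifted copy are conjugated by it and because exactness of the cone uses it. Strictness comes from
  minimality: a degree-preserving \<open>A\<close>-linear cochain map
  \<open>P \<rightarrow> P\<close> over the identity of \<open>k\<close> is the identity plus a map
  with coefficients in the augmentation ideal. That second map lowers the internal degree of
  generators, and these degrees are bounded below. Functionals see cochain maps only modulo the
  augmentation ideal. Hence Yoneda products do not depend on the chosen lifts, nor Ext-algebras on
  the chosen minimal resolutions. The latter is essential, since the resolutions of \<open>B\<close>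
  and \<open>k[z]\<close> are arbitrary while the cone is explicit. Moreover \<open>k[z]\<close> is
  the skew extension of \<open>k\<close> by the identity, so the same cone, over the trivial
  resolution of \<open>k\<close>, computes \<open>E(k[z])\<close>.\<close>

lemma gtotal_subspace:
  assumes "vector_space (gscale V)"
  shows "module.subspace (gscale V) (gtotal V)"
proof -
  interpret vector_space "gscale V" by fact
  show ?thesis by (simp add: gtotal_def)
qed

lemma gtotal_zero: "vector_space (gscale V) \<Longrightarrow> 0 \<in> gtotal V"
  and gtotal_add: "vector_space (gscale V) \<Longrightarrow> x \<in> gtotal V \<Longrightarrow> y \<in> gtotal V \<Longrightarrow> x + y \<in> gtotal V"
  and gtotal_scale: "vector_space (gscale V) \<Longrightarrow> x \<in> gtotal V \<Longrightarrow> gscale V c x \<in> gtotal V"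
proof -
  assume a: "vector_space (gscale V)"
  interpret vector_space "gscale V" by fact
  note s = gtotal_subspace[OF a]
  show "0 \<in> gtotal V" using s subspace_0 by blast
  show "x \<in> gtotal V \<Longrightarrow> y \<in> gtotal V \<Longrightarrow> x + y \<in> gtotal V" using s subspace_add by blast
  show "x \<in> gtotal V \<Longrightarrow> gscale V c x \<in> gtotal V" using s subspace_scale by blast
qed

lemma gtotal_sum:
  assumes "vector_space (gscale V)" "\<And>i. i \<in> S \<Longrightarrow> f i \<in> gtotal V"
  shows "(\<Sum>i\<in>S. f i) \<in> gtotal V"
  using assms(2)
  by (induction S rule: infinite_finite_induct) (auto simp: gtotal_zero gtotal_add assms(1))

lemma gcomp_gtotal: "vector_space (gscale V) \<Longrightarrow> x \<in> gcomp V g \<Longrightarrow> x \<in> gtotal V"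
proof -
  assume a: "vector_space (gscale V)" and x: "x \<in> gcomp V g"
  interpret vector_space "gscale V" by fact
  show ?thesis using x unfolding gtotal_def by (blast intro: span_base)
qed

lemma gtotal_induct [consumes 2, case_names zero add scale comp]:
  assumes "vector_space (gscale V)" "x \<in> gtotal V"
    and "P 0" "\<And>x y. x \<in> gtotal V \<Longrightarrow> y \<in> gtotal V \<Longrightarrow> P x \<Longrightarrow> P y \<Longrightarrow> P (x + y)"
    and "\<And>c x. x \<in> gtotal V \<Longrightarrow> P x \<Longrightarrow> P (gscale V c x)" "\<And>g x. x \<in> gcomp V g \<Longrightarrow> P x"
  shows "P x"
proof -
  interpret vector_space "gscale V" by fact
  have "x \<in> span (\<Union>g. gcomp V g)" using assms(2) by (simp add: gtotal_def)
  then have "x \<in> gtotal V \<and> P x"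
  proof (induction rule: span_induct_alt)
    case base
    show ?case using gtotal_zero[OF assms(1)] assms(3) by simp
  next
    case (step c x y)
    then obtain g where x: "x \<in> gcomp V g" by blast
    then have x': "x \<in> gtotal V" by (rule gcomp_gtotal[OF assms(1)])
    then have "gscale V c x \<in> gtotal V" "P (gscale V c x)"
      using gtotal_scale[OF assms(1)] assms(5)[OF x' assms(6)[OF x]] by blast+
    then show ?case using step assms(4) gtotal_add[OF assms(1)] by blast
  qed
  then show ?thesis by simp
qed

text \<open>Linearity is meaningful only on \<open>gtotal V\<close>, since nothing is assumed about
  maps elsewhere. The target enters through its scalar multiplication alone, so the notion also
  covers coordinates with values in the field.\<close>

definition linear_on_total ::
    "('g, 'k::field, 'v::ab_group_add, 'z) gspace_scheme \<Rightarrow> ('k \<Rightarrow> 'u::ab_group_add \<Rightarrow> 'u) \<Rightarrow>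
     ('v \<Rightarrow> 'u) \<Rightarrow> bool" where
  "linear_on_total V s f \<longleftrightarrow>
     (\<forall>x\<in>gtotal V. \<forall>y\<in>gtotal V. f (x + y) = f x + f y) \<and>
     (\<forall>c. \<forall>x\<in>gtotal V. f (gscale V c x) = s c (f x))"

lemma graded_linear_iff:
  "graded_linear V W f \<longleftrightarrow>
     linear_on_total V (gscale W) f \<and> (\<forall>g. \<forall>x\<in>gcomp V g. f x \<in> gcomp W g)"
  by (auto simp: graded_linear_def linear_on_total_def)

lemma linear_on_total_zero:
  assumes "vector_space (gscale V)" "linear_on_total V s f"
  shows "f 0 = 0"
proof -
  have "f (0 + 0) = f 0 + f 0"
    using assms gtotal_zero unfolding linear_on_total_def by blast
  then show ?thesis by simp
qed

lemma linear_on_total_eq: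
  assumes "vector_space (gscale V)" "linear_on_total V s f" "linear_on_total V s h"
    and "\<And>g x. x \<in> gcomp V g \<Longrightarrow> f x = h x" and "x \<in> gtotal V"
  shows "f x = h x"
  using assms(1,5)
proof (induction rule: gtotal_induct)
  case zero
  show ?case using assms(1-3) linear_on_total_zero by metis
qed (use assms(2-4) in \<open>auto simp: linear_on_total_def\<close>)

lemma graded_linear_gtotal:
  assumes "vector_space (gscale V)" "vector_space (gscale W)" "graded_linear V W f" "x \<in> gtotal V"
  shows "f x \<in> gtotal W"
  using assms(1,4)
proof (induction rule: gtotal_induct)
  case zero
  then show ?case
    using assms by (metis graded_linear_iff gtotal_zero linear_on_total_zero)
next
  case (add x y)
  then show ?case using assms by (auto simp: graded_linear_def gtotal_add)
next
  case (scale c x)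
  then show ?case using assms by (auto simp: graded_linear_def gtotal_scale)
next
  case (comp g x)
  then have "f x \<in> gcomp W g" using assms(3) by (auto simp: graded_linear_def)
  then show ?case by (rule gcomp_gtotal[OF assms(2)])
qed

text \<open>Because the inverse is graded too, each component is hit exactly, which
  \<open>graded_linear_iso\<close> demands besides bijectivity.\<close>

lemma graded_linear_isoI:
  assumes V: "vector_space (gscale V)" and W: "vector_space (gscale W)"
    and f: "graded_linear V W f" and h: "graded_linear W V h"
    and hf: "\<And>x. x \<in> gtotal V \<Longrightarrow> h (f x) = x" and fh: "\<And>y. y \<in> gtotal W \<Longrightarrow> f (h y) = y"
  shows "graded_linear_iso V W f"
proof -
  have "bij_betw f (gtotal V) (gtotal W)"
    by (rule bij_betw_byWitness[where f' = h])
      (use hf fh graded_linear_gtotal[OF V W f] graded_linear_gtotal[OF W V h] in auto)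
  moreover have "f ` gcomp V g = gcomp W g" for g
  proof
    show "f ` gcomp V g \<subseteq> gcomp W g" using f by (auto simp: graded_linear_def)
    show "gcomp W g \<subseteq> f ` gcomp V g"
    proof
      fix y assume y: "y \<in> gcomp W g"
      then have "h y \<in> gcomp V g" "f (h y) = y"
        using h fh gcomp_gtotal[OF W] by (auto simp: graded_linear_def)
      then show "y \<in> f ` gcomp V g" by (metis imageI)
    qed
  qed
  ultimately show ?thesis using f by (simp add: graded_linear_iso_def)
qed

lemma graded_linear_iso_inv:
  assumes V: "vector_space (gscale V)" and W: "vector_space (gscale W)"
    and f: "graded_linear_iso V W f"
  shows "graded_linear_iso W V (inv_into (gtotal V) f)"
proof -
  let ?h = "inv_into (gtotal V) f"
  have b: "bij_betw f (gtotal V) (gtotal W)" and f': "graded_linear V W f"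
    and im: "f ` gcomp V g = gcomp W g" for g
    using f by (auto simp: graded_linear_iso_def)
  have fh: "f (?h y) = y" "?h y \<in> gtotal V" if "y \<in> gtotal W" for y
    using that b by (simp_all add: bij_betw_inv_into_right) (metis bij_betw_def inv_into_into)
  have hf: "?h (f x) = x" if "x \<in> gtotal V" for x
    using that b by (simp add: bij_betw_inv_into_left)
  have "graded_linear W V ?h"
    unfolding graded_linear_def
  proof (intro conjI allI ballI)
    fix x y assume xy: "x \<in> gtotal W" "y \<in> gtotal W"
    have "f (?h x + ?h y) = x + y" using f' fh xy by (simp add: graded_linear_def)
    then show "?h (x + y) = ?h x + ?h y" using hf gtotal_add[OF V] fh xy by metis
  next
    fix c x assume x: "x \<in> gtotal W"
    have "f (gscale V c (?h x)) = gscale W c x" using f' fh x by (simp add: graded_linear_def)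
    then show "?h (gscale W c x) = gscale V c (?h x)" using hf gtotal_scale[OF V] fh x by metis
  next
    fix g x assume "x \<in> gcomp W g"
    then obtain v where "v \<in> gcomp V g" "x = f v" using im by blast
    then show "?h x \<in> gcomp V g" using hf gcomp_gtotal[OF V] by auto
  qed
  from graded_linear_isoI[OF W V this f' fh(1) hf] show ?thesis .
qed

lemma graded_linear_iso_comp:
  assumes "vector_space (gscale V)" "vector_space (gscale W)"
    and f: "graded_linear_iso U V f" and h: "graded_linear_iso V W h"
    and U: "vector_space (gscale U)"
  shows "graded_linear_iso U W (h \<circ> f)"
  unfolding graded_linear_iso_def
proof (intro conjI allI)
  have g: "f x \<in> gtotal V" if "x \<in> gtotal U" for x
    using that graded_linear_gtotal[OF U assms(1)] f by (auto simp: graded_linear_iso_def)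
  show "graded_linear U W (h \<circ> f)"
    using f h g by (auto simp: graded_linear_iso_def graded_linear_def)
  show "bij_betw (h \<circ> f) (gtotal U) (gtotal W)"
    using f h bij_betw_trans by (auto simp: graded_linear_iso_def)
  show "(h \<circ> f) ` gcomp U g = gcomp W g" for g
    using f h unfolding graded_linear_iso_def image_comp[symmetric] by simp
qed

lemma graded_algebra_vector_space: "graded_algebra A \<Longrightarrow> vector_space (gscale A)"
  by (simp add: graded_algebra_def graded_space_def)

text \<open>Closure under the product and the unit are assumed in place of
  \<open>graded_algebra\<close>, because these are the facts available for smash products when the
  lemma is applied to them.\<close>

lemma isomorphic_graded_algebras_sym:
  assumes A: "vector_space (gscale A)" and B: "vector_space (gscale B)"
    and one: "gone A \<in> gtotal A"
    and closed: "\<And>x y. x \<in> gtotal A \<Longrightarrow> y \<in> gtotal A \<Longrightarrow> gmult A x y \<in> gtotal A"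
    and "isomorphic_graded_algebras A B"
  shows "isomorphic_graded_algebras B A"
proof -
  obtain f where f: "graded_linear_iso A B f" "f (gone A) = gone B"
      "\<And>x y. x \<in> gtotal A \<Longrightarrow> y \<in> gtotal A \<Longrightarrow> f (gmult A x y) = gmult B (f x) (f y)"
    using assms(5) by (auto simp: isomorphic_graded_algebras_def graded_algebra_iso_def)
  let ?h = "inv_into (gtotal A) f"
  have b: "bij_betw f (gtotal A) (gtotal B)" using f(1) by (simp add: graded_linear_iso_def)
  have fh: "f (?h y) = y" "?h y \<in> gtotal A" if "y \<in> gtotal B" for y
    using that b by (simp_all add: bij_betw_inv_into_right) (metis bij_betw_def inv_into_into)
  have hf: "?h (f x) = x" if "x \<in> gtotal A" for x
    using that b by (simp add: bij_betw_inv_into_left)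
  have "?h (gmult B x y) = gmult A (?h x) (?h y)" if "x \<in> gtotal B" "y \<in> gtotal B" for x y
    using f(3)[of "?h x" "?h y"] fh that hf closed by metis
  moreover have "?h (gone B) = gone A" using hf one f(2) by metis
  ultimately show ?thesis
    using graded_linear_iso_inv[OF A B f(1)]
    by (auto simp: isomorphic_graded_algebras_def graded_algebra_iso_def)
qed

lemma isomorphic_graded_algebras_trans:
  assumes "vector_space (gscale A)" "vector_space (gscale B)" "vector_space (gscale C)"
    and "isomorphic_graded_algebras A B" "isomorphic_graded_algebras B C"
  shows "isomorphic_graded_algebras A C"
proof -
  obtain f h where f: "graded_algebra_iso A B f" and h: "graded_algebra_iso B C h"
    using assms by (auto simp: isomorphic_graded_algebras_def)
  have "f x \<in> gtotal B" if "x \<in> gtotal A" for x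
    using that graded_linear_gtotal[OF assms(1,2)] f
    by (auto simp: graded_linear_iso_def graded_algebra_iso_def)
  then have "graded_algebra_iso A C (h \<circ> f)"
    using f h graded_linear_iso_comp[OF assms(2,3) _ _ assms(1)]
    by (auto simp: graded_algebra_iso_def)
  then show ?thesis by (auto simp: isomorphic_graded_algebras_def)
qed

section \<open>Tensor products of graded spaces and maps out of them\<close>

lemma vector_space_tensor_space: "vector_space (gscale (tensor_space V W))"
  unfolding tensor_space_def tensor_scale_def
  by unfold_locales (auto simp: algebra_simps fun_eq_iff plus_fun_apply)

lemma tensor_add_left: "tensor V W (x + x') y = tensor V W x y + tensor V W x' y"
  and tensor_add_right: "tensor V W x (y + y') = tensor V W x y + tensor V W x y'"
  and tensor_scale_left: "tensor V W (gscale V c x) y = tensor_scale c (tensor V W x y)"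
  and tensor_scale_right: "tensor V W x (gscale W c y) = tensor_scale c (tensor V W x y)"
proof -
  have *: "b (x + x') y = b x y + b x' y \<and> b x (y + y') = b x y + b x y' \<and>
      b (gscale V c x) y = c * b x y \<and> b x (gscale W c y) = c * b x y"
    if "bilinear_form V W b" for b
  proof -
    interpret l: Vector_Spaces.linear "gscale V" "(*)" "\<lambda>x. b x y"
      using that by (simp add: bilinear_form_def)
    interpret r: Vector_Spaces.linear "gscale W" "(*)" "b x"
      using that by (simp add: bilinear_form_def)
    show ?thesis by (simp add: l.add r.add l.scale r.scale)
  qed
  show "tensor V W (x + x') y = tensor V W x y + tensor V W x' y"
    "tensor V W x (y + y') = tensor V W x y + tensor V W x y'"
    using * by (simp_all add: tensor_def fun_eq_iff plus_fun_apply)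
  show "tensor V W (gscale V c x) y = tensor_scale c (tensor V W x y)"
    using * by (simp add: tensor_def tensor_scale_def fun_eq_iff)
  have "b x (gscale W c y) = c * b x y" if "bilinear_form V W b" for b
    using *[OF that] by blast
  then show "tensor V W x (gscale W c y) = tensor_scale c (tensor V W x y)"
    by (simp add: tensor_def tensor_scale_def fun_eq_iff)
qed

lemma gcomp_tensor_space:
  "gcomp (tensor_space V W) m = module.span (gscale (tensor_space V W))
     {tensor V W x y | x y g h. x \<in> gcomp V g \<and> y \<in> gcomp W h \<and> g + h = m}"
  by (simp add: tensor_space_def)

lemma tensor_gcomp:
  assumes "x \<in> gcomp V g" "y \<in> gcomp W h"
  shows "tensor V W x y \<in> gcomp (tensor_space V W) (g + h)"
proof -
  interpret vector_space "gscale (tensor_space V W)"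
    by (rule vector_space_tensor_space)
  show ?thesis using assms unfolding gcomp_tensor_space by (blast intro: span_base)
qed

lemma subspace_gcomp_tensor_space:
  "module.subspace (gscale (tensor_space V W)) (gcomp (tensor_space V W) g)"
proof -
  interpret vector_space "gscale (tensor_space V W)"
    by (rule vector_space_tensor_space)
  show ?thesis by (simp add: gcomp_tensor_space)
qed

text \<open>The tensor space is generated by pure tensors of homogeneous elements; splitting one
  factor at a time into components reaches arbitrary pure tensors.\<close>

lemma tensor_gtotal:
  assumes V: "vector_space (gscale V)" and W: "vector_space (gscale W)"
    and "x \<in> gtotal V" "y \<in> gtotal W"
  shows "tensor V W x y \<in> gtotal (tensor_space V W)"
proof -
  note T = vector_space_tensor_space[of V W]
  have sc: "gscale (tensor_space V W) = tensor_scale" by (simp add: tensor_space_def)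
  interpret T: vector_space "gscale (tensor_space V W)"
    by (rule vector_space_tensor_space)
  have z: "tensor V W 0 y = 0" "tensor V W x 0 = 0" for x y
    using tensor_add_left[of V W 0 0 y] tensor_add_right[of V W x 0 0] by simp_all
  have *: "tensor V W x y \<in> gtotal (tensor_space V W)" if x: "x \<in> gcomp V g" for x g
    using W assms(4)
  proof (induction rule: gtotal_induct)
    case zero show ?case unfolding z by (rule gtotal_zero[OF T])
  next
    case (add y y') then show ?case by (simp add: tensor_add_right gtotal_add[OF T])
  next
    case (scale c y)
    then show ?case using gtotal_scale[OF T] by (simp add: tensor_scale_right sc)
  next
    case (comp h y)
    then show ?case using gcomp_gtotal[OF T] tensor_gcomp x by blast
  qed
  show ?thesis
    using V assms(3)
  proof (induction rule: gtotal_induct)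
    case zero show ?case unfolding z by (rule gtotal_zero[OF T])
  next
    case (add y y') then show ?case by (simp add: tensor_add_left gtotal_add[OF T])
  next
    case (scale c y)
    then show ?case using gtotal_scale[OF T] by (simp add: tensor_scale_left sc)
  next
    case (comp h y)
    then show ?case using * by blast
  qed
qed

text \<open>A scalar multiple of a pure tensor is again pure, so sums suffice and no case for
  scalars arises.\<close>

lemma tensor_space_total_induct [consumes 3, case_names add tensor]:
  assumes V: "vector_space (gscale V)" and W: "vector_space (gscale W)"
    and t: "t \<in> gtotal (tensor_space V W)"
    and add: "\<And>s t. s \<in> gtotal (tensor_space V W) \<Longrightarrow> t \<in> gtotal (tensor_space V W) \<Longrightarrow>
      P s \<Longrightarrow> P t \<Longrightarrow> P (s + t)"
    and tens: "\<And>x y. x \<in> gtotal V \<Longrightarrow> y \<in> gtotal W \<Longrightarrow> P (tensor V W x y)"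
  shows "P t"
proof -
  have sc: "gscale (tensor_space V W) = tensor_scale" by (simp add: tensor_space_def)
  interpret T: vector_space "gscale (tensor_space V W)"
    by (rule vector_space_tensor_space)
  have z: "tensor V W 0 y = 0" "tensor V W x 0 = 0" for x y
    using tensor_add_left[of V W 0 0 y] tensor_add_right[of V W x 0 0] by simp_all
  let ?S = "{tensor V W x y | x y. x \<in> gtotal V \<and> y \<in> gtotal W}"
  have "t \<in> T.span ?S"
  proof -
    have 1: "gcomp (tensor_space V W) g \<subseteq> T.span ?S" for g
      unfolding gcomp_tensor_space
      by (rule T.span_mono) (use gcomp_gtotal[OF V] gcomp_gtotal[OF W] in blast)
    have "gtotal (tensor_space V W) \<subseteq> T.span ?S"
      unfolding gtotal_def[of "tensor_space V W"] by (rule T.span_minimal) (use 1 in auto)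
    with t show ?thesis by blast
  qed
  then have "t \<in> gtotal (tensor_space V W) \<and> P t"
  proof (induction rule: T.span_induct_alt)
    case base
    show ?case using tens[OF gtotal_zero[OF V] gtotal_zero[OF W]]
        gtotal_zero[OF vector_space_tensor_space[of V W]] unfolding z by blast
  next
    case (step c s u)
    then obtain x y where s: "s = tensor V W x y" "x \<in> gtotal V" "y \<in> gtotal W" by blast
    then have cs: "gscale (tensor_space V W) c s = tensor V W (gscale V c x) y"
      by (simp add: tensor_scale_left sc)
    have cx: "gscale V c x \<in> gtotal V" by (rule gtotal_scale[OF V s(2)])
    have "gscale (tensor_space V W) c s \<in> gtotal (tensor_space V W)"
      "P (gscale (tensor_space V W) c s)"
      unfolding cs using tensor_gtotal[OF V W cx s(3)] tens[OF cx s(3)] by simp_all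
    then show ?case
      using add step gtotal_add[OF vector_space_tensor_space[of V W]] by auto
  qed
  then show ?thesis by simp
qed

definition bilinear_on_totals ::
    "('g, 'k::field, 'v::ab_group_add, 'z) gspace_scheme \<Rightarrow>
     ('g, 'k, 'w::ab_group_add, 'y) gspace_scheme \<Rightarrow> ('k \<Rightarrow> 'u::ab_group_add \<Rightarrow> 'u) \<Rightarrow>
     ('v \<Rightarrow> 'w \<Rightarrow> 'u) \<Rightarrow> bool" where
  "bilinear_on_totals V W s f \<longleftrightarrow>
     (\<forall>y\<in>gtotal W. linear_on_total V s (\<lambda>x. f x y)) \<and>
     (\<forall>x\<in>gtotal V. linear_on_total W s (f x))"

context
  fixes V :: "('g::comm_monoid_add, 'k::field, 'v::ab_group_add, 'z) gspace_scheme"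
    and W :: "('g, 'k, 'w::ab_group_add, 'y) gspace_scheme"
    and s and f :: "'v \<Rightarrow> 'w \<Rightarrow> 'u::ab_group_add"
  assumes V: "vector_space (gscale V)" and W: "vector_space (gscale W)" and U: "vector_space s"
    and f: "bilinear_on_totals V W s f"
begin

lemma tensor_lift_list:
  "set ps \<subseteq> gtotal V \<times> gtotal W \<Longrightarrow>
    tensor_lift V W f (\<Sum>(x, y)\<leftarrow>ps. tensor V W x y) = (\<Sum>(x, y)\<leftarrow>ps. f x y)"
  by (rule tensor_lift_sum[OF V W U])
    (use f in \<open>auto simp: bilinear_on_totals_def linear_on_total_def\<close>)

lemma tensor_lift_tensor:
  assumes "x \<in> gtotal V" "y \<in> gtotal W"
  shows "tensor_lift V W f (tensor V W x y) = f x y"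
  using tensor_lift_list[of "[(x, y)]"] assms by simp

lemma tensor_space_total_list:
  assumes "t \<in> gtotal (tensor_space V W)"
  shows "\<exists>ps. set ps \<subseteq> gtotal V \<times> gtotal W \<and> t = (\<Sum>(x, y)\<leftarrow>ps. tensor V W x y)"
  using V W assms
proof (induction rule: tensor_space_total_induct)
  case (add s t)
  then obtain ps qs where "set ps \<subseteq> gtotal V \<times> gtotal W" "s = (\<Sum>(x, y)\<leftarrow>ps. tensor V W x y)"
      "set qs \<subseteq> gtotal V \<times> gtotal W" "t = (\<Sum>(x, y)\<leftarrow>qs. tensor V W x y)" by blast
  then show ?case by (intro exI[of _ "ps @ qs"]) auto
next
  case (tensor x y)
  then show ?case by (intro exI[of _ "[(x, y)]"]) auto
qed

text \<open>The lift evaluates a chosen representation as a list of pure tensors. Independence of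
  that choice gives additivity: concatenating representations of two tensors represents their
  sum.\<close>

lemma tensor_lift_linear: "linear_on_total (tensor_space V W) s (tensor_lift V W f)"
proof -
  have sc: "gscale (tensor_space V W) = tensor_scale" by (simp add: tensor_space_def)
  note T = vector_space_tensor_space[of V W]
  interpret U: vector_space s by (rule U)
  interpret T: vector_space "gscale (tensor_space V W)"
    by (rule vector_space_tensor_space)
  have lift_add: "tensor_lift V W f (u + t) = tensor_lift V W f u + tensor_lift V W f t"
    if u: "u \<in> gtotal (tensor_space V W)" and t: "t \<in> gtotal (tensor_space V W)" for u t
  proof -
    obtain ps qs where *: "set ps \<subseteq> gtotal V \<times> gtotal W" "u = (\<Sum>(x, y)\<leftarrow>ps. tensor V W x y)"
      "set qs \<subseteq> gtotal V \<times> gtotal W" "t = (\<Sum>(x, y)\<leftarrow>qs. tensor V W x y)"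
      using tensor_space_total_list[OF u] tensor_space_total_list[OF t] by blast
    show ?thesis
      using tensor_lift_list[of "ps @ qs"] tensor_lift_list[of ps] tensor_lift_list[of qs] *
      by simp
  qed
  have lift_scale: "tensor_lift V W f (gscale (tensor_space V W) c t) = s c (tensor_lift V W f t)"
    if "t \<in> gtotal (tensor_space V W)" for c t
    using V W that
  proof (induction rule: tensor_space_total_induct)
    case (add u t)
    have "tensor_lift V W f (gscale (tensor_space V W) c (u + t)) =
        tensor_lift V W f (gscale (tensor_space V W) c u) +
        tensor_lift V W f (gscale (tensor_space V W) c t)"
      unfolding T.scale_right_distrib
      by (rule lift_add[OF gtotal_scale[OF T add(1)] gtotal_scale[OF T add(2)]])
    then show ?case
      by (simp only: add lift_add[OF add(1,2)] U.scale_right_distrib)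
  next
    case (tensor x y)
    then show ?case
      using tensor_lift_tensor[of "gscale V c x" y] f gtotal_scale[OF V tensor(1)]
      by (simp add: sc tensor_scale_left tensor_lift_tensor bilinear_on_totals_def linear_on_total_def)
  qed
  show ?thesis
    unfolding linear_on_total_def by (intro conjI ballI allI lift_add lift_scale)
qed

end

lemma tensor_space_linear_eq:
  assumes "vector_space (gscale V)" "vector_space (gscale W)"
    and "linear_on_total (tensor_space V W) s f" "linear_on_total (tensor_space V W) s h"
    and "\<And>x y. x \<in> gtotal V \<Longrightarrow> y \<in> gtotal W \<Longrightarrow> f (tensor V W x y) = h (tensor V W x y)"
    and "t \<in> gtotal (tensor_space V W)"
  shows "f t = h t"
  using assms(1,2,6)
proof (induction rule: tensor_space_total_induct)
  case (add s t)
  then have "f (s + t) = f s + f t" "h (s + t) = h s + h t"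
    using assms(3,4) unfolding linear_on_total_def by blast+
  then show ?case by (simp only: add)
qed (rule assms(5))

lemma tensor_space_graded_linearI:
  fixes V :: "('g::comm_monoid_add, 'k::field, 'v::ab_group_add, 'z) gspace_scheme"
    and W :: "('g, 'k, 'w::ab_group_add, 'y) gspace_scheme"
    and U :: "('g, 'k, 'u::ab_group_add, 'q) gspace_scheme"
  assumes V: "vector_space (gscale V)" and W: "vector_space (gscale W)"
    and U: "vector_space (gscale U)" "\<And>g. module.subspace (gscale U) (gcomp U g)"
    and lin: "linear_on_total (tensor_space V W) (gscale U) f"
    and comp: "\<And>g h x y. x \<in> gcomp V g \<Longrightarrow> y \<in> gcomp W h \<Longrightarrow> f (tensor V W x y) \<in> gcomp U (g + h)"
  shows "graded_linear (tensor_space V W) U f"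
  unfolding graded_linear_iff
proof (intro conjI allI ballI)
  fix m t assume t: "t \<in> gcomp (tensor_space V W) m"
  note T = vector_space_tensor_space[of V W]
  interpret T: vector_space "gscale (tensor_space V W)" by (rule T)
  interpret U: vector_space "gscale U" by (rule U)
  let ?S = "{tensor V W x y |x y g h. x \<in> gcomp V g \<and> y \<in> gcomp W h \<and> g + h = m}"
  have "t \<in> T.span ?S" using t by (simp add: gcomp_tensor_space)
  then have "t \<in> gtotal (tensor_space V W) \<and> f t \<in> gcomp U m"
  proof (induction rule: T.span_induct_alt)
    case base
    show ?case using gtotal_zero[OF T] U.subspace_0[OF U(2), of m]
      by (simp only: linear_on_total_zero[OF T lin] simp_thms)
  next
    case (step c x y)
    then have x: "x \<in> gtotal (tensor_space V W)" "f x \<in> gcomp U m"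
      using gcomp_gtotal[OF T] tensor_gcomp comp by blast+
    have cx: "gscale (tensor_space V W) c x \<in> gtotal (tensor_space V W)"
      by (rule gtotal_scale[OF T x(1)])
    have "f (gscale (tensor_space V W) c x + y) = gscale U c (f x) + f y"
      using cx x step lin unfolding linear_on_total_def by simp
    then show ?case
      using gtotal_add[OF T cx] step x(2) U.subspace_add[OF U(2)] U.subspace_scale[OF U(2)] by auto
  qed
  then show "f t \<in> gcomp U m" by simp
qed (rule lin)

definition graded_algebra_hom ::
    "('g, 'k::field, 'v::ab_group_add, 'z) galgebra_scheme \<Rightarrow>
     ('g, 'k, 'w::ab_group_add, 'y) galgebra_scheme \<Rightarrow> ('v \<Rightarrow> 'w) \<Rightarrow> bool" where
  "graded_algebra_hom A B f \<longleftrightarrow>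
     graded_linear A B f \<and> f (gone A) = gone B \<and>
     (\<forall>x\<in>gtotal A. \<forall>y\<in>gtotal A. f (gmult A x y) = gmult B (f x) (f y))"

lemma graded_algebra_mult_gcomp:
  "graded_algebra A \<Longrightarrow> x \<in> gcomp A g \<Longrightarrow> y \<in> gcomp A h \<Longrightarrow> gmult A x y \<in> gcomp A (g + h)"
  by (simp add: graded_algebra_def)

lemma graded_algebra_mult_gtotal:
  assumes A: "graded_algebra A" and "x \<in> gtotal A" "y \<in> gtotal A"
  shows "gmult A x y \<in> gtotal A"
proof -
  note V = graded_algebra_vector_space[OF A]
  interpret vector_space "gscale A" by (rule V)
  have L: "gmult A (u + v) w = gmult A u w + gmult A v w"
    "gmult A w (u + v) = gmult A w u + gmult A w v"
    if "u \<in> gtotal A" "v \<in> gtotal A" "w \<in> gtotal A" for u v w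
    using A that by (auto simp: graded_algebra_def)
  have S: "gmult A (gscale A c u) w = gscale A c (gmult A u w)"
    "gmult A w (gscale A c u) = gscale A c (gmult A w u)"
    if "u \<in> gtotal A" "w \<in> gtotal A" for u w c
    using A that by (auto simp: graded_algebra_def)
  have z: "gmult A 0 w = 0" "gmult A w 0 = 0" if "w \<in> gtotal A" for w
    using L[OF gtotal_zero[OF V] gtotal_zero[OF V] that] by simp_all
  have *: "gmult A x y \<in> gtotal A" if "x \<in> gcomp A g" for x g
    using V assms(3)
  proof (induction rule: gtotal_induct)
    case (comp h y)
    then have "gmult A x y \<in> gcomp A (g + h)" using A that by (auto simp: graded_algebra_def)
    then show ?case by (rule gcomp_gtotal[OF V])
  next
    case zero
    show ?case using z[OF gcomp_gtotal[OF V that]] gtotal_zero[OF V] by simp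
  next
    case (add u v)
    then show ?case using L(2)[OF add(1,2) gcomp_gtotal[OF V that]] gtotal_add[OF V] by simp
  next
    case (scale c u)
    then show ?case using S(2)[OF scale(1) gcomp_gtotal[OF V that]] gtotal_scale[OF V] by simp
  qed
  show ?thesis
    using V assms(2)
  proof (induction rule: gtotal_induct)
    case zero
    show ?case using z[OF assms(3)] gtotal_zero[OF V] by simp
  next
    case (add u v)
    then show ?case using L(1)[OF add(1,2) assms(3)] gtotal_add[OF V] by simp
  next
    case (scale c u)
    then show ?case using S(1)[OF scale(1) assms(3)] gtotal_scale[OF V] by simp
  qed (rule *)
qed

section \<open>Algebras that factor into two subalgebras\<close>

text \<open>\<open>compat\<close> says that \<open>R\<close> rewrites a product
  \<open>j d i c\<close> as a sum of products \<open>i c' j d'\<close>. Since the multiplication map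
  is injective, this determines \<open>R\<close>, and every identity in the smash product can be
  verified inside the associative algebra \<open>E\<close>.\<close>

locale smash_factorization =
  fixes C :: "('g::comm_monoid_add, 'k::field, 'v::ab_group_add) galgebra"
    and D :: "('g, 'k, 'w::ab_group_add) galgebra"
    and E :: "('g, 'k, 'u::ab_group_add) galgebra"
    and R i j
  assumes C: "graded_algebra C" and D: "graded_algebra D" and E: "graded_algebra E"
    and i: "graded_algebra_hom C E i" and j: "graded_algebra_hom D E j"
    and R: "graded_linear (tensor_space D C) (tensor_space C D) R"
    and iso: "graded_linear_iso (tensor_space C D) E
      (tensor_lift C D (\<lambda>c d. gmult E (i c) (j d)))"
    and compat: "\<And>c d. c \<in> gtotal C \<Longrightarrow> d \<in> gtotal D \<Longrightarrow>
      tensor_lift C D (\<lambda>c d. gmult E (i c) (j d)) (R (tensor D C d c)) = gmult E (j d) (i c)"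
begin

abbreviation "m \<equiv> tensor_lift C D (\<lambda>c d. gmult E (i c) (j d))"
abbreviation "T \<equiv> tensor_space C D"

lemmas vs = graded_algebra_vector_space[OF C] graded_algebra_vector_space[OF D]
  graded_algebra_vector_space[OF E]

lemma vT: "vector_space (gscale T)" "vector_space (gscale (tensor_space D C))"
  by (rule vector_space_tensor_space)+

lemma i_total: "c \<in> gtotal C \<Longrightarrow> i c \<in> gtotal E"
  and j_total: "d \<in> gtotal D \<Longrightarrow> j d \<in> gtotal E"
  using i j graded_linear_gtotal vs by (auto simp: graded_algebra_hom_def)

lemma E_mult [simp]:
  "x \<in> gtotal E \<Longrightarrow> y \<in> gtotal E \<Longrightarrow> gmult E x y \<in> gtotal E"
  by (rule graded_algebra_mult_gtotal[OF E])

lemma assoc: "x \<in> gtotal E \<Longrightarrow> y \<in> gtotal E \<Longrightarrow> z \<in> gtotal E \<Longrightarrow>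
    gmult E (gmult E x y) z = gmult E x (gmult E y z)"
  and distrib: "x \<in> gtotal E \<Longrightarrow> y \<in> gtotal E \<Longrightarrow> z \<in> gtotal E \<Longrightarrow>
    gmult E (x + y) z = gmult E x z + gmult E y z"
    "x \<in> gtotal E \<Longrightarrow> y \<in> gtotal E \<Longrightarrow> z \<in> gtotal E \<Longrightarrow>
    gmult E z (x + y) = gmult E z x + gmult E z y"
  and scales: "x \<in> gtotal E \<Longrightarrow> y \<in> gtotal E \<Longrightarrow> gmult E (gscale E a x) y = gscale E a (gmult E x y)"
    "x \<in> gtotal E \<Longrightarrow> y \<in> gtotal E \<Longrightarrow> gmult E x (gscale E a y) = gscale E a (gmult E x y)"
  using E by (auto simp: graded_algebra_def)

lemma m_bilinear: "bilinear_on_totals C D (gscale E) (\<lambda>c d. gmult E (i c) (j d))"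
  unfolding bilinear_on_totals_def linear_on_total_def
  using i j i_total j_total
  by (auto simp: graded_algebra_hom_def graded_linear_def distrib scales)

lemma m_tensor: "c \<in> gtotal C \<Longrightarrow> d \<in> gtotal D \<Longrightarrow> m (tensor C D c d) = gmult E (i c) (j d)"
  by (rule tensor_lift_tensor[OF vs m_bilinear])

lemma m_linear: "linear_on_total T (gscale E) m"
  by (rule tensor_lift_linear[OF vs m_bilinear])

lemma m_total: "t \<in> gtotal T \<Longrightarrow> m t \<in> gtotal E"
  using iso bij_betwE by (fastforce simp: graded_linear_iso_def)

lemma m_inj: "s \<in> gtotal T \<Longrightarrow> t \<in> gtotal T \<Longrightarrow> m s = m t \<longleftrightarrow> s = t"
  using iso by (auto simp: graded_linear_iso_def bij_betw_def inj_on_def)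

lemma R_total: "t \<in> gtotal (tensor_space D C) \<Longrightarrow> R t \<in> gtotal T"
  by (rule graded_linear_gtotal[OF vT(2,1) R])

text \<open>Bilinearity of the maps that define the product is checked after applying \<open>m\<close>, which is
  linear and injective.\<close>

lemma bilinear_through_m:
  assumes total: "\<And>x y. x \<in> gtotal C \<Longrightarrow> y \<in> gtotal D \<Longrightarrow> f x y \<in> gtotal T"
    and m: "bilinear_on_totals C D (gscale E) (\<lambda>x y. m (f x y))"
  shows "bilinear_on_totals C D (gscale T) f"
proof -
  have add: "f x y = f x' y' + f x'' y''"
    if "m (f x y) = m (f x' y') + m (f x'' y'')" "x \<in> gtotal C" "y \<in> gtotal D"
      "x' \<in> gtotal C" "y' \<in> gtotal D" "x'' \<in> gtotal C" "y'' \<in> gtotal D" for x y x' y' x'' y''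
  proof -
    have "m (f x' y' + f x'' y'') = m (f x' y') + m (f x'' y'')"
      using m_linear total that unfolding linear_on_total_def by blast
    then show ?thesis using m_inj total gtotal_add[OF vT(1)] that by metis
  qed
  have scale: "f x y = gscale T c (f x' y')"
    if "m (f x y) = gscale E c (m (f x' y'))" "x \<in> gtotal C" "y \<in> gtotal D"
      "x' \<in> gtotal C" "y' \<in> gtotal D" for x y x' y' c
  proof -
    have "m (gscale T c (f x' y')) = gscale E c (m (f x' y'))"
      using m_linear total that unfolding linear_on_total_def by blast
    then show ?thesis using m_inj total gtotal_scale[OF vT(1)] that by metis
  qed
  show ?thesis
    unfolding bilinear_on_totals_def linear_on_total_def
    by (intro conjI ballI allI add scale)
      (use m vs gtotal_add gtotal_scale in \<open>auto simp: bilinear_on_totals_def linear_on_total_def\<close>)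
qed

text \<open>The smash multiplication consists of three nested lifts. Seen through \<open>m\<close>,
  each of them multiplies by a fixed \<open>p\<close> on the left and a fixed \<open>q\<close> on
  the right, so one argument serves for all three.\<close>

lemma tensor_lift_through_m:
  assumes total: "\<And>x y. x \<in> gtotal C \<Longrightarrow> y \<in> gtotal D \<Longrightarrow> f x y \<in> gtotal T"
    and m: "\<And>x y. x \<in> gtotal C \<Longrightarrow> y \<in> gtotal D \<Longrightarrow>
      m (f x y) = gmult E p (gmult E (gmult E (i x) (j y)) q)"
    and pq: "p \<in> gtotal E" "q \<in> gtotal E"
    and t: "t \<in> gtotal T"
  shows "tensor_lift C D f t \<in> gtotal T"
    and "m (tensor_lift C D f t) = gmult E p (gmult E (m t) q)"
    and "linear_on_total T (gscale T) (tensor_lift C D f)"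
proof -
  have b: "bilinear_on_totals C D (gscale T) f"
  proof (rule bilinear_through_m[OF total])
    show "bilinear_on_totals C D (gscale E) (\<lambda>x y. m (f x y))"
      unfolding bilinear_on_totals_def linear_on_total_def
      using m_bilinear pq i_total j_total vs
      by (auto simp: m bilinear_on_totals_def linear_on_total_def distrib scales gtotal_add gtotal_scale)
  qed
  note lin = tensor_lift_linear[OF vs(1,2) vT(1) b]
  show "linear_on_total T (gscale T) (tensor_lift C D f)" by (rule lin)
  have "tensor_lift C D f t \<in> gtotal T \<and> m (tensor_lift C D f t) = gmult E p (gmult E (m t) q)"
    using vs(1,2) t
  proof (induction rule: tensor_space_total_induct)
    case (add s t)
    have "tensor_lift C D f (s + t) = tensor_lift C D f s + tensor_lift C D f t"
      using lin add(1,2) unfolding linear_on_total_def by blast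
    moreover have "m (s + t) = m s + m t"
      using m_linear add(1,2) unfolding linear_on_total_def by blast
    moreover have "m (tensor_lift C D f s + tensor_lift C D f t) =
        m (tensor_lift C D f s) + m (tensor_lift C D f t)"
      using m_linear add(3,4) unfolding linear_on_total_def by blast
    ultimately show ?case
      using add gtotal_add[OF vT(1)] m_total[OF add(1)] m_total[OF add(2)] pq
      by (simp add: distrib)
  next
    case (tensor x y)
    then show ?case
      by (simp add: tensor_lift_tensor[OF vs(1,2) vT(1) b] total m m_tensor)
  qed
  then show "tensor_lift C D f t \<in> gtotal T"
    "m (tensor_lift C D f t) = gmult E p (gmult E (m t) q)" by simp_all
qed

lemma one_total: "gone C \<in> gtotal C" "gone D \<in> gtotal D" "gone E \<in> gtotal E"
  using C D E vs gcomp_gtotal by (auto simp: graded_algebra_def)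

lemma E_one: "x \<in> gtotal E \<Longrightarrow> gmult E (gone E) x = x" "x \<in> gtotal E \<Longrightarrow> gmult E x (gone E) = x"
  using E by (auto simp: graded_algebra_def)

lemma inner_product:
  assumes "c \<in> gtotal C" "d \<in> gtotal D" "r \<in> gtotal T"
  defines "f \<equiv> \<lambda>u v. tensor C D (gmult C c u) (gmult D v d)"
  shows "tensor_lift C D f r \<in> gtotal T"
    and "m (tensor_lift C D f r) = gmult E (i c) (gmult E (m r) (j d))"
proof -
  have cl: "gmult C c x \<in> gtotal C" "gmult D y d \<in> gtotal D"
    if "x \<in> gtotal C" "y \<in> gtotal D" for x y
    using that assms graded_algebra_mult_gtotal C D by blast+
  have 1: "f x y \<in> gtotal T" if "x \<in> gtotal C" "y \<in> gtotal D" for x y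
    unfolding f_def by (rule tensor_gtotal[OF vs(1,2) cl[OF that]])
  have 2: "m (f x y) = gmult E (i c) (gmult E (gmult E (i x) (j y)) (j d))"
    if "x \<in> gtotal C" "y \<in> gtotal D" for x y
    using that i j assms i_total j_total
    by (simp add: f_def m_tensor[OF cl] graded_algebra_hom_def assoc)
  show "tensor_lift C D f r \<in> gtotal T"
    "m (tensor_lift C D f r) = gmult E (i c) (gmult E (m r) (j d))"
    using tensor_lift_through_m[OF 1 2 i_total j_total] assms by blast+
qed

lemma middle_product:
  assumes "c \<in> gtotal C" "d \<in> gtotal D" "t \<in> gtotal T"
  defines "f \<equiv> \<lambda>c' d'. tensor_lift C D (\<lambda>u v. tensor C D (gmult C c u) (gmult D v d'))
               (R (tensor D C d c'))"
  shows "tensor_lift C D f t \<in> gtotal T"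
    and "m (tensor_lift C D f t) = gmult E (gmult E (i c) (j d)) (m t)"
proof -
  have Rt: "R (tensor D C d x) \<in> gtotal T" if "x \<in> gtotal C" for x
    by (rule R_total[OF tensor_gtotal[OF vs(2,1) assms(2) that]])
  have 1: "f x y \<in> gtotal T" if "x \<in> gtotal C" "y \<in> gtotal D" for x y
    unfolding f_def by (rule inner_product(1)[OF assms(1) that(2) Rt[OF that(1)]])
  \<comment> \<open>Here \<open>compat\<close> turns \<open>i c (m (R (d \<otimes> x))) j y\<close>
    into \<open>i c j d i x j y\<close>; the right factor \<open>q\<close> is the unit.\<close>
  have 2: "m (f x y) = gmult E (gmult E (i c) (j d)) (gmult E (gmult E (i x) (j y)) (gone E))"
    if "x \<in> gtotal C" "y \<in> gtotal D" for x y
    unfolding f_def inner_product(2)[OF assms(1) that(2) Rt[OF that(1)]] compat[OF that(1) assms(2)]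
    using that assms i_total j_total one_total(3) by (simp add: assoc E_one)
  have 3: "gmult E (i c) (j d) \<in> gtotal E" using assms i_total j_total by simp
  show "tensor_lift C D f t \<in> gtotal T"
    "m (tensor_lift C D f t) = gmult E (gmult E (i c) (j d)) (m t)"
    using tensor_lift_through_m(1,2)[OF 1 2 3 one_total(3) assms(3)] m_total[OF assms(3)]
    by (simp_all add: E_one)
qed

lemma smash_product:
  assumes "s \<in> gtotal T" "t \<in> gtotal T"
  shows "gmult (smash C D R) s t \<in> gtotal T"
    and "m (gmult (smash C D R) s t) = gmult E (m s) (m t)"
proof -
  define f where "f = (\<lambda>c d. tensor_lift C D (\<lambda>c' d'.
             tensor_lift C D (\<lambda>u v. tensor C D (gmult C c u) (gmult D v d'))
               (R (tensor D C d c'))) t)"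
  have st: "gmult (smash C D R) s t = tensor_lift C D f s"
    by (simp add: smash_def f_def)
  have 1: "f x y \<in> gtotal T" if "x \<in> gtotal C" "y \<in> gtotal D" for x y
    unfolding f_def by (rule middle_product(1)[OF that assms(2)])
  have 2: "m (f x y) = gmult E (gone E) (gmult E (gmult E (i x) (j y)) (m t))"
    if "x \<in> gtotal C" "y \<in> gtotal D" for x y
    unfolding f_def middle_product(2)[OF that assms(2)]
    using that m_total[OF assms(2)] i_total j_total by (simp add: E_one)
  show "gmult (smash C D R) s t \<in> gtotal T" "m (gmult (smash C D R) s t) = gmult E (m s) (m t)"
    unfolding st
    using tensor_lift_through_m(1,2)[OF 1 2 one_total(3) m_total assms(1)] assms m_total
    by (simp_all add: E_one)
qed

lemma gtotal_smash: "gtotal (smash C D R) = gtotal T"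
  by (simp add: gtotal_def smash_def)

lemma gone_smash: "gone (smash C D R) \<in> gtotal T" "m (gone (smash C D R)) = gone E"
  using tensor_gtotal[OF vs(1,2) one_total(1,2)] m_tensor[OF one_total(1,2)] i j one_total
  by (simp_all add: smash_def graded_algebra_hom_def E_one)

text \<open>\<open>m\<close> is injective and carries the smash multiplication to that of
  \<open>E\<close>, so associativity and the unit laws are pulled back.\<close>

theorem is_smash_product: "is_smash_product C D R"
  unfolding is_smash_product_def gtotal_smash
proof (intro conjI ballI)
  let ?p = "gmult (smash C D R)"
  show "?p (?p x y) z = ?p x (?p y z)" if "x \<in> gtotal T" "y \<in> gtotal T" "z \<in> gtotal T" for x y z
  proof -
    have "m (?p (?p x y) z) = m (?p x (?p y z))"
      using that by (simp only: smash_product assoc m_total)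
    then show ?thesis using m_inj smash_product(1) that by metis
  qed
  show "?p (gone (smash C D R)) x = x" if "x \<in> gtotal T" for x
  proof -
    have "m (?p (gone (smash C D R)) x) = m x"
      using that by (simp only: smash_product gone_smash E_one m_total)
    then show ?thesis using m_inj smash_product(1) that gone_smash(1) by metis
  qed
  show "?p x (gone (smash C D R)) = x" if "x \<in> gtotal T" for x
  proof -
    have "m (?p x (gone (smash C D R))) = m x"
      using that by (simp only: smash_product gone_smash E_one m_total)
    then show ?thesis using m_inj smash_product(1) that gone_smash(1) by metis
  qed
qed (rule R)

theorem smash_iso: "graded_algebra_iso (smash C D R) E m"
proof -
  have "graded_linear_iso (smash C D R) E m"
    using iso unfolding graded_linear_iso_def graded_linear_def gtotal_smash
    by (simp add: smash_def)
  then show ?thesis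
    unfolding graded_algebra_iso_def gtotal_smash using smash_product(2) gone_smash(2) by blast
qed

end

text \<open>The inverse of \<open>R\<close> satisfies \<open>compat\<close> with \<open>C\<close>
  and \<open>D\<close> exchanged, so the preceding locale applies to both orders. The second
  exported property recognises a value of \<open>R\<close> from any tensor \<open>u\<close> with the
  right product in \<open>E\<close>, which avoids computing with inverses of multiplication
  maps.\<close>

lemma smash_from_subalgebras:
  fixes C :: "('g::comm_monoid_add, 'k::field, 'v::ab_group_add) galgebra"
    and D :: "('g, 'k, 'w::ab_group_add) galgebra"
    and E :: "('g, 'k, 'u::ab_group_add) galgebra"
  assumes C: "graded_algebra C" and D: "graded_algebra D" and E: "graded_algebra E"
    and i: "graded_algebra_hom C E i" and j: "graded_algebra_hom D E j"
    and isoC: "graded_linear_iso (tensor_space C D) E (tensor_lift C D (\<lambda>c d. gmult E (i c) (j d)))"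
    and isoD: "graded_linear_iso (tensor_space D C) E (tensor_lift D C (\<lambda>d c. gmult E (j d) (i c)))"
  obtains R where "graded_linear_iso (tensor_space D C) (tensor_space C D) R"
    and "\<And>c d u. c \<in> gtotal C \<Longrightarrow> d \<in> gtotal D \<Longrightarrow> u \<in> gtotal (tensor_space C D) \<Longrightarrow>
      tensor_lift C D (\<lambda>c d. gmult E (i c) (j d)) u = gmult E (j d) (i c) \<Longrightarrow>
      R (tensor D C d c) = u"
    and "normal_twist C D R" "is_smash_product C D R"
    and "is_smash_product D C (inv_into (gtotal (tensor_space D C)) R)"
    and "isomorphic_graded_algebras E (smash C D R)"
    and "isomorphic_graded_algebras (smash C D R)
      (smash D C (inv_into (gtotal (tensor_space D C)) R))"
proof -
  let ?CD = "tensor_space C D" and ?DC = "tensor_space D C"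
  let ?m = "tensor_lift C D (\<lambda>c d. gmult E (i c) (j d))"
  let ?m' = "tensor_lift D C (\<lambda>d c. gmult E (j d) (i c))"
  note vs = graded_algebra_vector_space[OF C] graded_algebra_vector_space[OF D]
    graded_algebra_vector_space[OF E]
  note vT = vector_space_tensor_space[of C D] vector_space_tensor_space[of D C]
  define R where "R = inv_into (gtotal ?CD) ?m \<circ> ?m'"
  let ?S = "inv_into (gtotal ?DC) R"
  have Riso: "graded_linear_iso ?DC ?CD R"
    unfolding R_def
    by (rule graded_linear_iso_comp[OF vs(3) vT(1) isoD graded_linear_iso_inv[OF vT(1) vs(3) isoC] vT(2)])
  have Siso: "graded_linear_iso ?CD ?DC ?S" by (rule graded_linear_iso_inv[OF vT(2,1) Riso])
  have bm: "bij_betw ?m (gtotal ?CD) (gtotal E)" and bm': "bij_betw ?m' (gtotal ?DC) (gtotal E)"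
    and bR: "bij_betw R (gtotal ?DC) (gtotal ?CD)"
    using isoC isoD Riso unfolding graded_linear_iso_def by blast+
  have mR: "?m (R t) = ?m' t" if "t \<in> gtotal ?DC" for t
    unfolding R_def o_def by (rule bij_betw_inv_into_right[OF bm bij_betwE[OF bm', rule_format, OF that]])
  have mS: "?m' (?S t) = ?m t" if t: "t \<in> gtotal ?CD" for t
  proof -
    have "?S t \<in> gtotal ?DC" using bR t by (metis bij_betw_def inv_into_into)
    then have "?m' (?S t) = ?m (R (?S t))" by (rule mR[symmetric])
    then show ?thesis using bij_betw_inv_into_right[OF bR t] by simp
  qed
  have ij: "i c \<in> gtotal E" "j d \<in> gtotal E" if "c \<in> gtotal C" "d \<in> gtotal D" for c d
    using that graded_linear_gtotal[OF vs(1,3)] graded_linear_gtotal[OF vs(2,3)] i j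
    unfolding graded_algebra_hom_def by blast+
  have b: "bilinear_on_totals C D (gscale E) (\<lambda>c d. gmult E (i c) (j d))"
    "bilinear_on_totals D C (gscale E) (\<lambda>d c. gmult E (j d) (i c))"
    unfolding bilinear_on_totals_def linear_on_total_def
    using i j ij E by (auto simp: graded_algebra_hom_def graded_linear_def graded_algebra_def)
  have m_t: "?m (tensor C D c d) = gmult E (i c) (j d)"
    and m'_t: "?m' (tensor D C d c) = gmult E (j d) (i c)"
    if "c \<in> gtotal C" "d \<in> gtotal D" for c d
    by (rule tensor_lift_tensor[OF vs b(1) that] tensor_lift_tensor[OF vs(2,1,3) b(2) that(2,1)])+
  interpret CD: smash_factorization C D E R i j
  proof
    show "graded_linear ?DC ?CD R" using Riso by (simp add: graded_linear_iso_def)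
    show "?m (R (tensor D C d c)) = gmult E (j d) (i c)" if "c \<in> gtotal C" "d \<in> gtotal D" for c d
      using mR[OF tensor_gtotal[OF vs(2,1) that(2,1)]] m'_t[OF that] by simp
  qed (fact C D E i j isoC)+
  interpret DC: smash_factorization D C E ?S j i
  proof
    show "graded_linear ?CD ?DC ?S" using Siso by (simp add: graded_linear_iso_def)
    show "?m' (?S (tensor C D c d)) = gmult E (i c) (j d)" if "d \<in> gtotal D" "c \<in> gtotal C" for c d
      using mS[OF tensor_gtotal[OF vs(1,2) that(2,1)]] m_t[OF that(2,1)] by simp
  qed (fact C D E i j isoD)+
  have unique: "R (tensor D C d c) = u"
    if "c \<in> gtotal C" "d \<in> gtotal D" "u \<in> gtotal ?CD" "?m u = gmult E (j d) (i c)" for c d u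
    using CD.m_inj[OF CD.R_total[OF tensor_gtotal[OF vs(2,1) that(2,1)]] that(3)] CD.compat that(1,2,4)
    by simp
  have "normal_twist C D R"
    unfolding normal_twist_def
  proof (intro conjI ballI)
    note o = CD.one_total(1,2)
    have one: "i (gone C) = gone E" "j (gone D) = gone E"
      using i j by (simp_all add: graded_algebra_hom_def)
    show "R (tensor D C (gone D) c) = tensor C D c (gone D)" if "c \<in> gtotal C" for c
      by (rule unique[OF that o(2) tensor_gtotal[OF vs(1,2) that o(2)]])
        (simp add: m_t[OF that o(2)] one CD.E_one CD.i_total that)
    show "R (tensor D C d (gone C)) = tensor C D (gone C) d" if "d \<in> gtotal D" for d
      by (rule unique[OF o(1) that tensor_gtotal[OF vs(1,2) o(1) that]])
        (simp add: m_t[OF o(1) that] one CD.E_one CD.j_total that)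
  qed
  moreover have isos: "isomorphic_graded_algebras (smash C D R) E"
    "isomorphic_graded_algebras (smash D C ?S) E"
    using CD.smash_iso DC.smash_iso by (auto simp: isomorphic_graded_algebras_def)
  have v: "vector_space (gscale (smash C D R))" "vector_space (gscale (smash D C ?S))"
    using vT by (simp_all add: smash_def)
  have sym: "isomorphic_graded_algebras E (smash C D R)"
    "isomorphic_graded_algebras E (smash D C ?S)"
    using isomorphic_graded_algebras_sym[OF v(1) vs(3) _ _ isos(1)]
      isomorphic_graded_algebras_sym[OF v(2) vs(3) _ _ isos(2)]
      CD.gone_smash(1) DC.gone_smash(1) CD.smash_product(1) DC.smash_product(1)
    unfolding CD.gtotal_smash DC.gtotal_smash by blast+
  ultimately show ?thesis
    using that Riso unique CD.is_smash_product DC.is_smash_product sym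
      isomorphic_graded_algebras_trans[OF v(1) vs(3) v(2) isos(1) sym(2)] by blast
qed

text \<open>The algebra \<open>Z\<close> is spanned by \<open>1\<close> and \<open>\<zeta>\<close>, with coordinates \<open>\<kappa>\<^sub>0\<close> and \<open>\<kappa>\<^sub>1\<close>, and \<open>E\<close> is
  \<open>j D \<oplus> j D \<omega>\<close>, with coordinates \<open>p\<^sub>0\<close> and \<open>p\<^sub>1\<close>.\<close>

locale exterior_extension =
  fixes Z :: "('g::comm_monoid_add, 'k::field, 'v::ab_group_add) galgebra"
    and D :: "('g, 'k, 'w::ab_group_add) galgebra"
    and E :: "('g, 'k, 'u::ab_group_add) galgebra"
    and \<zeta> \<kappa>\<^sub>0 \<kappa>\<^sub>1 and dz :: 'g and j \<omega> p\<^sub>0 p\<^sub>1 and S S' :: "'w \<Rightarrow> 'w"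
  assumes Z: "graded_algebra Z" and D: "graded_algebra D" and E: "graded_algebra E"
    and \<zeta>: "\<zeta> \<in> gcomp Z dz" "gmult Z \<zeta> \<zeta> = 0"
    and \<kappa>: "linear_on_total Z (*) \<kappa>\<^sub>0" "linear_on_total Z (*) \<kappa>\<^sub>1"
      "\<kappa>\<^sub>0 (gone Z) = 1" "\<kappa>\<^sub>1 (gone Z) = 0" "\<kappa>\<^sub>0 \<zeta> = 0" "\<kappa>\<^sub>1 \<zeta> = 1"
      "\<And>g. g \<in> gtotal Z \<Longrightarrow> g = gscale Z (\<kappa>\<^sub>0 g) (gone Z) + gscale Z (\<kappa>\<^sub>1 g) \<zeta>"
      "\<And>g h. g \<in> gcomp Z h \<Longrightarrow> \<kappa>\<^sub>0 g \<noteq> 0 \<Longrightarrow> h = 0"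
      "\<And>g h. g \<in> gcomp Z h \<Longrightarrow> \<kappa>\<^sub>1 g \<noteq> 0 \<Longrightarrow> h = dz"
    and j: "graded_algebra_hom D E j"
    and \<omega>: "\<omega> \<in> gcomp E dz" "gmult E \<omega> \<omega> = 0"
    and p: "linear_on_total E (gscale D) p\<^sub>0" "linear_on_total E (gscale D) p\<^sub>1"
      "\<And>F h. F \<in> gcomp E h \<Longrightarrow> p\<^sub>0 F \<in> gcomp D h"
      "\<And>F h. F \<in> gcomp E h \<Longrightarrow> p\<^sub>1 F = 0 \<or> (\<exists>h'. dz + h' = h \<and> p\<^sub>1 F \<in> gcomp D h')"
      "\<And>F. F \<in> gtotal E \<Longrightarrow> F = j (p\<^sub>0 F) + gmult E (j (p\<^sub>1 F)) \<omega>"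
      "\<And>f f'. f \<in> gtotal D \<Longrightarrow> f' \<in> gtotal D \<Longrightarrow> p\<^sub>0 (j f + gmult E (j f') \<omega>) = f"
      "\<And>f f'. f \<in> gtotal D \<Longrightarrow> f' \<in> gtotal D \<Longrightarrow> p\<^sub>1 (j f + gmult E (j f') \<omega>) = f'"
    and S: "graded_linear D D S" "graded_linear D D S'"
      "\<And>f. f \<in> gtotal D \<Longrightarrow> S (S' f) = f"
      "\<And>f. f \<in> gtotal D \<Longrightarrow> gmult E \<omega> (j (S f)) = gmult E (j f) \<omega>"
begin

text \<open>The linear map that sends the unit to the unit and \<open>\<zeta>\<close> to
  \<open>\<omega>\<close>, written in coordinates and thereby defined on the whole type.\<close>

definition "i g = gscale E (\<kappa>\<^sub>0 g) (gone E) + gscale E (\<kappa>\<^sub>1 g) \<omega>"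

lemmas vs = graded_algebra_vector_space[OF Z] graded_algebra_vector_space[OF D]
  graded_algebra_vector_space[OF E]

sublocale vZ: vector_space "gscale Z" + vD: vector_space "gscale D" + vE: vector_space "gscale E"
  by (rule vs)+

lemma assoc: "x \<in> gtotal E \<Longrightarrow> y \<in> gtotal E \<Longrightarrow> z \<in> gtotal E \<Longrightarrow>
    gmult E (gmult E x y) z = gmult E x (gmult E y z)"
  and distrib: "x \<in> gtotal E \<Longrightarrow> y \<in> gtotal E \<Longrightarrow> z \<in> gtotal E \<Longrightarrow>
    gmult E (x + y) z = gmult E x z + gmult E y z"
    "x \<in> gtotal E \<Longrightarrow> y \<in> gtotal E \<Longrightarrow> z \<in> gtotal E \<Longrightarrow>
    gmult E z (x + y) = gmult E z x + gmult E z y"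
  and scales: "x \<in> gtotal E \<Longrightarrow> y \<in> gtotal E \<Longrightarrow> gmult E (gscale E a x) y = gscale E a (gmult E x y)"
    "x \<in> gtotal E \<Longrightarrow> y \<in> gtotal E \<Longrightarrow> gmult E x (gscale E a y) = gscale E a (gmult E x y)"
  using E by (auto simp: graded_algebra_def)

lemma subE: "module.subspace (gscale E) (gcomp E g)" and subD: "module.subspace (gscale D) (gcomp D g)"
  using E D by (auto simp: graded_algebra_def graded_space_def)

lemma E_mult: "x \<in> gtotal E \<Longrightarrow> y \<in> gtotal E \<Longrightarrow> gmult E x y \<in> gtotal E"
  by (rule graded_algebra_mult_gtotal[OF E])

lemma total [simp]: "\<omega> \<in> gtotal E" "gone E \<in> gtotal E" "\<zeta> \<in> gtotal Z" "gone Z \<in> gtotal Z"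
  using \<omega> \<zeta> E Z gcomp_gtotal vs by (auto simp: graded_algebra_def)

lemma E_one: "x \<in> gtotal E \<Longrightarrow> gmult E (gone E) x = x" "x \<in> gtotal E \<Longrightarrow> gmult E x (gone E) = x"
  using E by (auto simp: graded_algebra_def)

lemma j_total: "d \<in> gtotal D \<Longrightarrow> j d \<in> gtotal E"
  using j graded_linear_gtotal vs by (auto simp: graded_algebra_hom_def)

lemma i_total: "i g \<in> gtotal E"
  unfolding i_def by (intro gtotal_add gtotal_scale vs total)

lemma i_graded_linear: "graded_linear Z E i"
  unfolding graded_linear_def
proof (intro conjI allI ballI)
  fix g x assume x: "x \<in> gcomp Z g"
  have "gscale E (\<kappa>\<^sub>0 x) (gone E) \<in> gcomp E g"
    using \<kappa>(8)[OF x] E vE.subspace_0[OF subE] vE.subspace_scale[OF subE]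
    by (cases "\<kappa>\<^sub>0 x = 0") (auto simp: graded_algebra_def)
  moreover have "gscale E (\<kappa>\<^sub>1 x) \<omega> \<in> gcomp E g"
    using \<kappa>(9)[OF x] \<omega>(1) vE.subspace_0[OF subE] vE.subspace_scale[OF subE]
    by (cases "\<kappa>\<^sub>1 x = 0") auto
  ultimately show "i x \<in> gcomp E g"
    unfolding i_def by (rule vE.subspace_add[OF subE])
qed (use \<kappa>(1,2) in \<open>auto simp: linear_on_total_def i_def vE.scale_left_distrib vE.scale_right_distrib\<close>)

lemma i_special: "i (gone Z) = gone E" "i \<zeta> = \<omega>"
  by (simp_all add: i_def \<kappa>)

text \<open>The unit and \<open>\<zeta>\<close> span \<open>Z\<close>, so multiplicativity comes
  down to \<open>\<zeta>\<close> and \<open>\<omega>\<close> both having square zero.\<close>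

lemma i_hom: "graded_algebra_hom Z E i"
  unfolding graded_algebra_hom_def
proof (intro conjI ballI)
  show "graded_linear Z E i" by (rule i_graded_linear)
  show "i (gone Z) = gone E" by (rule i_special)
  fix x y assume xy: "x \<in> gtotal Z" "y \<in> gtotal Z"
  let ?a = "\<kappa>\<^sub>0 x" and ?b = "\<kappa>\<^sub>1 x" and ?c = "\<kappa>\<^sub>0 y" and ?d = "\<kappa>\<^sub>1 y"
  have Zm: "gmult Z (u + v) w = gmult Z u w + gmult Z v w" "gmult Z w (u + v) = gmult Z w u + gmult Z w v"
    if "u \<in> gtotal Z" "v \<in> gtotal Z" "w \<in> gtotal Z" for u v w
    using Z that by (auto simp: graded_algebra_def)
  have Zs: "gmult Z (gscale Z r u) w = gscale Z r (gmult Z u w)"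
    "gmult Z w (gscale Z r u) = gscale Z r (gmult Z w u)"
    if "u \<in> gtotal Z" "w \<in> gtotal Z" for u w r
    using Z that by (auto simp: graded_algebra_def)
  have Zo: "gmult Z (gone Z) u = u" "gmult Z u (gone Z) = u" if "u \<in> gtotal Z" for u
    using Z that by (auto simp: graded_algebra_def)
  have i_lin: "i (gscale Z r u) = gscale E r (i u)" "i (u + v) = i u + i v"
    if "u \<in> gtotal Z" "v \<in> gtotal Z" for r u v
    using i_graded_linear that by (auto simp: graded_linear_def)
  note i_scale = i_lin(1)[OF _ gtotal_zero[OF vs(1)]]
  have "gmult Z x y = gmult Z (gscale Z ?a (gone Z) + gscale Z ?b \<zeta>) (gscale Z ?c (gone Z) + gscale Z ?d \<zeta>)"
    using \<kappa>(7)[OF xy(1)] \<kappa>(7)[OF xy(2)] by simp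
  also have "\<dots> = gscale Z (?a * ?c) (gone Z) + gscale Z (?a * ?d + ?b * ?c) \<zeta>"
    by (simp add: Zm Zs Zo gtotal_add[OF vs(1)] gtotal_scale[OF vs(1)] \<zeta> vZ.scale_left_distrib
        vZ.scale_right_distrib algebra_simps)
  finally have "i (gmult Z x y) = gscale E (?a * ?c) (gone E) + gscale E (?a * ?d + ?b * ?c) \<omega>"
    by (simp add: i_lin(2) i_scale gtotal_scale[OF vs(1)] i_special)
  also have "\<dots> = gmult E (i x) (i y)"
    by (simp add: i_def distrib scales E_one gtotal_add[OF vs(3)] gtotal_scale[OF vs(3)] \<omega>
        vE.scale_left_distrib vE.scale_right_distrib algebra_simps)
  finally show "i (gmult Z x y) = gmult E (i x) (i y)" .
qed

lemma bilinear:
  "bilinear_on_totals Z D (gscale E) (\<lambda>c d. gmult E (i c) (j d))"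
  "bilinear_on_totals D Z (gscale E) (\<lambda>d c. gmult E (j d) (i c))"
  unfolding bilinear_on_totals_def linear_on_total_def
  using i_graded_linear j j_total i_total
  by (auto simp: graded_algebra_hom_def graded_linear_def distrib scales)

lemma S_total: "f \<in> gtotal D \<Longrightarrow> S f \<in> gtotal D" "f \<in> gtotal D \<Longrightarrow> S' f \<in> gtotal D"
  using graded_linear_gtotal[OF vs(2,2)] S by blast+

lemma p_total:
  assumes "F \<in> gtotal E"
  shows "p\<^sub>0 F \<in> gtotal D" "p\<^sub>1 F \<in> gtotal D"
proof -
  have "p\<^sub>0 F \<in> gtotal D \<and> p\<^sub>1 F \<in> gtotal D"
    using vs(3) assms
  proof (induction rule: gtotal_induct)
    case zero
    show ?case using p(1,2) linear_on_total_zero[OF vs(3)] gtotal_zero[OF vs(2)] by metis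
  next
    case (comp g x)
    then show ?case using p(3,4) gcomp_gtotal[OF vs(2)] gtotal_zero[OF vs(2)] by metis
  qed (use p(1,2) gtotal_add[OF vs(2)] gtotal_scale[OF vs(2)] in \<open>auto simp: linear_on_total_def\<close>)
  then show "p\<^sub>0 F \<in> gtotal D" "p\<^sub>1 F \<in> gtotal D" by simp_all
qed

text \<open>Serves the inverses of both multiplication maps: each is a sum of two maps into pure
  tensors, one for each coordinate of \<open>E\<close>.\<close>

lemma graded_linear_tensor_split:
  fixes V :: "('g, 'k, 'a::ab_group_add) galgebra" and W :: "('g, 'k, 'b::ab_group_add) galgebra"
  assumes "linear_on_total E tensor_scale f" "linear_on_total E tensor_scale h"
    and "\<And>F g. F \<in> gcomp E g \<Longrightarrow> f F \<in> gcomp (tensor_space V W) g"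
    and "\<And>F g. F \<in> gcomp E g \<Longrightarrow> h F \<in> gcomp (tensor_space V W) g"
  shows "graded_linear E (tensor_space V W) (\<lambda>F. f F + h F)"
proof -
  interpret T: vector_space "gscale (tensor_space V W)" by (rule vector_space_tensor_space)
  have sc: "gscale (tensor_space V W) = tensor_scale" by (simp add: tensor_space_def)
  show ?thesis
    unfolding graded_linear_def
  proof (intro conjI allI ballI)
    fix g x assume x: "x \<in> gcomp E g"
    show "f x + h x \<in> gcomp (tensor_space V W) g"
      by (rule T.subspace_add[OF subspace_gcomp_tensor_space assms(3,4)[OF x]])
  next
    fix x y assume "x \<in> gtotal E" "y \<in> gtotal E"
    then show "f (x + y) + h (x + y) = f x + h x + (f y + h y)"
      using assms(1,2) unfolding linear_on_total_def by (simp add: add_ac)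
  next
    fix c x assume "x \<in> gtotal E"
    then show "f (gscale E c x) + h (gscale E c x) = gscale (tensor_space V W) c (f x + h x)"
      using assms(1,2) T.scale_right_distrib unfolding linear_on_total_def sc by simp
  qed
qed

lemma gone_comp: "gone Z \<in> gcomp Z 0" using Z by (simp add: graded_algebra_def)

lemma m_right: "tensor_lift D Z (\<lambda>d c. gmult E (j d) (i c)) (tensor D Z f g) =
    j (gscale D (\<kappa>\<^sub>0 g) f) + gmult E (j (gscale D (\<kappa>\<^sub>1 g) f)) \<omega>"
  if "f \<in> gtotal D" "g \<in> gtotal Z"
proof -
  have "j (gscale D c f) = gscale E c (j f)" for c
    using j that by (auto simp: graded_algebra_hom_def graded_linear_def)
  then show ?thesis
    unfolding tensor_lift_tensor[OF vs(2,1,3) bilinear(2) that]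
    by (simp add: i_def distrib scales E_one gtotal_scale[OF vs(3)] j_total that)
qed

text \<open>Moving \<open>\<omega>\<close> from the left of \<open>j f\<close> to its right replaces
  \<open>f\<close> by \<open>S' f\<close>, as the commutation rule shows when applied to
  \<open>S' f\<close>.\<close>

lemma m_left: "tensor_lift Z D (\<lambda>c d. gmult E (i c) (j d)) (tensor Z D g f) =
    j (gscale D (\<kappa>\<^sub>0 g) f) + gmult E (j (gscale D (\<kappa>\<^sub>1 g) (S' f))) \<omega>"
  if "f \<in> gtotal D" "g \<in> gtotal Z"
proof -
  have *: "j (gscale D c f) = gscale E c (j f)" if "f \<in> gtotal D" for c f
    using j that by (auto simp: graded_algebra_hom_def graded_linear_def)
  have "gmult E \<omega> (j f) = gmult E (j (S' f)) \<omega>"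
    using S(4)[OF S_total(2)[OF that(1)]] S(3)[OF that(1)] by simp
  then show ?thesis
    unfolding tensor_lift_tensor[OF vs bilinear(1) that(2,1)]
    by (simp add: i_def distrib scales E_one gtotal_scale[OF vs(3)] j_total that * S_total)
qed

lemma iso_right:
  "graded_linear_iso (tensor_space D Z) E (tensor_lift D Z (\<lambda>d c. gmult E (j d) (i c)))"
  (is "graded_linear_iso _ _ ?m")
proof -
  let ?T = "tensor_space D Z"
  interpret T: vector_space "gscale (tensor_space D Z)" by (rule vector_space_tensor_space)
  have sc: "gscale (tensor_space D Z) = tensor_scale" by (simp add: tensor_space_def)
  \<comment> \<open>The inverse reads off both coordinates of \<open>F\<close>, which are taken with
    \<open>\<omega>\<close> on the right.\<close>
  let ?N = "\<lambda>F. tensor D Z (p\<^sub>0 F) (gone Z) + tensor D Z (p\<^sub>1 F) \<zeta>"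
  have N: "graded_linear E ?T ?N"
  proof (rule graded_linear_tensor_split)
    show "linear_on_total E tensor_scale (\<lambda>F. tensor D Z (p\<^sub>0 F) (gone Z))"
      "linear_on_total E tensor_scale (\<lambda>F. tensor D Z (p\<^sub>1 F) \<zeta>)"
      using p(1,2) by (simp_all add: linear_on_total_def tensor_add_left tensor_scale_left)
    fix F g assume F: "F \<in> gcomp E g"
    show "tensor D Z (p\<^sub>0 F) (gone Z) \<in> gcomp ?T g"
      using tensor_gcomp[OF p(3)[OF F] gone_comp] by simp
    show "tensor D Z (p\<^sub>1 F) \<zeta> \<in> gcomp ?T g"
    proof (cases "p\<^sub>1 F = 0")
      case True
      have "tensor D Z 0 \<zeta> = 0" using tensor_add_left[of D Z 0 0 \<zeta>] by simp
      then show ?thesis using True T.subspace_0[OF subspace_gcomp_tensor_space] by simp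
    next
      case False
      then obtain h' where "dz + h' = g" "p\<^sub>1 F \<in> gcomp D h'" using p(4)[OF F] by blast
      then show ?thesis using tensor_gcomp[OF _ \<zeta>(1)] by (metis add.commute)
    qed
  qed
  have m: "graded_linear ?T E ?m"
  proof (rule tensor_space_graded_linearI[OF vs(2,1,3) subE tensor_lift_linear[OF vs(2,1,3) bilinear(2)]])
    fix g h x y assume x: "x \<in> gcomp D g" and y: "y \<in> gcomp Z h"
    have "?m (tensor D Z x y) = gmult E (j x) (i y)"
      by (rule tensor_lift_tensor[OF vs(2,1,3) bilinear(2) gcomp_gtotal[OF vs(2) x] gcomp_gtotal[OF vs(1) y]])
    then show "?m (tensor D Z x y) \<in> gcomp E (g + h)"
      using j i_graded_linear x y E
      by (auto simp: graded_algebra_def graded_algebra_hom_def graded_linear_def)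
  qed
  show ?thesis
  proof (rule graded_linear_isoI[OF vector_space_tensor_space vs(3) m N])
    fix F assume F: "F \<in> gtotal E"
    have "?m (?N F) = ?m (tensor D Z (p\<^sub>0 F) (gone Z)) + ?m (tensor D Z (p\<^sub>1 F) \<zeta>)"
      using tensor_lift_linear[OF vs(2,1,3) bilinear(2)] tensor_gtotal[OF vs(2,1)] p_total[OF F]
      by (simp add: linear_on_total_def)
    also have "\<dots> = j (p\<^sub>0 F) + gmult E (j (p\<^sub>1 F)) \<omega>"
      using p_total[OF F] by (simp add: tensor_lift_tensor[OF vs(2,1,3) bilinear(2)] i_special E_one j_total)
    finally show "?m (?N F) = F" using p(5)[OF F] by simp
  next
    fix t assume t: "t \<in> gtotal ?T"
    have lin: "linear_on_total ?T tensor_scale (\<lambda>t. ?N (?m t))" "linear_on_total ?T tensor_scale (\<lambda>t. t)"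
      using N m graded_linear_gtotal[OF vector_space_tensor_space vs(3) m]
      unfolding graded_linear_def linear_on_total_def sc by auto
    show "?N (?m t) = t"
    proof (rule tensor_space_linear_eq[OF vs(2,1) lin _ t])
      fix f g assume fg: "f \<in> gtotal D" "g \<in> gtotal Z"
      have sf: "gscale D c f \<in> gtotal D" for c by (rule gtotal_scale[OF vs(2) fg(1)])
      have "?N (?m (tensor D Z f g)) = tensor D Z f (gscale Z (\<kappa>\<^sub>0 g) (gone Z) + gscale Z (\<kappa>\<^sub>1 g) \<zeta>)"
        unfolding m_right[OF fg] p(6)[OF sf sf] p(7)[OF sf sf] tensor_add_right tensor_scale_left
          tensor_scale_right by (rule refl)
      then show "?N (?m (tensor D Z f g)) = tensor D Z f g" using \<kappa>(7)[OF fg(2)] by simp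
    qed
  qed
qed

lemma iso_left:
  "graded_linear_iso (tensor_space Z D) E (tensor_lift Z D (\<lambda>c d. gmult E (i c) (j d)))"
  (is "graded_linear_iso _ _ ?m")
proof -
  let ?T = "tensor_space Z D"
  interpret T: vector_space "gscale (tensor_space Z D)" by (rule vector_space_tensor_space)
  have sc: "gscale (tensor_space Z D) = tensor_scale" by (simp add: tensor_space_def)
  \<comment> \<open>The coordinates refer to \<open>\<omega>\<close> on the right, while the tensors
    now have \<open>\<zeta>\<close> on the left. The rule
    \<open>\<omega> j (S f) = j f \<omega>\<close> therefore requires \<open>S\<close> on the second
    coordinate.\<close>
  let ?N = "\<lambda>F. tensor Z D (gone Z) (p\<^sub>0 F) + tensor Z D \<zeta> (S (p\<^sub>1 F))"
  have Slin: "x \<in> gtotal D \<Longrightarrow> y \<in> gtotal D \<Longrightarrow> S (x + y) = S x + S y"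
    "x \<in> gtotal D \<Longrightarrow> S (gscale D c x) = gscale D c (S x)" for c x y
    using S by (auto simp: graded_linear_def)
  have S0: "S 0 = 0" using Slin(1)[OF gtotal_zero[OF vs(2)] gtotal_zero[OF vs(2)]] by simp
  have N: "graded_linear E ?T ?N"
  proof (rule graded_linear_tensor_split)
    show "linear_on_total E tensor_scale (\<lambda>F. tensor Z D (gone Z) (p\<^sub>0 F))"
      "linear_on_total E tensor_scale (\<lambda>F. tensor Z D \<zeta> (S (p\<^sub>1 F)))"
      using p(1,2) p_total by (simp_all add: linear_on_total_def tensor_add_right tensor_scale_right Slin)
    fix F g assume F: "F \<in> gcomp E g"
    show "tensor Z D (gone Z) (p\<^sub>0 F) \<in> gcomp ?T g"
      using tensor_gcomp[OF gone_comp p(3)[OF F]] by simp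
    show "tensor Z D \<zeta> (S (p\<^sub>1 F)) \<in> gcomp ?T g"
    proof (cases "p\<^sub>1 F = 0")
      case True
      have "tensor Z D \<zeta> 0 = 0" using tensor_add_right[of Z D \<zeta> 0 0] by simp
      then show ?thesis using True S0 T.subspace_0[OF subspace_gcomp_tensor_space] by simp
    next
      case False
      then obtain h' where h: "dz + h' = g" "p\<^sub>1 F \<in> gcomp D h'" using p(4)[OF F] by blast
      then have "S (p\<^sub>1 F) \<in> gcomp D h'" using S by (auto simp: graded_linear_def)
      then show ?thesis using tensor_gcomp[OF \<zeta>(1)] h(1) by blast
    qed
  qed
  have m: "graded_linear ?T E ?m"
  proof (rule tensor_space_graded_linearI[OF vs subE tensor_lift_linear[OF vs bilinear(1)]])
    fix g h x y assume x: "x \<in> gcomp Z g" and y: "y \<in> gcomp D h"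
    have "?m (tensor Z D x y) = gmult E (i x) (j y)"
      by (rule tensor_lift_tensor[OF vs bilinear(1) gcomp_gtotal[OF vs(1) x] gcomp_gtotal[OF vs(2) y]])
    then show "?m (tensor Z D x y) \<in> gcomp E (g + h)"
      using j i_graded_linear x y E
      by (auto simp: graded_algebra_def graded_algebra_hom_def graded_linear_def)
  qed
  show ?thesis
  proof (rule graded_linear_isoI[OF vector_space_tensor_space vs(3) m N])
    fix F assume F: "F \<in> gtotal E"
    have "?m (?N F) = ?m (tensor Z D (gone Z) (p\<^sub>0 F)) + ?m (tensor Z D \<zeta> (S (p\<^sub>1 F)))"
      using tensor_lift_linear[OF vs bilinear(1)] tensor_gtotal[OF vs(1,2)] p_total[OF F] S_total
      by (simp add: linear_on_total_def)
    also have "\<dots> = j (p\<^sub>0 F) + gmult E (j (p\<^sub>1 F)) \<omega>"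
      using p_total[OF F] S_total S(4)
      by (simp add: tensor_lift_tensor[OF vs bilinear(1)] i_special E_one j_total)
    finally show "?m (?N F) = F" using p(5)[OF F] by simp
  next
    fix t assume t: "t \<in> gtotal ?T"
    have lin: "linear_on_total ?T tensor_scale (\<lambda>t. ?N (?m t))" "linear_on_total ?T tensor_scale (\<lambda>t. t)"
      using N m graded_linear_gtotal[OF vector_space_tensor_space vs(3) m]
      unfolding graded_linear_def linear_on_total_def sc by auto
    show "?N (?m t) = t"
    proof (rule tensor_space_linear_eq[OF vs(1,2) lin _ t])
      fix g f assume fg: "g \<in> gtotal Z" "f \<in> gtotal D"
      have sf: "gscale D c f \<in> gtotal D" "gscale D c (S' f) \<in> gtotal D" for c
        using gtotal_scale[OF vs(2)] fg(2) S_total by blast+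
      have Sf: "S (gscale D c (S' f)) = gscale D c f" for c
        using Slin(2) S_total fg(2) S(3) by simp
      have "?N (?m (tensor Z D g f)) = tensor Z D (gscale Z (\<kappa>\<^sub>0 g) (gone Z) + gscale Z (\<kappa>\<^sub>1 g) \<zeta>) f"
        unfolding m_left[OF fg(2,1)] p(6)[OF sf] p(7)[OF sf] Sf tensor_add_left tensor_scale_left
          tensor_scale_right by (rule refl)
      then show "?N (?m (tensor Z D g f)) = tensor Z D g f" using \<kappa>(7)[OF fg(1)] by simp
    qed
  qed
qed

text \<open>If \<open>\<kappa>\<^sub>0 g = 0\<close>, then \<open>i g\<close> is a multiple of
  \<open>\<omega>\<close>, and the commutation rule in \<open>E\<close> becomes the formula for
  \<open>R\<close> by uniqueness of its values.\<close>

theorem smash_decomposition: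
  obtains R where "graded_linear_iso (tensor_space D Z) (tensor_space Z D) R"
    and "\<And>f g. f \<in> gtotal D \<Longrightarrow> g \<in> gtotal Z \<Longrightarrow> \<kappa>\<^sub>0 g = 0 \<Longrightarrow>
      R (tensor D Z f g) = tensor Z D g (S f)"
    and "normal_twist Z D R" "is_smash_product Z D R"
    and "is_smash_product D Z (inv_into (gtotal (tensor_space D Z)) R)"
    and "isomorphic_graded_algebras E (smash Z D R)"
    and "isomorphic_graded_algebras (smash Z D R)
      (smash D Z (inv_into (gtotal (tensor_space D Z)) R))"
proof -
  obtain R where 1: "graded_linear_iso (tensor_space D Z) (tensor_space Z D) R"
    "\<And>c d u. c \<in> gtotal Z \<Longrightarrow> d \<in> gtotal D \<Longrightarrow> u \<in> gtotal (tensor_space Z D) \<Longrightarrow>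
      tensor_lift Z D (\<lambda>c d. gmult E (i c) (j d)) u = gmult E (j d) (i c) \<Longrightarrow>
      R (tensor D Z d c) = u"
    "normal_twist Z D R" "is_smash_product Z D R"
    "is_smash_product D Z (inv_into (gtotal (tensor_space D Z)) R)"
    "isomorphic_graded_algebras E (smash Z D R)"
    "isomorphic_graded_algebras (smash Z D R)
      (smash D Z (inv_into (gtotal (tensor_space D Z)) R))"
    using smash_from_subalgebras[OF Z D E i_hom j iso_left iso_right] by blast
  have "R (tensor D Z f g) = tensor Z D g (S f)"
    if fg: "f \<in> gtotal D" "g \<in> gtotal Z" "\<kappa>\<^sub>0 g = 0" for f g
  proof (rule 1(2)[OF fg(2,1) tensor_gtotal[OF vs(1,2) fg(2) S_total(1)[OF fg(1)]]])
    show "tensor_lift Z D (\<lambda>c d. gmult E (i c) (j d)) (tensor Z D g (S f)) = gmult E (j f) (i g)"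
      using fg S(4)[OF fg(1)]
      unfolding tensor_lift_tensor[OF vs bilinear(1) fg(2) S_total(1)[OF fg(1)]]
      by (simp add: i_def scales j_total S_total)
  qed
  then show ?thesis using that 1 by blast
qed

end

section \<open>Connected graded algebras\<close>

lemma graded_space_independent:
  assumes V: "graded_space V" and S: "finite S" and f: "\<And>g. g \<in> S \<Longrightarrow> f g \<in> gcomp V g"
    and sum: "(\<Sum>g\<in>S. f g) = 0" and g: "g \<in> S"
  shows "f g = 0"
proof -
  interpret vector_space "gscale V" using V by (simp add: graded_space_def)
  define F where "F = Abs_poly_mapping (\<lambda>g. if g \<in> S then f g else 0)"
  have "finite {g. (if g \<in> S then f g else 0) \<noteq> 0}"
    by (rule finite_subset[OF _ S]) auto
  then have F: "Poly_Mapping.lookup F = (\<lambda>g. if g \<in> S then f g else 0)"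
    unfolding F_def by (rule lookup_Abs_poly_mapping)
  have "(\<Sum>g\<in>Poly_Mapping.keys F. Poly_Mapping.lookup F g) = (\<Sum>g\<in>S. f g)"
  proof -
    have "(\<Sum>g\<in>Poly_Mapping.keys F. Poly_Mapping.lookup F g) = (\<Sum>g\<in>S. Poly_Mapping.lookup F g)"
      by (rule sum.mono_neutral_left[OF S]) (auto simp: F in_keys_iff split: if_splits)
    then show ?thesis by (simp add: F)
  qed
  moreover have "\<forall>g. Poly_Mapping.lookup F g \<in> gcomp V g"
    using V f subspace_0 by (auto simp: F graded_space_def)
  ultimately have "F = 0" using V sum unfolding graded_space_def by metis
  then have "Poly_Mapping.lookup F g = 0" by simp
  then show ?thesis using g by (simp add: F)
qed

text \<open>The sum of the components is direct as soon as there are additive maps that vanish on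
  all components but one and jointly separate the elements of that one. For functions and
  polynomials such maps are values and coefficients.\<close>

lemma graded_spaceI:
  fixes V :: "('g, 'k::field, 'v::ab_group_add, 'z) gspace_scheme"
    and \<pi> :: "'i \<Rightarrow> 'g \<Rightarrow> 'v \<Rightarrow> 'u::ab_group_add"
  assumes "vector_space (gscale V)" and "\<And>g. module.subspace (gscale V) (gcomp V g)"
    and add: "\<And>i g x y. \<pi> i g (x + y) = \<pi> i g x + \<pi> i g y"
    and zero: "\<And>i g h x. x \<in> gcomp V h \<Longrightarrow> h \<noteq> g \<Longrightarrow> \<pi> i g x = 0"
    and sep: "\<And>g x. x \<in> gcomp V g \<Longrightarrow> x \<noteq> 0 \<Longrightarrow> \<exists>i. \<pi> i g x \<noteq> 0"
  shows "graded_space V"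
  unfolding graded_space_def
proof (intro conjI allI impI)
  fix f :: "'g \<Rightarrow>\<^sub>0 'v"
  assume f: "\<forall>g. Poly_Mapping.lookup f g \<in> gcomp V g"
    and s: "(\<Sum>g\<in>Poly_Mapping.keys f. Poly_Mapping.lookup f g) = 0"
  have \<pi>0: "\<pi> i g 0 = 0" for i g using add[of i g 0 0] by simp
  have \<pi>s: "\<pi> i g (\<Sum>h\<in>H. w h) = (\<Sum>h\<in>H. \<pi> i g (w h))" for i g w and H :: "'g set"
    by (induction H rule: infinite_finite_induct) (simp_all add: \<pi>0 add)
  have "Poly_Mapping.lookup f g = 0" for g
  proof (rule ccontr)
    assume n: "Poly_Mapping.lookup f g \<noteq> 0"
    then obtain i where i: "\<pi> i g (Poly_Mapping.lookup f g) \<noteq> 0" using sep f by blast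
    have "(\<Sum>h\<in>Poly_Mapping.keys f. \<pi> i g (Poly_Mapping.lookup f h)) =
        (\<Sum>h\<in>Poly_Mapping.keys f. if h = g then \<pi> i g (Poly_Mapping.lookup f g) else 0)"
      by (intro sum.cong refl) (use zero f in \<open>metis (full_types)\<close>)
    then have "\<pi> i g (Poly_Mapping.lookup f g) = 0"
      using arg_cong[OF s, of "\<pi> i g"] n unfolding \<pi>s \<pi>0 by (simp add: in_keys_iff)
    with i show False by simp
  qed
  then show "f = 0" by (simp add: poly_mapping_eqI)
qed (use assms in auto)

text \<open>The homogeneous part of degree \<open>g\<close>, taken from a chosen decomposition. It
  is determined on \<open>gtotal V\<close> and arbitrary elsewhere.\<close>

definition gproj :: "('g, 'k::field, 'v::ab_group_add, 'z) gspace_scheme \<Rightarrow> 'g \<Rightarrow> 'v \<Rightarrow> 'v" where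
  "gproj V g x = (SOME f. (\<forall>h. f h \<in> gcomp V h) \<and> finite {h. f h \<noteq> 0} \<and> x = (\<Sum>h | f h \<noteq> 0. f h)) g"

context
  fixes V :: "('g, 'k::field, 'v::ab_group_add, 'z) gspace_scheme"
  assumes V: "graded_space V"
begin

lemma graded_space_vector_space: "vector_space (gscale V)"
  using V by (simp add: graded_space_def)

lemma gcomp_subspace: "module.subspace (gscale V) (gcomp V g)"
  using V by (simp add: graded_space_def)

lemma gcomp_zero: "0 \<in> gcomp V g"
  and gcomp_add: "x \<in> gcomp V g \<Longrightarrow> y \<in> gcomp V g \<Longrightarrow> x + y \<in> gcomp V g"
  and gcomp_scale: "x \<in> gcomp V g \<Longrightarrow> gscale V c x \<in> gcomp V g"
  and gcomp_minus: "x \<in> gcomp V g \<Longrightarrow> - x \<in> gcomp V g"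
  and gcomp_diff: "x \<in> gcomp V g \<Longrightarrow> y \<in> gcomp V g \<Longrightarrow> x - y \<in> gcomp V g"
proof -
  interpret vector_space "gscale V" by (rule graded_space_vector_space)
  note s = gcomp_subspace
  show "0 \<in> gcomp V g"
    "x \<in> gcomp V g \<Longrightarrow> y \<in> gcomp V g \<Longrightarrow> x + y \<in> gcomp V g"
    "x \<in> gcomp V g \<Longrightarrow> gscale V c x \<in> gcomp V g"
    "x \<in> gcomp V g \<Longrightarrow> - x \<in> gcomp V g"
    "x \<in> gcomp V g \<Longrightarrow> y \<in> gcomp V g \<Longrightarrow> x - y \<in> gcomp V g"
    using subspace_0[OF s] subspace_add[OF s] subspace_scale[OF s] subspace_neg[OF s]
      subspace_diff[OF s] by blast+
qed

lemma gcomp_sum: "(\<And>i. i \<in> I \<Longrightarrow> f i \<in> gcomp V g) \<Longrightarrow> (\<Sum>i\<in>I. f i) \<in> gcomp V g"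
  by (induction I rule: infinite_finite_induct) (simp_all add: gcomp_zero gcomp_add)

text \<open>Compare with the chosen decomposition on the union of the supports: the differences are
  homogeneous of distinct degrees with sum zero, so each is zero.\<close>

lemma gproj_unique:
  assumes S: "finite S" and f: "\<And>g. f g \<in> gcomp V g" "\<And>g. g \<notin> S \<Longrightarrow> f g = 0"
    and x: "x = (\<Sum>g\<in>S. f g)"
  shows "gproj V g x = f g"
proof -
  have fin: "finite {h. f h \<noteq> 0}" by (rule finite_subset[OF _ S]) (use f(2) in auto)
  have "(\<forall>h. f h \<in> gcomp V h) \<and> finite {h. f h \<noteq> 0} \<and> x = (\<Sum>h | f h \<noteq> 0. f h)"
    using f fin S unfolding x by (auto intro!: sum.mono_neutral_right)
  then have *: "\<exists>f. (\<forall>h. f h \<in> gcomp V h) \<and> finite {h. f h \<noteq> 0} \<and> x = (\<Sum>h | f h \<noteq> 0. f h)" by blast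
  define f' where "f' = (SOME f. (\<forall>h. f h \<in> gcomp V h) \<and> finite {h. f h \<noteq> 0} \<and> x = (\<Sum>h | f h \<noteq> 0. f h))"
  have f': "\<forall>h. f' h \<in> gcomp V h" "finite {h. f' h \<noteq> 0}" "x = (\<Sum>h | f' h \<noteq> 0. f' h)"
    using someI_ex[OF *] unfolding f'_def by blast+
  let ?T = "insert g (S \<union> {h. f' h \<noteq> 0})"
  have T: "finite ?T" using S f'(2) by simp
  have "(\<Sum>h\<in>?T. f h) = x"
    unfolding x by (rule sum.mono_neutral_right[OF T]) (use f(2) in auto)
  moreover have "(\<Sum>h\<in>?T. f' h) = x"
    by (rule trans[OF sum.mono_neutral_right[OF T] f'(3)[symmetric]]) auto
  ultimately have "(\<Sum>h\<in>?T. f' h - f h) = 0" by (simp add: sum_subtractf)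
  from graded_space_independent[OF V T _ this, of g] have "f' g - f g = 0"
    using f(1) f'(1) gcomp_diff by blast
  then show ?thesis by (simp add: gproj_def f'_def)
qed

lemma gproj_comp: "x \<in> gcomp V g \<Longrightarrow> gproj V h x = (if h = g then x else 0)"
  by (rule gproj_unique[of "{g}"]) (auto simp: gcomp_zero)

lemma gproj_exists:
  assumes "x \<in> gtotal V"
  shows "\<exists>S f. finite S \<and> (\<forall>g. f g \<in> gcomp V g) \<and> (\<forall>g. g \<notin> S \<longrightarrow> f g = 0) \<and> x = (\<Sum>g\<in>S. f g)"
  using graded_space_vector_space assms
proof (induction rule: gtotal_induct)
  case zero
  show ?case by (rule exI[of _ "{}"], rule exI[of _ "\<lambda>_. 0"]) (simp add: gcomp_zero)
next
  case (add x y)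
  then obtain S f T h where *: "finite S" "\<forall>g. f g \<in> gcomp V g" "\<forall>g. g \<notin> S \<longrightarrow> f g = 0" "x = (\<Sum>g\<in>S. f g)"
    "finite T" "\<forall>g. h g \<in> gcomp V g" "\<forall>g. g \<notin> T \<longrightarrow> h g = 0" "y = (\<Sum>g\<in>T. h g)" by metis
  have "x = (\<Sum>g\<in>S \<union> T. f g)" "y = (\<Sum>g\<in>S \<union> T. h g)"
    using * by (auto intro!: sum.mono_neutral_left)
  then show ?case
    using * by (intro exI[of _ "S \<union> T"] exI[of _ "\<lambda>g. f g + h g"]) (auto simp: sum.distrib gcomp_add)
next
  case (scale c x)
  interpret vector_space "gscale V" by (rule graded_space_vector_space)
  from scale obtain S f where *: "finite S" "\<forall>g. f g \<in> gcomp V g" "\<forall>g. g \<notin> S \<longrightarrow> f g = 0" "x = (\<Sum>g\<in>S. f g)"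
    by blast
  then show ?case
    by (intro exI[of _ S] exI[of _ "\<lambda>g. gscale V c (f g)"]) (auto simp: scale_sum_right gcomp_scale)
next
  case (comp g x)
  then show ?case
    by (intro exI[of _ "{g}"] exI[of _ "\<lambda>h. if h = g then x else 0"]) (auto simp: gcomp_zero)
qed

lemma gproj_in: "x \<in> gtotal V \<Longrightarrow> gproj V g x \<in> gcomp V g"
  using gproj_exists gproj_unique by metis

lemma gproj_finite: "x \<in> gtotal V \<Longrightarrow> finite {g. gproj V g x \<noteq> 0}"
proof -
  assume "x \<in> gtotal V"
  then obtain S f where *: "finite S" "\<forall>g. f g \<in> gcomp V g" "\<forall>g. g \<notin> S \<longrightarrow> f g = 0" "x = (\<Sum>g\<in>S. f g)"
    using gproj_exists by blast
  then have "gproj V g x = f g" for g using gproj_unique by blast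
  then show ?thesis using * by (intro finite_subset[OF _ *(1)]) auto
qed

lemma gproj_sum: "x \<in> gtotal V \<Longrightarrow> (\<Sum>g | gproj V g x \<noteq> 0. gproj V g x) = x"
proof -
  assume "x \<in> gtotal V"
  then obtain S f where *: "finite S" "\<forall>g. f g \<in> gcomp V g" "\<forall>g. g \<notin> S \<longrightarrow> f g = 0" "x = (\<Sum>g\<in>S. f g)"
    using gproj_exists by blast
  then have "gproj V g x = f g" for g using gproj_unique by blast
  then show ?thesis using * by (auto intro!: sum.mono_neutral_left)
qed

lemma gproj_add:
  assumes "x \<in> gtotal V" "y \<in> gtotal V"
  shows "gproj V g (x + y) = gproj V g x + gproj V g y"
proof -
  let ?S = "{g. gproj V g x \<noteq> 0} \<union> {g. gproj V g y \<noteq> 0}"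
  show ?thesis
  proof (rule gproj_unique[of ?S])
    have T: "finite ?S" using gproj_finite assms by blast
    have "x = (\<Sum>g\<in>?S. gproj V g x)"
      by (rule trans[OF gproj_sum[OF assms(1), symmetric]], rule sum.mono_neutral_left[OF T]) auto
    moreover have "y = (\<Sum>g\<in>?S. gproj V g y)"
      by (rule trans[OF gproj_sum[OF assms(2), symmetric]], rule sum.mono_neutral_left[OF T]) auto
    ultimately show "x + y = (\<Sum>g\<in>?S. gproj V g x + gproj V g y)" by (simp add: sum.distrib)
  qed (use assms gproj_finite gproj_in gcomp_add in auto)
qed

end

section \<open>Connected algebras and their augmentation\<close>

locale connected_algebra =
  fixes A :: "(int, 'k::field, 'a::ab_group_add) galgebra"
  assumes connected: "connected_graded_algebra A"
begin

abbreviation mul (infixl "\<star>" 70) where "x \<star> y \<equiv> gmult A x y"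
abbreviation "one \<equiv> gone A"
abbreviation "sc \<equiv> gscale A"
abbreviation "\<epsilon> \<equiv> augmentation A"
abbreviation "act \<equiv> raction A"
abbreviation "e x \<equiv> Poly_Mapping.single x one"

lemma graded_algebra: "graded_algebra A" and total [simp]: "gtotal A = UNIV"
  using connected by (simp_all add: connected_graded_algebra_def)

lemma graded_space: "graded_space A" using graded_algebra by (simp add: graded_algebra_def)

sublocale vector_space sc by (rule graded_space_vector_space[OF graded_space])

lemma mul_assoc: "x \<star> y \<star> z = x \<star> (y \<star> z)"
  and mul_add: "(x + y) \<star> z = x \<star> z + y \<star> z" "x \<star> (y + z) = x \<star> y + x \<star> z"
  and mul_scale: "sc c x \<star> y = sc c (x \<star> y)" "x \<star> sc c y = sc c (x \<star> y)"
  and mul_one [simp]: "one \<star> x = x" "x \<star> one = x"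
  using graded_algebra unfolding graded_algebra_def total by auto

lemma mul_zero [simp]: "0 \<star> x = 0" "x \<star> 0 = 0"
  using mul_add(1)[of 0 0 x] mul_add(2)[of x 0 0] by simp_all

lemma mul_minus [simp]: "(- x) \<star> y = - (x \<star> y)" "x \<star> (- y) = - (x \<star> y)"
  using mul_add(1)[of x "- x" y] mul_add(2)[of x y "- y"]
  by (simp_all add: add_eq_0_iff)

lemma mul_gcomp: "x \<in> gcomp A i \<Longrightarrow> y \<in> gcomp A j \<Longrightarrow> x \<star> y \<in> gcomp A (i + j)"
  using graded_algebra by (simp add: graded_algebra_def)

lemma one_gcomp: "one \<in> gcomp A 0" using graded_algebra by (simp add: graded_algebra_def)

lemma one_nonzero [simp]: "one \<noteq> 0" using connected by (simp add: connected_graded_algebra_def)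

lemma gcomp_negative: "i < 0 \<Longrightarrow> x \<in> gcomp A i \<Longrightarrow> x = 0"
  and gcomp_0: "x \<in> gcomp A 0 \<Longrightarrow> \<exists>c. x = sc c one"
  using connected by (auto simp: connected_graded_algebra_def)

text \<open>Only additivity enters, so the principle also applies to maps into groups without
  scalars, such as coefficient families.\<close>

lemma linear_eq_homogeneous:
  assumes "\<And>x y. f (x + y) = f x + (f y :: 'b::ab_group_add)" "\<And>x y. h (x + y) = h x + h y"
    and "\<And>i x. x \<in> gcomp A i \<Longrightarrow> f x = h x"
  shows "f x = h x"
proof -
  have z: "f 0 = 0" "h 0 = 0" using assms(1)[of 0 0] assms(2)[of 0 0] by simp_all
  have s: "f (\<Sum>i\<in>S. w i) = (\<Sum>i\<in>S. f (w i))" "h (\<Sum>i\<in>S. w i) = (\<Sum>i\<in>S. h (w i))"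
    for S :: "int set" and w
    by (induction S rule: infinite_finite_induct) (simp_all add: z assms(1,2))
  let ?S = "{i. gproj A i x \<noteq> 0}"
  have "f (\<Sum>i\<in>?S. gproj A i x) = h (\<Sum>i\<in>?S. gproj A i x)"
    unfolding s by (intro sum.cong refl, rule assms(3), rule gproj_in[OF graded_space]) simp
  then show ?thesis by (simp add: gproj_sum[OF graded_space])
qed

lemma gproj_A_add: "gproj A i (x + y) = gproj A i x + gproj A i y"
  by (simp add: gproj_add[OF graded_space])

text \<open>Negative components vanish, so an element without part of degree 0 is a sum of parts of
  positive degree. This makes membership in the positive part computable.\<close>

lemma positive_part_eq: "positive_part A = {a. gproj A 0 a = 0}"
proof (intro set_eqI iffI CollectI)
  fix a assume "a \<in> positive_part A"
  then have "a \<in> span (\<Union>i\<in>{1..}. gcomp A i)" by (simp add: positive_part_def)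
  then show "gproj A 0 a = 0"
  proof (induction rule: span_induct_alt)
    case base
    then show ?case using gproj_comp[OF graded_space gcomp_zero[OF graded_space]] by simp
  next
    case (step c x y)
    then obtain i where "i \<ge> 1" "x \<in> gcomp A i" by auto
    then have "gproj A 0 (sc c x) = 0"
      using gproj_comp[OF graded_space gcomp_scale[OF graded_space], of x i 0 c] by simp
    then show ?case using step by (simp add: gproj_A_add)
  qed
next
  fix a assume "a \<in> {a. gproj A 0 a = 0}"
  then have a: "gproj A 0 a = 0" by simp
  have "(\<Sum>i | gproj A i a \<noteq> 0. gproj A i a) \<in> span (\<Union>i\<in>{1..}. gcomp A i)"
  proof (rule span_sum)
    fix i assume i: "i \<in> {i. gproj A i a \<noteq> 0}"
    have g: "gproj A i a \<in> gcomp A i" by (rule gproj_in[OF graded_space]) simp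
    have "\<not> i < 0" using gcomp_negative[OF _ g] i by blast
    moreover have "i \<noteq> 0" using a i by auto
    ultimately have "i \<ge> 1" by simp
    with g show "gproj A i a \<in> span (\<Union>i\<in>{1..}. gcomp A i)" by (intro span_base) auto
  qed
  then show "a \<in> positive_part A"
    by (simp add: gproj_sum[OF graded_space] positive_part_def)
qed

lemma aug_eqI: "gproj A 0 a = sc c one \<Longrightarrow> \<epsilon> a = c"
proof -
  assume a: "gproj A 0 a = sc c one"
  have m: "gproj A 0 (- sc c' one) = - sc c' one" for c'
    using gproj_comp[OF graded_space gcomp_minus[OF graded_space gcomp_scale[OF graded_space one_gcomp]], of 0]
    by simp
  have "a - sc c' one \<in> positive_part A \<longleftrightarrow> c' = c" for c'
    using gproj_A_add[of 0 a "- sc c' one"] a m[of c'] unfolding positive_part_eq by auto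
  then show ?thesis unfolding augmentation_def by simp
qed

lemma gproj_0: "gproj A 0 a = sc (\<epsilon> a) one"
  using gcomp_0[OF gproj_in[OF graded_space, of a 0]] aug_eqI by auto

lemma aug_one [simp]: "\<epsilon> one = 1"
  by (rule aug_eqI) (simp add: gproj_comp[OF graded_space one_gcomp])

lemma aug_add [simp]: "\<epsilon> (a + b) = \<epsilon> a + \<epsilon> b"
  by (rule aug_eqI) (simp add: gproj_A_add gproj_0 scale_left_distrib)

lemma aug_homogeneous: "a \<in> gcomp A i \<Longrightarrow> i \<noteq> 0 \<Longrightarrow> \<epsilon> a = 0"
  by (rule aug_eqI) (simp add: gproj_comp[OF graded_space])

lemma aug_zero [simp]: "\<epsilon> 0 = 0" by (metis add.right_neutral add_left_cancel aug_add)

lemma aug_minus [simp]: "\<epsilon> (- a) = - \<epsilon> a"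
  using aug_add[of a "- a"] by (simp add: add_eq_0_iff del: aug_add)

lemma aug_diff [simp]: "\<epsilon> (a - b) = \<epsilon> a - \<epsilon> b" using aug_add[of a "- b"] by simp

lemma aug_sum: "\<epsilon> (\<Sum>i\<in>S. f i) = (\<Sum>i\<in>S. \<epsilon> (f i))"
  by (induction S rule: infinite_finite_induct) simp_all

lemma aug_scale [simp]: "\<epsilon> (sc c a) = c * \<epsilon> a"
proof (rule linear_eq_homogeneous[of "\<lambda>a. \<epsilon> (sc c a)" "\<lambda>a. c * \<epsilon> a"])
  fix i x assume x: "x \<in> gcomp A i"
  show "\<epsilon> (sc c x) = c * \<epsilon> x"
  proof (cases "i = 0")
    case True
    then obtain d where "x = sc d one" using x gcomp_0 by blast
    moreover have "\<epsilon> (sc r one) = r" for r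
      by (rule aug_eqI) (simp add: gproj_comp[OF graded_space gcomp_scale[OF graded_space one_gcomp]])
    ultimately show ?thesis by simp
  next
    case False
    then show ?thesis using x aug_homogeneous gcomp_scale[OF graded_space] by (metis mult_zero_right)
  qed
qed (simp_all add: scale_right_distrib distrib_left)

text \<open>Two homogeneous factors of nonzero degree could have a product of degree 0 only if one
  degree were negative, and then that factor is zero.\<close>

lemma aug_mult [simp]: "\<epsilon> (a \<star> b) = \<epsilon> a * \<epsilon> b"
proof -
  have hom: "\<epsilon> (a \<star> b) = \<epsilon> a * \<epsilon> b" if a: "a \<in> gcomp A i" and b: "b \<in> gcomp A j" for a b i j
  proof (cases "i = 0")
    case True
    then obtain d where "a = sc d one" using a gcomp_0 by blast
    then show ?thesis by (simp add: mul_scale)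
  next
    case False
    then have 0: "\<epsilon> a = 0" using a aug_homogeneous by blast
    show ?thesis
    proof (cases "i < 0 \<or> j < 0")
      case True
      then show ?thesis using 0 gcomp_negative a b by fastforce
    next
      case ij: False
      then have "i + j \<noteq> 0" using False by simp
      then show ?thesis using aug_homogeneous[OF mul_gcomp[OF a b]] 0 by simp
    qed
  qed
  have hom': "\<epsilon> (a \<star> b) = \<epsilon> a * \<epsilon> b" if a: "a \<in> gcomp A i" for a i
    by (rule linear_eq_homogeneous[of "\<lambda>b. \<epsilon> (a \<star> b)" "\<lambda>b. \<epsilon> a * \<epsilon> b"])
      (simp_all add: mul_add distrib_left hom[OF a])
  show ?thesis
    by (rule linear_eq_homogeneous[of "\<lambda>a. \<epsilon> (a \<star> b)" "\<lambda>a. \<epsilon> a * \<epsilon> b"])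
      (simp_all add: mul_add distrib_right hom')
qed

lemma positive_part_iff: "a \<in> positive_part A \<longleftrightarrow> \<epsilon> a = 0"
  by (simp add: positive_part_eq gproj_0)

text \<open>Recognises the augmentation from its values on scalars and in positive degrees. The map
  \<open>\<epsilon> \<circ> \<sigma>\<close> and the augmentations of \<open>B\<close> and of the
  base field are identified in this way.\<close>

lemma aug_unique:
  assumes "\<And>x y. f (x + y) = f x + f y" "\<And>c. f (sc c one) = c"
    and "\<And>i x. x \<in> gcomp A i \<Longrightarrow> i > 0 \<Longrightarrow> f x = 0"
  shows "f x = \<epsilon> x"
proof (rule linear_eq_homogeneous[of f \<epsilon>, OF assms(1) aug_add])
  fix i x assume x: "x \<in> gcomp A i"
  have f0: "f 0 = 0" using assms(2)[of 0] by simp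
  consider "i < 0" | "i = 0" | "i > 0" by linarith
  then show "f x = \<epsilon> x"
  proof cases
    case 1
    have "x = 0" by (rule gcomp_negative[OF 1 x])
    then show ?thesis using f0 by simp
  next
    case 2 then show ?thesis using gcomp_0 x assms(2) by fastforce
  next
    case 3 then show ?thesis using assms(3)[OF x] aug_homogeneous[OF x] by simp
  qed
qed

lemma hom_props:
  assumes "graded_algebra_hom A A \<sigma>"
  shows "\<sigma> (x + y) = \<sigma> x + \<sigma> y" "\<sigma> (sc c x) = sc c (\<sigma> x)" "\<sigma> (x \<star> y) = \<sigma> x \<star> \<sigma> y"
    "\<sigma> one = one" "x \<in> gcomp A i \<Longrightarrow> \<sigma> x \<in> gcomp A i" "\<sigma> 0 = 0"
proof -
  show *: "\<sigma> (x + y) = \<sigma> x + \<sigma> y" "\<sigma> (sc c x) = sc c (\<sigma> x)" "\<sigma> (x \<star> y) = \<sigma> x \<star> \<sigma> y"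
    "\<sigma> one = one" "x \<in> gcomp A i \<Longrightarrow> \<sigma> x \<in> gcomp A i" for x y
    using assms unfolding graded_algebra_hom_def graded_linear_def total by auto
  show "\<sigma> 0 = 0" using *(1)[of 0 0] by simp
qed

lemma aug_hom: "graded_algebra_hom A A \<sigma> \<Longrightarrow> \<epsilon> (\<sigma> x) = \<epsilon> x"
  by (rule aug_unique[of "\<lambda>x. \<epsilon> (\<sigma> x)"])
    (auto simp: hom_props intro: aug_homogeneous[OF hom_props(5)])

lemma hom_id: "graded_algebra_hom A A id" "graded_algebra_hom A A (\<lambda>x. x)"
  by (simp_all add: graded_algebra_hom_def graded_linear_def)

lemma lookup_act [simp]: "Poly_Mapping.lookup (act a p) x = a \<star> Poly_Mapping.lookup p x"
  by (simp add: raction_def Poly_Mapping.map.rep_eq when_def)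

lemma act_simps:
  "act a (p + q) = act a p + act a q" "act (a + b) p = act a p + act b p"
  "act a (act b p) = act (a \<star> b) p" "act one p = p" "act 0 p = 0" "act a 0 = 0"
  "act a (- p) = - act a p" "act (- a) p = - act a p" "act a (Poly_Mapping.single x b) = Poly_Mapping.single x (a \<star> b)"
  by (rule poly_mapping_eqI; simp add: lookup_add mul_add mul_assoc lookup_single when_def)+

lemma act_sum: "act a (\<Sum>i\<in>S. f i) = (\<Sum>i\<in>S. act a (f i))" "act (\<Sum>i\<in>S. g i) p = (\<Sum>i\<in>S. act (g i) p)"
  by (induction S rule: infinite_finite_induct) (simp_all add: act_simps)

lemma keys_act: "Poly_Mapping.keys (act a p) \<subseteq> Poly_Mapping.keys p"
  by (auto simp: in_keys_iff)

lemma expand: "p = (\<Sum>x\<in>Poly_Mapping.keys p. act (Poly_Mapping.lookup p x) (e x))"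
proof (rule poly_mapping_eqI)
  fix y
  have "(\<Sum>x\<in>Poly_Mapping.keys p. Poly_Mapping.lookup (act (Poly_Mapping.lookup p x) (e x)) y) =
     (\<Sum>x\<in>Poly_Mapping.keys p. if x = y then Poly_Mapping.lookup p y else 0)"
    by (rule sum.cong) (auto simp: lookup_single when_def)
  then show "Poly_Mapping.lookup p y =
      Poly_Mapping.lookup (\<Sum>x\<in>Poly_Mapping.keys p. act (Poly_Mapping.lookup p x) (e x)) y"
    by (simp add: lookup_sum in_keys_iff)
qed

text \<open>Multiplication by (-1)^n in any abelian group, so that scalars, algebra elements and
  elements of resolutions share one notation for signs.\<close>

definition sg :: "nat \<Rightarrow> 'b::ab_group_add \<Rightarrow> 'b" where "sg n p = (if even n then p else - p)"

lemma sg_simps [simp]: "sg n 0 = 0" "sg n (sg n p) = p" "sg 0 p = p" "sg (Suc 0) p = - p"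
  "sg n (- p) = - sg n p" "sg n (p + q) = sg n p + sg n q" "sg n (p - q) = sg n p - sg n q"
  "Poly_Mapping.lookup (sg n P) x = sg n (Poly_Mapping.lookup P x)" "act a (sg n P) = sg n (act a P)"
  "sg (m + n) p = sg m (sg n p)" "\<epsilon> (sg n a) = sg n (\<epsilon> a)" "sg n p = 0 \<longleftrightarrow> p = 0"
  by (simp_all add: sg_def act_simps)

end

section \<open>Free modules and semilinear maps\<close>

context connected_algebra
begin

text \<open>In contrast to \<open>semilinear_on_resolution\<close>, source and target may have
  different basis types, as the comparison of two resolutions requires.\<close>

definition semilin :: "('a \<Rightarrow> 'a) \<Rightarrow> ('x, 'a) resolution \<Rightarrow> (('x \<Rightarrow>\<^sub>0 'a) \<Rightarrow> ('y \<Rightarrow>\<^sub>0 'a)) \<Rightarrow> bool" where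
  "semilin \<sigma> P \<psi> \<longleftrightarrow>
     (\<forall>p\<in>rmodule P. \<forall>q\<in>rmodule P. \<psi> (p + q) = \<psi> p + \<psi> q) \<and>
     (\<forall>a. \<forall>p\<in>rmodule P. \<psi> (act a p) = act (\<sigma> a) (\<psi> p))"

lemma semilinear_iff: "semilinear_on_resolution A \<sigma> P \<psi> \<longleftrightarrow> semilin \<sigma> P \<psi>"
  by (simp add: semilinear_on_resolution_def semilin_def)

definition shifts ::
    "('x, 'a) resolution \<Rightarrow> ('y, 'a) resolution \<Rightarrow> int \<Rightarrow> int \<Rightarrow> (('x \<Rightarrow>\<^sub>0 'a) \<Rightarrow> ('y \<Rightarrow>\<^sub>0 'a)) \<Rightarrow> bool" where
  "shifts P Q i s \<psi> \<longleftrightarrow> (\<forall>j m. \<forall>p\<in>rbidegree A P j m. \<psi> p \<in> rbidegree A Q (j + i) (m + s))"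

lemma shifts_iff: "shifts_bidegree A P i s \<psi> \<longleftrightarrow> shifts P P i s \<psi>"
  by (simp add: shifts_bidegree_def shifts_def)

definition lin_ext :: "('a \<Rightarrow> 'a) \<Rightarrow> ('x \<Rightarrow> ('y \<Rightarrow>\<^sub>0 'a)) \<Rightarrow> ('x \<Rightarrow>\<^sub>0 'a) \<Rightarrow> ('y \<Rightarrow>\<^sub>0 'a)" where
  "lin_ext \<sigma> F p = (\<Sum>x\<in>Poly_Mapping.keys p. act (\<sigma> (Poly_Mapping.lookup p x)) (F x))"

lemma rmodule_iff: "p \<in> rmodule P \<longleftrightarrow> (\<forall>x. x \<notin> rbasis P \<longrightarrow> Poly_Mapping.lookup p x = 0)"
  by (auto simp: rmodule_def in_keys_iff)

lemma rmodule_simps [simp]: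
  "0 \<in> rmodule P" "p \<in> rmodule P \<Longrightarrow> q \<in> rmodule P \<Longrightarrow> p + q \<in> rmodule P"
  "p \<in> rmodule P \<Longrightarrow> - p \<in> rmodule P" "p \<in> rmodule P \<Longrightarrow> act a p \<in> rmodule P"
  "p \<in> rmodule P \<Longrightarrow> q \<in> rmodule P \<Longrightarrow> p - q \<in> rmodule P" "p \<in> rmodule P \<Longrightarrow> sg n p \<in> rmodule P"
  by (simp_all add: rmodule_iff lookup_add lookup_minus)

lemma e_rmodule [simp]: "e x \<in> rmodule P \<longleftrightarrow> x \<in> rbasis P"
  by (simp add: rmodule_def)

lemma rmodule_sum: fixes P :: "('x, 'a) resolution" shows "(\<And>i. i \<in> S \<Longrightarrow> f i \<in> rmodule P) \<Longrightarrow> (\<Sum>i\<in>S. f i) \<in> rmodule P"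
  by (induction S rule: infinite_finite_induct) simp_all

lemma rdegree_iff: "p \<in> rdegree P j \<longleftrightarrow>
    (\<forall>x. \<not> (x \<in> rbasis P \<and> - int (hdeg P x) = j) \<longrightarrow> Poly_Mapping.lookup p x = 0)"
  by (auto simp: rdegree_def in_keys_iff)

lemma rbidegree_iff: "p \<in> rbidegree A P j m \<longleftrightarrow>
    p \<in> rdegree P j \<and> (\<forall>x. Poly_Mapping.lookup p x \<in> gcomp A (m - ideg P x))"
  using gcomp_zero[OF graded_space] by (auto simp: rbidegree_def in_keys_iff)

lemma rdegree_rmodule: "p \<in> rdegree P j \<Longrightarrow> p \<in> rmodule P"
  by (simp add: rdegree_iff rmodule_iff)

lemma rbidegree_rdegree: "p \<in> rbidegree A P j m \<Longrightarrow> p \<in> rdegree P j"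
  by (simp add: rbidegree_iff)

lemmas rbidegree_rmodule = rdegree_rmodule[OF rbidegree_rdegree]

lemma rdegree_closed:
  "0 \<in> rdegree P j" "p \<in> rdegree P j \<Longrightarrow> q \<in> rdegree P j \<Longrightarrow> p + q \<in> rdegree P j"
  "p \<in> rdegree P j \<Longrightarrow> act a p \<in> rdegree P j" "p \<in> rdegree P j \<Longrightarrow> - p \<in> rdegree P j"
  "p \<in> rdegree P j \<Longrightarrow> sg n p \<in> rdegree P j"
  "p \<in> rdegree P j \<Longrightarrow> q \<in> rdegree P j \<Longrightarrow> p - q \<in> rdegree P j"
  by (simp_all add: rdegree_iff lookup_add lookup_minus)

lemma rdegree_sum: fixes P :: "('x, 'a) resolution" shows "(\<And>i. i \<in> S \<Longrightarrow> f i \<in> rdegree P j) \<Longrightarrow> (\<Sum>i\<in>S. f i) \<in> rdegree P j"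
  by (induction S rule: infinite_finite_induct) (simp_all add: rdegree_closed)

lemma rdegree_positive: "j > 0 \<Longrightarrow> p \<in> rdegree P j \<Longrightarrow> p = 0"
  by (rule poly_mapping_eqI) (auto simp: rdegree_iff)

lemma e_rdegree: "x \<in> rbasis P \<Longrightarrow> e x \<in> rdegree P (- int (hdeg P x))"
  by (simp add: rdegree_def)

lemma e_rbidegree: "x \<in> rbasis P \<Longrightarrow> e x \<in> rbidegree A P (- int (hdeg P x)) (ideg P x)"
  by (auto simp: rbidegree_def e_rdegree one_gcomp)

lemmas gA = gcomp_zero[OF graded_space] gcomp_add[OF graded_space] gcomp_scale[OF graded_space]
  gcomp_minus[OF graded_space] gcomp_diff[OF graded_space]

lemma rbidegree_closed:
  "0 \<in> rbidegree A P j m" "p \<in> rbidegree A P j m \<Longrightarrow> q \<in> rbidegree A P j m \<Longrightarrow> p + q \<in> rbidegree A P j m"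
  "p \<in> rbidegree A P j m \<Longrightarrow> - p \<in> rbidegree A P j m"
  "p \<in> rbidegree A P j m \<Longrightarrow> sg n p \<in> rbidegree A P j m"
  "p \<in> rbidegree A P j m \<Longrightarrow> q \<in> rbidegree A P j m \<Longrightarrow> p - q \<in> rbidegree A P j m"
  by (simp_all add: rbidegree_iff rdegree_closed lookup_add lookup_minus gA sg_def)

lemma rbidegree_act:
  assumes "p \<in> rbidegree A P j m" "a \<in> gcomp A i"
  shows "act a p \<in> rbidegree A P j (i + m)"
proof -
  have "a \<star> Poly_Mapping.lookup p x \<in> gcomp A (i + (m - ideg P x))" for x
    using assms by (intro mul_gcomp) (auto simp: rbidegree_iff)
  then show ?thesis using assms by (simp add: rbidegree_iff rdegree_closed add_diff_eq)
qed

lemma rbidegree_sum: "(\<And>i. i \<in> S \<Longrightarrow> f i \<in> rbidegree A P j m) \<Longrightarrow> (\<Sum>i\<in>S. f i) \<in> rbidegree A P j m"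
  by (induction S rule: infinite_finite_induct) (simp_all add: rbidegree_closed)

context
  fixes \<sigma> P and \<psi> :: "('x \<Rightarrow>\<^sub>0 'a) \<Rightarrow> ('y \<Rightarrow>\<^sub>0 'a)"
  assumes \<psi>: "semilin \<sigma> P \<psi>"
begin

lemma semilin_add: "p \<in> rmodule P \<Longrightarrow> q \<in> rmodule P \<Longrightarrow> \<psi> (p + q) = \<psi> p + \<psi> q"
  and semilin_act: "p \<in> rmodule P \<Longrightarrow> \<psi> (act a p) = act (\<sigma> a) (\<psi> p)"
  using \<psi> by (simp_all add: semilin_def)

lemma semilin_zero: "\<psi> 0 = 0" using semilin_add[of 0 0] by simp

lemma semilin_minus: "p \<in> rmodule P \<Longrightarrow> \<psi> (- p) = - \<psi> p"
  using semilin_add[of p "- p"] by (simp add: semilin_zero add_eq_0_iff)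

lemma semilin_diff: "p \<in> rmodule P \<Longrightarrow> q \<in> rmodule P \<Longrightarrow> \<psi> (p - q) = \<psi> p - \<psi> q"
  using semilin_add[of p "- q"] by (simp add: semilin_minus)

lemma semilin_sg: "p \<in> rmodule P \<Longrightarrow> \<psi> (sg n p) = sg n (\<psi> p)"
  by (simp add: sg_def semilin_minus)

lemma semilin_sum: "(\<And>i. i \<in> S \<Longrightarrow> f i \<in> rmodule P) \<Longrightarrow> \<psi> (\<Sum>i\<in>S. f i) = (\<Sum>i\<in>S. \<psi> (f i))"
  by (induction S rule: infinite_finite_induct) (simp_all add: semilin_zero semilin_add rmodule_sum)

lemma semilin_expand:
  assumes "p \<in> rmodule P"
  shows "\<psi> p = lin_ext \<sigma> (\<lambda>x. \<psi> (e x)) p"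
proof -
  have k: "e x \<in> rmodule P" if "x \<in> Poly_Mapping.keys p" for x
    using assms that by (auto simp: rmodule_def)
  have "\<psi> p = \<psi> (\<Sum>x\<in>Poly_Mapping.keys p. act (Poly_Mapping.lookup p x) (e x))"
    using expand[of p] by simp
  also have "\<dots> = (\<Sum>x\<in>Poly_Mapping.keys p. \<psi> (act (Poly_Mapping.lookup p x) (e x)))"
    using k by (intro semilin_sum) simp
  finally show ?thesis using k unfolding lin_ext_def by (simp add: semilin_act cong: sum.cong)
qed

end

text \<open>The extension consults \<open>F\<close> only at generators that occur in
  \<open>p\<close>. This locality is what allows \<open>F\<close> to be constructed by recursion on
  the homological degree.\<close>

lemma lin_ext_cong: "(\<And>x. x \<in> Poly_Mapping.keys p \<Longrightarrow> F x = G x) \<Longrightarrow> lin_ext \<sigma> F p = lin_ext \<sigma> G p"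
  by (simp add: lin_ext_def)

lemma semilin_eq:
  assumes "semilin \<sigma> P \<psi>" "semilin \<sigma> P \<phi>" "p \<in> rmodule P"
    and "\<And>x. x \<in> Poly_Mapping.keys p \<Longrightarrow> \<psi> (e x) = \<phi> (e x)"
  shows "\<psi> p = \<phi> p"
  unfolding semilin_expand[OF assms(1,3)] semilin_expand[OF assms(2,3)]
  by (rule lin_ext_cong[OF assms(4)])

lemma semilin_eqI:
  assumes "semilin \<sigma> P \<psi>" "semilin \<sigma> P \<phi>" "\<And>x. x \<in> rbasis P \<Longrightarrow> \<psi> (e x) = \<phi> (e x)" "p \<in> rmodule P"
  shows "\<psi> p = \<phi> p"
  by (rule semilin_eq[OF assms(1,2,4)]) (use assms(3,4) in \<open>auto simp: rmodule_def\<close>)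

lemma semilin_plus: "semilin \<sigma> P \<psi> \<Longrightarrow> semilin \<sigma> P \<phi> \<Longrightarrow> semilin \<sigma> P (\<lambda>p. \<psi> p + \<phi> p)"
  and semilin_minus_fun: "semilin \<sigma> P \<psi> \<Longrightarrow> semilin \<sigma> P \<phi> \<Longrightarrow> semilin \<sigma> P (\<lambda>p. \<psi> p - \<phi> p)"
  and semilin_sign: "semilin \<sigma> P \<psi> \<Longrightarrow> semilin \<sigma> P (\<lambda>p. sg n (\<psi> p))"
  and semilin_zero_fun: "semilin \<sigma> P (\<lambda>p. 0)"
  and semilin_id: "semilin id P (\<lambda>p. p)" "semilin id P id"
proof -
  have d: "act a (p - q) = act a p - act a q" for a p q
    using act_simps(1)[of a p "- q"] by (simp add: act_simps)
  show "semilin \<sigma> P \<psi> \<Longrightarrow> semilin \<sigma> P \<phi> \<Longrightarrow> semilin \<sigma> P (\<lambda>p. \<psi> p + \<phi> p)"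
    "semilin \<sigma> P \<psi> \<Longrightarrow> semilin \<sigma> P \<phi> \<Longrightarrow> semilin \<sigma> P (\<lambda>p. \<psi> p - \<phi> p)"
    "semilin \<sigma> P \<psi> \<Longrightarrow> semilin \<sigma> P (\<lambda>p. sg n (\<psi> p))"
    "semilin \<sigma> P (\<lambda>p. 0)" "semilin id P (\<lambda>p. p)" "semilin id P id"
    by (simp_all add: semilin_def act_simps d)
qed

lemma semilin_comp:
  assumes "semilin \<sigma> P \<psi>" "semilin \<tau> Q \<phi>" "\<And>p. p \<in> rmodule P \<Longrightarrow> \<psi> p \<in> rmodule Q"
  shows "semilin (\<tau> \<circ> \<sigma>) P (\<lambda>p. \<phi> (\<psi> p))"
  using assms by (simp add: semilin_def)

lemma lin_ext_superset:
  assumes "finite S" "Poly_Mapping.keys p \<subseteq> S" "\<sigma> 0 = 0"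
  shows "lin_ext \<sigma> F p = (\<Sum>x\<in>S. act (\<sigma> (Poly_Mapping.lookup p x)) (F x))"
  unfolding lin_ext_def
  by (rule sum.mono_neutral_left[OF assms(1,2)]) (auto simp: in_keys_iff assms(3) act_simps)

lemma lin_ext_e [simp]: "\<sigma> one = one \<Longrightarrow> lin_ext \<sigma> F (e x) = F x"
  by (simp add: lin_ext_def act_simps)

lemma semilin_lin_ext:
  assumes "graded_algebra_hom A A \<sigma>"
  shows "semilin \<sigma> P (lin_ext \<sigma> F)"
proof -
  note h = hom_props[OF assms]
  have "lin_ext \<sigma> F (p + q) = lin_ext \<sigma> F p + lin_ext \<sigma> F q" for p q
  proof -
    let ?S = "Poly_Mapping.keys p \<union> Poly_Mapping.keys q"
    have "lin_ext \<sigma> F (p + q) = (\<Sum>x\<in>?S. act (\<sigma> (Poly_Mapping.lookup (p + q) x)) (F x))"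
      by (rule lin_ext_superset[where \<sigma> = \<sigma>, OF _ keys_add h(6)]) simp
    moreover have "lin_ext \<sigma> F p = (\<Sum>x\<in>?S. act (\<sigma> (Poly_Mapping.lookup p x)) (F x))"
      "lin_ext \<sigma> F q = (\<Sum>x\<in>?S. act (\<sigma> (Poly_Mapping.lookup q x)) (F x))"
      by (rule lin_ext_superset[where \<sigma> = \<sigma>, OF _ _ h(6)]; simp)+
    ultimately show ?thesis by (simp add: lookup_add h act_simps sum.distrib)
  qed
  moreover have "lin_ext \<sigma> F (act a p) = act (\<sigma> a) (lin_ext \<sigma> F p)" for a p
    using lin_ext_superset[where \<sigma> = \<sigma>, OF finite_keys keys_act h(6), of F a p]
    by (simp add: h act_simps act_sum lin_ext_def)
  ultimately show ?thesis by (simp add: semilin_def)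
qed

lemma lin_ext_rdegree:
  assumes "\<And>x. x \<in> Poly_Mapping.keys p \<Longrightarrow> F x \<in> rdegree Q j"
  shows "lin_ext \<sigma> F p \<in> rdegree Q j"
  unfolding lin_ext_def using assms by (intro rdegree_sum rdegree_closed)

lemma lin_ext_rbidegree:
  assumes \<sigma>: "graded_algebra_hom A A \<sigma>" and p: "p \<in> rbidegree A P i m"
    and F: "\<And>x. x \<in> Poly_Mapping.keys p \<Longrightarrow> F x \<in> rbidegree A Q j (ideg P x + s)"
  shows "lin_ext \<sigma> F p \<in> rbidegree A Q j (m + s)"
  unfolding lin_ext_def
proof (rule rbidegree_sum)
  fix x assume x: "x \<in> Poly_Mapping.keys p"
  have "\<sigma> (Poly_Mapping.lookup p x) \<in> gcomp A (m - ideg P x)"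
    using p by (intro hom_props(5)[OF \<sigma>]) (simp add: rbidegree_iff)
  from rbidegree_act[OF F[OF x] this]
  show "act (\<sigma> (Poly_Mapping.lookup p x)) (F x) \<in> rbidegree A Q j (m + s)"
    by (simp add: algebra_simps)
qed

lemma lin_ext_aug:
  assumes "graded_algebra_hom A A \<sigma>" "\<And>x. \<epsilon> (Poly_Mapping.lookup p x) = 0"
  shows "\<epsilon> (Poly_Mapping.lookup (lin_ext \<sigma> F p) y) = 0"
  by (simp add: lin_ext_def lookup_sum aug_sum aug_hom[OF assms(1)] assms(2))

lemma rdegree_keys: "p \<in> rdegree P j \<Longrightarrow> x \<in> Poly_Mapping.keys p \<Longrightarrow> x \<in> rbasis P \<and> - int (hdeg P x) = j"
  by (auto simp: rdegree_def)

lemma shiftsI: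
  assumes \<sigma>: "graded_algebra_hom A A \<sigma>" and \<psi>: "semilin \<sigma> P \<psi>"
    and b: "\<And>x. x \<in> rbasis P \<Longrightarrow> \<psi> (e x) \<in> rbidegree A Q (- int (hdeg P x) + i) (ideg P x + s)"
  shows "shifts P Q i s \<psi>"
  unfolding shifts_def
proof (intro allI ballI)
  fix j m p assume p: "p \<in> rbidegree A P j m"
  show "\<psi> p \<in> rbidegree A Q (j + i) (m + s)"
    unfolding semilin_expand[OF \<psi> rbidegree_rmodule[OF p]]
    by (rule lin_ext_rbidegree[OF \<sigma> p]) (use b rdegree_keys[OF rbidegree_rdegree[OF p]] in force)
qed

lemma shifts_e:
  assumes "shifts P Q i s \<psi>" "x \<in> rbasis P"
  shows "\<psi> (e x) \<in> rbidegree A Q (- int (hdeg P x) + i) (ideg P x + s)"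
  by (rule assms(1)[unfolded shifts_def, rule_format, OF e_rbidegree[OF assms(2)]])

lemma shifts_rdegree:
  assumes "semilin \<sigma> P \<psi>" "shifts P Q i s \<psi>" "p \<in> rdegree P j"
  shows "\<psi> p \<in> rdegree Q (j + i)"
  unfolding semilin_expand[OF assms(1) rdegree_rmodule[OF assms(3)]]
proof (rule lin_ext_rdegree)
  fix x assume "x \<in> Poly_Mapping.keys p"
  from rdegree_keys[OF assms(3) this] rbidegree_rdegree[OF shifts_e[OF assms(2)], of x]
  show "\<psi> (e x) \<in> rdegree Q (j + i)" by auto
qed

lemma shifts_rmodule:
  assumes "semilin \<sigma> P \<psi>" "shifts P Q i s \<psi>" "p \<in> rmodule P"
  shows "\<psi> p \<in> rmodule Q"
  unfolding semilin_expand[OF assms(1,3)] lin_ext_def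
proof (intro rmodule_sum rmodule_simps)
  fix x assume "x \<in> Poly_Mapping.keys p"
  then have "x \<in> rbasis P" using assms(3) by (auto simp: rmodule_def)
  from rbidegree_rmodule[OF shifts_e[OF assms(2) this]] show "\<psi> (e x) \<in> rmodule Q" .
qed

lemma shifts_comp: "shifts P Q i s \<psi> \<Longrightarrow> shifts Q T j t \<phi> \<Longrightarrow> shifts P T (i + j) (s + t) (\<lambda>p. \<phi> (\<psi> p))"
  by (simp add: shifts_def add.assoc[symmetric])

lemma shifts_plus:
  "shifts P Q i s \<psi> \<Longrightarrow> shifts P Q i s \<phi> \<Longrightarrow> shifts P Q i s (\<lambda>p. \<psi> p + \<phi> p)"
  "shifts P Q i s \<psi> \<Longrightarrow> shifts P Q i s \<phi> \<Longrightarrow> shifts P Q i s (\<lambda>p. \<psi> p - \<phi> p)"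
  "shifts P Q i s (\<lambda>p. 0)"  "shifts P P 0 0 (\<lambda>p. p)"
  by (simp_all add: shifts_def rbidegree_closed)

section \<open>Pairing with functionals on the generators\<close>

lemma pairing_superset:
  assumes "finite S" "Poly_Mapping.keys p \<subseteq> S"
  shows "pairing A f p = (\<Sum>x\<in>S. \<epsilon> (Poly_Mapping.lookup p x) * f x)"
  unfolding pairing_def by (rule sum.mono_neutral_left[OF assms]) (auto simp: in_keys_iff)

lemma pairing_add: "pairing A f (p + q) = pairing A f p + pairing A f q"
proof -
  let ?S = "Poly_Mapping.keys p \<union> Poly_Mapping.keys q"
  have "finite ?S" by simp
  from pairing_superset[OF this keys_add] pairing_superset[OF this, of p] pairing_superset[OF this, of q]
  show ?thesis by (simp add: lookup_add sum.distrib distrib_right)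
qed

lemma pairing_act: "pairing A f (act a p) = \<epsilon> a * pairing A f p"
  using pairing_superset[OF finite_keys keys_act, of f a p]
  by (simp add: pairing_def sum_distrib_left mult.assoc)

lemma pairing_zero [simp]: "pairing A f 0 = 0" by (simp add: pairing_def)

lemma pairing_minus: "pairing A f (- p) = - pairing A f p"
  using pairing_add[of f p "- p"] by (simp add: add_eq_0_iff)

lemma pairing_diff: "pairing A f (p - q) = pairing A f p - pairing A f q"
  using pairing_add[of f p "- q"] by (simp add: pairing_minus)

lemma pairing_sg: "pairing A f (sg n p) = sg n (pairing A f p)"
  by (simp add: sg_def pairing_minus)

lemma pairing_sum: "pairing A f (\<Sum>i\<in>S. p i) = (\<Sum>i\<in>S. pairing A f (p i))"
  by (induction S rule: infinite_finite_induct) (simp_all add: pairing_add)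

lemma pairing_e [simp]: "pairing A f (e x) = f x" by (simp add: pairing_def)

lemma pairing_fun:
  "pairing A (\<lambda>x. f x + g x) p = pairing A f p + pairing A g p"
  "pairing A (\<lambda>x. c * f x) p = c * pairing A f p" "pairing A (\<lambda>x. 0) p = 0"
  by (simp_all add: pairing_def distrib_left sum.distrib sum_distrib_left mult.left_commute)

lemma pairing_cong: "(\<And>x. x \<in> Poly_Mapping.keys p \<Longrightarrow> f x = g x) \<Longrightarrow> pairing A f p = pairing A g p"
  by (simp add: pairing_def)

lemma pairing_minimal: "(\<And>x. \<epsilon> (Poly_Mapping.lookup p x) = 0) \<Longrightarrow> pairing A f p = 0"
  by (simp add: pairing_def)

text \<open>\<open>\<sigma>\<close> preserves the augmentation, so a functional composed with a
  \<open>\<sigma>\<close>-semilinear map is again of the form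
  \<open>\<epsilon> \<otimes> f'\<close>, with \<open>f'\<close> read off on generators.\<close>

lemma pairing_semilin:
  assumes "graded_algebra_hom A A \<sigma>" "semilin \<sigma> P \<psi>" "p \<in> rmodule P"
  shows "pairing A f (\<psi> p) = pairing A (\<lambda>x. pairing A f (\<psi> (e x))) p"
  by (subst semilin_expand[OF assms(2,3)])
    (simp add: lin_ext_def pairing_sum pairing_act aug_hom[OF assms(1)], simp add: pairing_def)

text \<open>The augmentation kills coefficients of nonzero degree, so only generators in exactly the
  bidegree of \<open>p\<close> contribute. All degree arguments about classes rest on this.\<close>

lemma pairing_bidegree:
  assumes "p \<in> rbidegree A P j m" "pairing A f p \<noteq> 0"
  shows "\<exists>x\<in>rbasis P. f x \<noteq> 0 \<and> - int (hdeg P x) = j \<and> ideg P x = m"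
proof (rule ccontr)
  assume n: "\<not> ?thesis"
  have "\<epsilon> (Poly_Mapping.lookup p x) * f x = 0" if x: "x \<in> Poly_Mapping.keys p" for x
  proof (cases "ideg P x = m")
    case True
    then show ?thesis using n rdegree_keys[OF rbidegree_rdegree[OF assms(1)] x] by auto
  next
    case False
    then have "\<epsilon> (Poly_Mapping.lookup p x) = 0"
      using assms(1) by (intro aug_homogeneous[of _ "m - ideg P x"]) (auto simp: rbidegree_iff)
    then show ?thesis by simp
  qed
  then have "pairing A f p = 0" unfolding pairing_def by (rule sum.neutral[OF ballI])
  with assms(2) show False by simp
qed

section \<open>Projection to an internal degree\<close>

definition rproj :: "('x, 'a) resolution \<Rightarrow> int \<Rightarrow> ('x \<Rightarrow>\<^sub>0 'a) \<Rightarrow> ('x \<Rightarrow>\<^sub>0 'a)" where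
  "rproj P m p = Poly_Mapping.mapp (\<lambda>x a. gproj A (m - ideg P x) a) p"

lemma lookup_rproj: "Poly_Mapping.lookup (rproj P m p) x = gproj A (m - ideg P x) (Poly_Mapping.lookup p x)"
  using gproj_comp[OF graded_space gA(1)]
  by (simp add: rproj_def Poly_Mapping.mapp.rep_eq in_keys_iff when_def)

lemma rproj_add: "rproj P m (p + q) = rproj P m p + rproj P m q"
  by (rule poly_mapping_eqI) (simp add: lookup_rproj lookup_add gproj_A_add)

lemma rproj_comp:
  assumes "p \<in> rbidegree A P j m"
  shows "rproj P m' p = (if m' = m then p else 0)"
proof (rule poly_mapping_eqI)
  fix x
  have "Poly_Mapping.lookup p x \<in> gcomp A (m - ideg P x)" using assms by (simp add: rbidegree_iff)
  from gproj_comp[OF graded_space this, of "m' - ideg P x"]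
  show "Poly_Mapping.lookup (rproj P m' p) x = Poly_Mapping.lookup (if m' = m then p else 0) x"
    by (simp add: lookup_rproj)
qed

lemma gproj_A_0 [simp]: "gproj A i 0 = 0"
  using gproj_comp[OF graded_space gA(1)] by simp

lemma gproj_A_in [simp]: "gproj A i a \<in> gcomp A i"
  by (rule gproj_in[OF graded_space]) simp

lemma rproj_in: "p \<in> rdegree P j \<Longrightarrow> rproj P m p \<in> rbidegree A P j m"
  by (simp add: rbidegree_iff rdegree_iff lookup_rproj)

text \<open>Allows exactness, which is stated for a whole cohomological degree, to be refined to
  single internal degrees.\<close>

lemma rproj_commute:
  assumes \<psi>: "semilin \<sigma> P \<psi>" "shifts P Q i 0 \<psi>" and p: "p \<in> rmodule P"
  shows "\<psi> (rproj P m p) = rproj Q m (\<psi> p)"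
proof -
  have z: "rproj P m 0 = 0" "rproj Q m 0 = 0" for m
    by (rule poly_mapping_eqI, simp add: lookup_rproj)+
  have s: "rproj P m (\<Sum>i\<in>S. w i) = (\<Sum>i\<in>S. rproj P m (w i))" for S :: "'x set" and w
    by (induction S rule: infinite_finite_induct) (simp_all add: z rproj_add)
  have s': "rproj Q m (\<Sum>i\<in>S. w i) = (\<Sum>i\<in>S. rproj Q m (w i))" for S :: "'x set" and w
    by (induction S rule: infinite_finite_induct) (simp_all add: z rproj_add)
  have rm: "rproj P m q \<in> rmodule P" if "q \<in> rmodule P" for q
    using that by (simp add: rmodule_iff lookup_rproj)
  have single: "\<psi> (rproj P m (act a (e x))) = rproj Q m (\<psi> (act a (e x)))" if x: "x \<in> rbasis P" for a x
  proof -
    let ?f = "\<lambda>a. \<psi> (rproj P m (act a (e x)))" and ?g = "\<lambda>a. rproj Q m (\<psi> (act a (e x)))"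
    show ?thesis
    proof (rule linear_eq_homogeneous[of ?f ?g])
      show "?f (a + b) = ?f a + ?f b" "?g (a + b) = ?g a + ?g b" for a b
        using x by (simp_all only: act_simps(2) rproj_add semilin_add[OF \<psi>(1)] rm rmodule_simps e_rmodule)
      fix i' a assume "a \<in> gcomp A i'"
      then have b: "act a (e x) \<in> rbidegree A P (- int (hdeg P x)) (i' + ideg P x)"
        by (rule rbidegree_act[OF e_rbidegree[OF x]])
      then have "\<psi> (act a (e x)) \<in> rbidegree A Q (- int (hdeg P x) + i) (i' + ideg P x + 0)"
        using \<psi>(2) unfolding shifts_def by blast
      from rproj_comp[OF this] show "?f a = ?g a"
        using rproj_comp[OF b] semilin_zero[OF \<psi>(1)] by simp
    qed
  qed
  let ?w = "\<lambda>x. act (Poly_Mapping.lookup p x) (e x)"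
  have k: "x \<in> rbasis P" if "x \<in> Poly_Mapping.keys p" for x using p that by (auto simp: rmodule_def)
  have "\<psi> (rproj P m (\<Sum>x\<in>Poly_Mapping.keys p. ?w x)) = rproj Q m (\<psi> (\<Sum>x\<in>Poly_Mapping.keys p. ?w x))"
  proof -
    have "\<psi> (rproj P m (\<Sum>x\<in>Poly_Mapping.keys p. ?w x)) = (\<Sum>x\<in>Poly_Mapping.keys p. \<psi> (rproj P m (?w x)))"
      unfolding s using k rm by (intro semilin_sum[OF \<psi>(1)]) simp
    moreover have "rproj Q m (\<psi> (\<Sum>x\<in>Poly_Mapping.keys p. ?w x)) = (\<Sum>x\<in>Poly_Mapping.keys p. rproj Q m (\<psi> (?w x)))"
      using k by (subst semilin_sum[OF \<psi>(1)]) (simp_all add: s')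
    ultimately show ?thesis using single k by simp
  qed
  then show ?thesis using expand[of p] by simp
qed

end

section \<open>Comparison of minimal resolutions\<close>

context connected_algebra
begin

section \<open>Consequences of minimality and exactness\<close>

context
  fixes P :: "('x, 'a) resolution"
  assumes P: "minimal_resolution A P"
begin

lemma diff_semilin: "semilin id P (rdiff P)"
  and diff_shifts: "shifts P P 1 0 (rdiff P)"
  and diff_exact: "j < 0 \<Longrightarrow> {p \<in> rdegree P j. rdiff P p = 0} = rdiff P ` rdegree P (j - 1)"
  and diff_exact_0: "{p \<in> rdegree P 0. raugmentation A P p = 0} = rdiff P ` rdegree P (- 1)"
  using P by (simp_all add: minimal_resolution_def semilinear_iff shifts_iff)

lemma diff_minimal: "p \<in> rmodule P \<Longrightarrow> \<epsilon> (Poly_Mapping.lookup (rdiff P p) x) = 0"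
  using P by (simp add: minimal_resolution_def positive_part_iff)

lemma unit_basis:
  obtains q where "q \<in> rbasis P" "hdeg P q = 0" "ideg P q = 0"
    "\<And>x. x \<in> rbasis P \<Longrightarrow> hdeg P x = 0 \<Longrightarrow> x = q"
proof -
  have "\<exists>q. {x \<in> rbasis P. hdeg P x = 0} = {q} \<and> ideg P q = 0"
    using P unfolding minimal_resolution_def by (elim conjE)
  then obtain q where q: "{x \<in> rbasis P. hdeg P x = 0} = {q}" "ideg P q = 0" by blast
  from q(1) have "q \<in> rbasis P" "hdeg P q = 0" "\<And>x. x \<in> rbasis P \<Longrightarrow> hdeg P x = 0 \<Longrightarrow> x = q"
    by blast+
  with q(2) that show ?thesis by blast
qed

lemma diff_rdegree: "p \<in> rdegree P j \<Longrightarrow> rdiff P p \<in> rdegree P (j + 1)"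
  by (rule shifts_rdegree[OF diff_semilin diff_shifts])

lemma diff_rmodule: "p \<in> rmodule P \<Longrightarrow> rdiff P p \<in> rmodule P"
  by (rule shifts_rmodule[OF diff_semilin diff_shifts])

lemma diff_e: "x \<in> rbasis P \<Longrightarrow> rdiff P (e x) \<in> rbidegree A P (- int (hdeg P x) + 1) (ideg P x)"
  using shifts_e[OF diff_shifts] by force

lemma diff_degree_0: "p \<in> rdegree P j \<Longrightarrow> j \<ge> 0 \<Longrightarrow> rdiff P p = 0"
  using rdegree_positive[OF _ diff_rdegree] by simp

text \<open>In negative degrees the image of the differential is the kernel of the next one by
  exactness; close to degree 0 the second differential already lands in positive cohomological
  degree, where the complex is zero.\<close>

lemma diff_diff: "p \<in> rmodule P \<Longrightarrow> rdiff P (rdiff P p) = 0"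
proof -
  have s: "semilin id P (\<lambda>p. rdiff P (rdiff P p))"
    using semilin_comp[OF diff_semilin diff_semilin diff_rmodule] by simp
  assume p: "p \<in> rmodule P"
  show ?thesis
  proof (rule semilin_eqI[OF s semilin_zero_fun _ p])
    fix x assume x: "x \<in> rbasis P"
    let ?j = "- int (hdeg P x)"
    have "rdiff P (e x) \<in> rdiff P ` rdegree P ?j" using e_rdegree[OF x] by blast
    moreover have "rdiff P (rdiff P (e x)) = 0" if "?j \<ge> -1"
      using diff_degree_0[OF diff_rdegree[OF e_rdegree[OF x]]] that by simp
    moreover have "rdiff P (rdiff P (e x)) = 0" if "?j < -1"
      using diff_exact[of "?j + 1"] that calculation(1) by (simp add: set_eq_iff) blast
    ultimately show "rdiff P (rdiff P (e x)) = 0" by linarith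
  qed
qed

text \<open>Take any preimage and project it to internal degree \<open>m\<close>; the differential
  commutes with this projection.\<close>

lemma exact_homogeneous:
  assumes p: "p \<in> rbidegree A P j m" and 0: "rdiff P p = 0"
    and j: "j < 0 \<or> j = 0 \<and> raugmentation A P p = 0"
  shows "\<exists>q \<in> rbidegree A P (j - 1) m. rdiff P q = p"
proof -
  have "p \<in> rdegree P j" by (rule rbidegree_rdegree[OF p])
  then have "p \<in> rdiff P ` rdegree P (j - 1)"
    using j 0 diff_exact[of j] diff_exact_0 by (cases "j < 0") auto
  then obtain q where q: "q \<in> rdegree P (j - 1)" "rdiff P q = p" by blast
  have "rdiff P (rproj P m q) = rproj P m (rdiff P q)"
    by (rule rproj_commute[OF diff_semilin diff_shifts rdegree_rmodule[OF q(1)]])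
  also have "\<dots> = p" using rproj_comp[OF p, of m] q(2) by simp
  finally show ?thesis using rproj_in[OF q(1)] by blast
qed

end

lemma lower_keys:
  assumes P: "minimal_resolution A P" and x: "x \<in> rbasis P" and y: "y \<in> Poly_Mapping.keys (rdiff P (e x))"
  shows "y \<in> rbasis P" "hdeg P x = Suc (hdeg P y)"
  using rdegree_keys[OF rbidegree_rdegree[OF diff_e[OF P x]] y] by auto

lemma wf_hdeg: "wf {(z, x). hdeg P z < hdeg P x}"
  using wf_measure[of "hdeg P"] by (simp add: measure_def inv_image_def less_than_def less_eq)

text \<open>The value at a generator \<open>x\<close> is a preimage of the value already fixed at
  \<open>rdiff P (e x)\<close>. The common form with a twist \<open>\<sigma>\<close>, a shift
  \<open>(i, s)\<close> and a prescribed class \<open>\<alpha>\<close> covers Yoneda lifts,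
  comparison maps between two resolutions and lifts of automorphisms.\<close>

theorem comparison:
  fixes P :: "('x, 'a) resolution" and Q :: "('y, 'a) resolution"
  assumes P: "minimal_resolution A P" and Q: "minimal_resolution A Q"
    and \<sigma>: "graded_algebra_hom A A \<sigma>"
    and \<alpha>: "\<And>x. \<alpha> x \<noteq> 0 \<Longrightarrow> x \<in> rbasis P \<and> hdeg P x = i \<and> ideg P x = - s"
  obtains \<phi> where "semilin \<sigma> P \<phi>" "shifts P Q (int i) s \<phi>"
    "\<And>p. p \<in> rmodule P \<Longrightarrow> sg i (rdiff Q (\<phi> p)) = \<phi> (rdiff P p)"
    "\<And>p. p \<in> rdegree P (- int i) \<Longrightarrow> raugmentation A Q (\<phi> p) = pairing A \<alpha> p"
proof -
  let ?L = "lin_ext \<sigma>"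
  obtain q where q: "q \<in> rbasis Q" "hdeg Q q = 0" "ideg Q q = 0" by (rule unit_basis[OF Q])
  \<comment> \<open>\<open>good F x y\<close> means that \<open>y\<close> is an admissible value at
    \<open>x\<close>, given the values of \<open>F\<close> at generators of smaller homological
    degree. It involves \<open>F\<close> only there, as well-founded choice requires.\<close>
  define good where "good F x y \<longleftrightarrow> (x \<in> rbasis P \<longrightarrow>
      y \<in> rbidegree A Q (int i - int (hdeg P x)) (ideg P x + s) \<and>
      sg i (rdiff Q y) = ?L F (rdiff P (e x)) \<and>
      (hdeg P x = i \<longrightarrow> raugmentation A Q y = \<alpha> x))" for F x y
  have Lsemi: "semilin \<sigma> T (?L F)" for F :: "'z \<Rightarrow> ('y \<Rightarrow>\<^sub>0 'a)" and T by (rule semilin_lin_ext[OF \<sigma>])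
  note one = hom_props(4)[OF \<sigma>]
  have "\<exists>F. \<forall>x. good F x (F x)"
  proof (rule dependent_wf_choice[OF wf_hdeg[of P]])
    fix F G :: "'x \<Rightarrow> ('y \<Rightarrow>\<^sub>0 'a)" and x y
    assume eq: "\<And>z. (z, x) \<in> {(z, x). hdeg P z < hdeg P x} \<Longrightarrow> F z = G z"
    have "?L F (rdiff P (e x)) = ?L G (rdiff P (e x))" if "x \<in> rbasis P"
      by (rule lin_ext_cong) (use lower_keys[OF P that] eq in auto)
    then show "good F x y = good G x y" by (auto simp: good_def)
  next
    fix x F
    assume "\<And>z. (z, x) \<in> {(z, x). hdeg P z < hdeg P x} \<Longrightarrow> good F z (F z)"
    then have IH: "good F z (F z)" if "hdeg P z < hdeg P x" for z using that by blast
    show "\<exists>y. good F x y"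
    proof (cases "x \<in> rbasis P")
      case False
      then show ?thesis by (simp add: good_def)
    next
      case x: True
      let ?n = "hdeg P x" and ?w = "?L F (rdiff P (e x))"
      have k: "z \<in> rbasis P" "hdeg P x = Suc (hdeg P z)" if "z \<in> Poly_Mapping.keys (rdiff P (e x))" for z
        using lower_keys[OF P x that] .
      have dm: "rdiff P (e x) \<in> rmodule P" using diff_rmodule[OF P] x by simp
      have w: "?w \<in> rbidegree A Q (int i - int ?n + 1) (ideg P x + s)"
      proof (rule lin_ext_rbidegree[OF \<sigma> diff_e[OF P x]])
        fix z assume z: "z \<in> Poly_Mapping.keys (rdiff P (e x))"
        show "F z \<in> rbidegree A Q (int i - int ?n + 1) (ideg P z + s)"
          using IH[of z] k[OF z] by (simp add: good_def)
      qed
      consider "?n < i" | "?n = i" | "?n > i" by linarith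
      then show ?thesis
      proof cases
        case 1
        then have "?w = 0" using rdegree_positive[OF _ rbidegree_rdegree[OF w]] by simp
        then have "good F x 0"
          using 1 semilin_zero[OF diff_semilin[OF Q]] by (simp add: good_def rbidegree_closed)
        then show ?thesis ..
      next
        case 2
        \<comment> \<open>In homological degree \<open>i\<close> the augmentation of the value is
          prescribed, so the value is \<open>\<alpha> x\<close> times the generator
          \<open>e q\<close> over the unit.\<close>
        let ?y = "act (sc (\<alpha> x) one) (e q)"
        have w0: "?w = 0" using rdegree_positive[OF _ rbidegree_rdegree[OF w]] 2 by simp
        have y: "?y \<in> rbidegree A Q 0 (ideg P x + s)"
        proof (cases "\<alpha> x = 0")
          case True
          then show ?thesis by (simp add: act_simps rbidegree_closed)
        next
          case False
          have "?y \<in> rbidegree A Q (- int (hdeg Q q)) (0 + ideg Q q)"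
            by (rule rbidegree_act[OF e_rbidegree[OF q(1)]]) (rule gA(3)[OF one_gcomp])
          then show ?thesis using q \<alpha>[OF False] by simp
        qed
        have "rdiff Q ?y = 0" by (rule diff_degree_0[OF Q rbidegree_rdegree[OF y]]) simp
        moreover have "raugmentation A Q ?y = \<alpha> x"
          using q by (simp add: raugmentation_def pairing_act unit_class_def)
        ultimately have "good F x ?y" using y w0 2 by (simp add: good_def)
        then show ?thesis ..
      next
        case 3
        have wm: "?w \<in> rmodule Q" by (rule rbidegree_rmodule[OF w])
        have "sg i (rdiff Q ?w) = ?L F (rdiff P (rdiff P (e x)))"
        proof -
          let ?f = "\<lambda>p. sg i (rdiff Q (?L F p))" and ?g = "\<lambda>p. ?L F (rdiff P p)"
          \<comment> \<open>The cochain equation is known so far only on generators one degree below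
            \<open>x\<close>. Restricting the basis to these makes the principle for semilinear maps
            applicable to \<open>rdiff P (e x)\<close>.\<close>
          let ?P' = "P\<lparr>rbasis := {z \<in> rbasis P. Suc (hdeg P z) = hdeg P x}\<rparr>"
          have m': "p \<in> rmodule P" if "p \<in> rmodule ?P'" for p using that by (auto simp: rmodule_def)
          have Fm: "?L F p \<in> rmodule Q" if "p \<in> rmodule ?P'" for p
            unfolding lin_ext_def
          proof (intro rmodule_sum rmodule_simps)
            fix z assume "z \<in> Poly_Mapping.keys p"
            then have "z \<in> rbasis P" "hdeg P z < hdeg P x" using that by (auto simp: rmodule_def)
            then show "F z \<in> rmodule Q" using IH[of z] rbidegree_rmodule by (auto simp: good_def)
          qed
          have 1: "semilin \<sigma> ?P' ?f"
            using semilin_sign[OF semilin_comp[OF Lsemi diff_semilin[OF Q] Fm]] by simp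
          have "semilin id ?P' (rdiff P)"
            using diff_semilin[OF P] m' by (simp add: semilin_def)
          then have 2: "semilin \<sigma> ?P' ?g"
            using semilin_comp[where \<sigma> = id and P = ?P' and \<psi> = "rdiff P" and \<phi> = "?L F",
              OF _ Lsemi diff_rmodule[OF P m']] by simp
          show ?thesis
          proof (rule semilin_eqI[OF 1 2])
            fix z assume "z \<in> rbasis ?P'"
            then show "sg i (rdiff Q (?L F (e z))) = ?L F (rdiff P (e z))"
              using IH[of z] one by (simp add: good_def)
          next
            show "rdiff P (e x) \<in> rmodule ?P'" using k by (auto simp: rmodule_def)
          qed
        qed
        also have "\<dots> = 0"
          using diff_diff[OF P] x by (simp add: lin_ext_def)
        finally have dw: "rdiff Q ?w = 0" by simp
        \<comment> \<open>This matters one step above degree \<open>i\<close>, where exactness is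
          relative to the augmentation. The coefficients of \<open>rdiff P (e x)\<close> lie in the
          augmentation ideal and stay there under the extension.\<close>
        have aug: "raugmentation A Q ?w = 0"
          unfolding raugmentation_def
          by (intro pairing_minimal lin_ext_aug[OF \<sigma>] diff_minimal[OF P]) (simp add: x)
        obtain y where y: "y \<in> rbidegree A Q (int i - int ?n + 1 - 1) (ideg P x + s)" "rdiff Q y = ?w"
        proof -
          have "int i - int ?n + 1 < 0 \<or> int i - int ?n + 1 = 0" using 3 by linarith
          with aug exact_homogeneous[OF Q w dw] that show ?thesis by blast
        qed
        \<comment> \<open>The target differential carries the sign (-1)^i, so the preimage is
          corrected by the same sign.\<close>
        have "sg i y \<in> rbidegree A Q (int i - int ?n) (ideg P x + s)"
          using y(1) by (simp add: rbidegree_closed)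
        moreover have "sg i (rdiff Q (sg i y)) = ?w"
          using semilin_sg[OF diff_semilin[OF Q] rbidegree_rmodule[OF y(1)]] y(2) by simp
        ultimately have "good F x (sg i y)" using 3 by (simp add: good_def)
        then show ?thesis ..
      qed
    qed
  qed
  then obtain F where F: "\<And>x. good F x (F x)" by blast
  have sh: "shifts P Q (int i) s (?L F)"
    by (rule shiftsI[OF \<sigma> Lsemi]) (use F in \<open>simp add: good_def one algebra_simps\<close>)
  note rm = shifts_rmodule[OF Lsemi sh]
  show ?thesis
  proof (rule that[OF Lsemi sh])
    fix p assume p: "p \<in> rmodule P"
    have 1: "semilin \<sigma> P (\<lambda>p. sg i (rdiff Q (?L F p)))"
      using semilin_sign[OF semilin_comp[OF Lsemi diff_semilin[OF Q] rm]] by simp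
    have 2: "semilin \<sigma> P (\<lambda>p. ?L F (rdiff P p))"
      using semilin_comp[OF diff_semilin[OF P] Lsemi diff_rmodule[OF P]] by simp
    show "sg i (rdiff Q (?L F p)) = ?L F (rdiff P p)"
      by (rule semilin_eqI[OF 1 2 _ p]) (use F in \<open>simp add: good_def one\<close>)
  next
    fix p assume p: "p \<in> rdegree P (- int i)"
    show "raugmentation A Q (?L F p) = pairing A \<alpha> p"
      unfolding raugmentation_def pairing_semilin[OF \<sigma> Lsemi rdegree_rmodule[OF p]]
      by (rule pairing_cong) (use F rdegree_keys[OF p] in \<open>force simp: good_def one raugmentation_def\<close>)
  qed
qed

text \<open>A cochain map that lifts zero is null-homotopic, and on minimal resolutions null-homotopic
  maps vanish modulo the augmentation ideal.\<close>

theorem null_homotopic: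
  fixes P :: "('x, 'a) resolution" and Q :: "('y, 'a) resolution"
  assumes P: "minimal_resolution A P" and Q: "minimal_resolution A Q"
    and \<sigma>: "graded_algebra_hom A A \<sigma>"
    and \<psi>: "semilin \<sigma> P \<psi>" "shifts P Q (int i) s \<psi>"
      "\<And>p. p \<in> rmodule P \<Longrightarrow> sg i (rdiff Q (\<psi> p)) = \<psi> (rdiff P p)"
      "\<And>p. p \<in> rdegree P (- int i) \<Longrightarrow> raugmentation A Q (\<psi> p) = 0"
    and p: "p \<in> rmodule P"
  shows "\<epsilon> (Poly_Mapping.lookup (\<psi> p) y) = 0"
proof -
  let ?L = "lin_ext \<sigma>"
  \<comment> \<open>\<open>H\<close> is to be a homotopy with
    \<open>\<psi> = d H + (-1)^i H d\<close>, hence of cohomological degree one less than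
    \<open>\<psi>\<close>.\<close>
  define good where "good H x y \<longleftrightarrow> (x \<in> rbasis P \<longrightarrow>
      y \<in> rbidegree A Q (int i - 1 - int (hdeg P x)) (ideg P x + s) \<and>
      rdiff Q y = \<psi> (e x) - sg i (?L H (rdiff P (e x))))" for H x y
  have Lsemi: "semilin \<sigma> T (?L F)" for F :: "'z \<Rightarrow> ('y \<Rightarrow>\<^sub>0 'a)" and T by (rule semilin_lin_ext[OF \<sigma>])
  note one = hom_props(4)[OF \<sigma>]
  have "\<exists>H. \<forall>x. good H x (H x)"
  proof (rule dependent_wf_choice[OF wf_hdeg[of P]])
    fix F G :: "'x \<Rightarrow> ('y \<Rightarrow>\<^sub>0 'a)" and x y
    assume eq: "\<And>z. (z, x) \<in> {(z, x). hdeg P z < hdeg P x} \<Longrightarrow> F z = G z"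
    have "?L F (rdiff P (e x)) = ?L G (rdiff P (e x))" if "x \<in> rbasis P"
      by (rule lin_ext_cong) (use lower_keys[OF P that] eq in auto)
    then show "good F x y = good G x y" by (auto simp: good_def)
  next
    fix x H
    assume "\<And>z. (z, x) \<in> {(z, x). hdeg P z < hdeg P x} \<Longrightarrow> good H z (H z)"
    then have IH: "good H z (H z)" if "hdeg P z < hdeg P x" for z using that by blast
    show "\<exists>y. good H x y"
    proof (cases "x \<in> rbasis P")
      case False
      then show ?thesis by (simp add: good_def)
    next
      case x: True
      let ?n = "hdeg P x" and ?u = "rdiff P (e x)"
      let ?w = "\<psi> (e x) - sg i (?L H ?u)"
      have k: "z \<in> rbasis P" "hdeg P x = Suc (hdeg P z)" if "z \<in> Poly_Mapping.keys ?u" for z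
        using lower_keys[OF P x that] .
      have um: "?u \<in> rmodule P" using diff_rmodule[OF P] x by simp
      have Lu: "?L H ?u \<in> rbidegree A Q (int i - int ?n) (ideg P x + s)"
      proof (rule lin_ext_rbidegree[OF \<sigma> diff_e[OF P x]])
        fix z assume z: "z \<in> Poly_Mapping.keys ?u"
        show "H z \<in> rbidegree A Q (int i - int ?n) (ideg P z + s)"
          using IH[of z] k[OF z] by (simp add: good_def algebra_simps)
      qed
      have \<psi>e: "\<psi> (e x) \<in> rbidegree A Q (int i - int ?n) (ideg P x + s)"
        using shifts_e[OF \<psi>(2) x] by (simp add: algebra_simps)
      have w: "?w \<in> rbidegree A Q (int i - int ?n) (ideg P x + s)"
        by (intro rbidegree_closed \<psi>e Lu)
      show ?thesis
      proof (cases "?n < i")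
        case True
        then have "?w = 0" using rdegree_positive[OF _ rbidegree_rdegree[OF w]] by simp
        then have "good H x 0"
          using semilin_zero[OF diff_semilin[OF Q]] by (simp add: good_def rbidegree_closed)
        then show ?thesis ..
      next
        case False
        \<comment> \<open>The homotopy equation one degree lower, evaluated at
          \<open>d (e x)\<close>. Its last term vanishes because \<open>d d = 0\<close>, and what
          remains shows that \<open>?w\<close> is a cycle.\<close>
        have "rdiff Q (?L H ?u) = \<psi> ?u - sg i (?L H (rdiff P ?u))"
        proof -
          let ?f = "\<lambda>p. rdiff Q (?L H p)" and ?g = "\<lambda>p. \<psi> p - sg i (?L H (rdiff P p))"
          let ?P' = "P\<lparr>rbasis := {z \<in> rbasis P. Suc (hdeg P z) = hdeg P x}\<rparr>"
          have m': "p \<in> rmodule P" if "p \<in> rmodule ?P'" for p using that by (auto simp: rmodule_def)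
          have Hm: "?L H p \<in> rmodule Q" if "p \<in> rmodule ?P'" for p
            unfolding lin_ext_def
          proof (intro rmodule_sum rmodule_simps)
            fix z assume "z \<in> Poly_Mapping.keys p"
            then have "z \<in> rbasis P" "hdeg P z < hdeg P x" using that by (auto simp: rmodule_def)
            then show "H z \<in> rmodule Q" using IH[of z] rbidegree_rmodule by (auto simp: good_def)
          qed
          have 1: "semilin \<sigma> ?P' ?f"
            using semilin_comp[OF Lsemi diff_semilin[OF Q] Hm] by simp
          have "semilin id ?P' (rdiff P)"
            using diff_semilin[OF P] m' by (simp add: semilin_def)
          then have "semilin \<sigma> ?P' (\<lambda>p. ?L H (rdiff P p))"
            using semilin_comp[where \<sigma> = id and P = ?P' and \<psi> = "rdiff P" and \<phi> = "?L H",
              OF _ Lsemi diff_rmodule[OF P m']] by simp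
          moreover have "semilin \<sigma> ?P' \<psi>" using \<psi>(1) m' by (simp add: semilin_def)
          ultimately have 2: "semilin \<sigma> ?P' ?g" by (intro semilin_minus_fun semilin_sign)
          show ?thesis
          proof (rule semilin_eqI[OF 1 2])
            fix z assume "z \<in> rbasis ?P'"
            then show "rdiff Q (?L H (e z)) = \<psi> (e z) - sg i (?L H (rdiff P (e z)))"
              using IH[of z] one by (simp add: good_def)
          next
            show "?u \<in> rmodule ?P'" using k by (auto simp: rmodule_def)
          qed
        qed
        also have "\<dots> = \<psi> ?u"
          using diff_diff[OF P] x by (simp add: lin_ext_def)
        finally have dL: "rdiff Q (?L H ?u) = \<psi> ?u" .
        have "rdiff Q (\<psi> (e x)) = sg i (sg i (rdiff Q (\<psi> (e x))))" by simp
        also have "\<dots> = sg i (\<psi> ?u)" using \<psi>(3)[of "e x"] x by simp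
        finally have "rdiff Q ?w = 0"
          using semilin_diff[OF diff_semilin[OF Q]] semilin_sg[OF diff_semilin[OF Q]]
            rbidegree_rmodule[OF Lu] rbidegree_rmodule[OF \<psi>e] dL by simp
        moreover have "raugmentation A Q ?w = 0" if "?n = i"
        proof -
          have "pairing A f (?L H ?u) = 0" for f
            by (intro pairing_minimal lin_ext_aug[OF \<sigma>] diff_minimal[OF P]) (simp add: x)
          moreover have "raugmentation A Q (\<psi> (e x)) = 0"
            using \<psi>(4) e_rdegree[OF x] that by simp
          ultimately show ?thesis by (simp add: raugmentation_def pairing_diff pairing_sg)
        qed
        ultimately obtain y where "y \<in> rbidegree A Q (int i - int ?n - 1) (ideg P x + s)" "rdiff Q y = ?w"
          using exact_homogeneous[OF Q w] False by (cases "?n = i") auto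
        then have "good H x y" by (simp add: good_def algebra_simps)
        then show ?thesis ..
      qed
    qed
  qed
  then obtain H where H: "\<And>x. good H x (H x)" by blast
  have b: "\<epsilon> (Poly_Mapping.lookup (\<psi> (e x)) y) = 0" if x: "x \<in> rbasis P" for x
  proof -
    have h: "H x \<in> rmodule Q" "\<psi> (e x) = rdiff Q (H x) + sg i (?L H (rdiff P (e x)))"
      using H[of x] x rbidegree_rmodule by (auto simp: good_def)
    have "\<epsilon> (Poly_Mapping.lookup (?L H (rdiff P (e x))) y) = 0"
      by (intro lin_ext_aug[OF \<sigma>] diff_minimal[OF P]) (simp add: x)
    then show ?thesis unfolding h(2) using diff_minimal[OF Q h(1)] by (simp add: lookup_add)
  qed
  have k: "x \<in> rbasis P" if "x \<in> Poly_Mapping.keys p" for x using p that by (auto simp: rmodule_def)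
  show ?thesis
    unfolding semilin_expand[OF \<psi>(1) p] lin_ext_def lookup_sum aug_sum
    by (rule sum.neutral) (simp add: b k)
qed

text \<open>Of the two conclusions, the congruence modulo the augmentation ideal serves to invert
  lifts, and the equality of pairings makes Yoneda products independent of lifts.\<close>

corollary cochain_maps_agree:
  fixes P :: "('x, 'a) resolution" and Q :: "('y, 'a) resolution"
  assumes P: "minimal_resolution A P" and Q: "minimal_resolution A Q"
    and \<sigma>: "graded_algebra_hom A A \<sigma>"
    and \<phi>: "semilin \<sigma> P \<phi>" "shifts P Q (int i) s \<phi>"
      "\<And>p. p \<in> rmodule P \<Longrightarrow> sg i (rdiff Q (\<phi> p)) = \<phi> (rdiff P p)"
    and \<psi>: "semilin \<sigma> P \<psi>" "shifts P Q (int i) s \<psi>"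
      "\<And>p. p \<in> rmodule P \<Longrightarrow> sg i (rdiff Q (\<psi> p)) = \<psi> (rdiff P p)"
    and eq: "\<And>p. p \<in> rdegree P (- int i) \<Longrightarrow> raugmentation A Q (\<phi> p) = raugmentation A Q (\<psi> p)"
    and p: "p \<in> rmodule P"
  shows "\<epsilon> (Poly_Mapping.lookup (\<phi> p - \<psi> p) y) = 0" "pairing A f (\<phi> p) = pairing A f (\<psi> p)"
proof -
  show *: "\<epsilon> (Poly_Mapping.lookup (\<phi> p - \<psi> p) y) = 0" for y
  proof (rule null_homotopic[OF P Q \<sigma> _ _ _ _ p])
    show "semilin \<sigma> P (\<lambda>p. \<phi> p - \<psi> p)" by (rule semilin_minus_fun[OF \<phi>(1) \<psi>(1)])
    show "shifts P Q (int i) s (\<lambda>p. \<phi> p - \<psi> p)" by (rule shifts_plus(2)[OF \<phi>(2) \<psi>(2)])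
    show "sg i (rdiff Q (\<phi> p - \<psi> p)) = \<phi> (rdiff P p) - \<psi> (rdiff P p)" if "p \<in> rmodule P" for p
      using that shifts_rmodule[OF \<phi>(1,2) that] shifts_rmodule[OF \<psi>(1,2) that]
      by (simp add: semilin_diff[OF diff_semilin[OF Q]] \<phi>(3) \<psi>(3))
    show "raugmentation A Q (\<phi> p - \<psi> p) = 0" if "p \<in> rdegree P (- int i)" for p
      using eq[OF that] by (simp add: raugmentation_def pairing_diff)
  qed
  show "pairing A f (\<phi> p) = pairing A f (\<psi> p)"
    using pairing_minimal[OF *] by (simp add: pairing_diff)
qed

end

section \<open>The Ext-algebra of a connected graded algebra\<close>

lemma ext_algebra_simps [simp]:
  "gscale (ext_algebra A P) = (\<lambda>c f x. c * f x)"
  "gcomp (ext_algebra A P) g = {f. \<forall>x. f x \<noteq> 0 \<longrightarrow> x \<in> rbasis P \<and> ext_bidegree P x = g}"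
  "gmult (ext_algebra A P) = yoneda_product A P" "gone (ext_algebra A P) = unit_class P"
  by (simp_all add: ext_algebra_def)

lemma ext_vector_space: "vector_space (gscale (ext_algebra A P))"
  by unfold_locales (auto simp: algebra_simps fun_eq_iff plus_fun_apply)

lemma ext_graded_space: "graded_space (ext_algebra A P)"
proof (rule graded_spaceI[where \<pi> = "\<lambda>x g f. if ext_bidegree P x = g then f x else 0"])
  interpret vector_space "gscale (ext_algebra A P)" by (rule ext_vector_space)
  show "subspace (gcomp (ext_algebra A P) g)" for g
  proof -
    have "gcomp (ext_algebra A P) g = {f. \<forall>x. \<not> (x \<in> rbasis P \<and> ext_bidegree P x = g) \<longrightarrow> f x = 0}"
      by auto
    then show ?thesis by (intro subspaceI) (simp_all add: plus_fun_apply zero_fun_apply)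
  qed
qed (use ext_vector_space[of A P] in \<open>auto simp: plus_fun_apply fun_eq_iff zero_fun_apply\<close>)

text \<open>\<open>yoneda_product\<close> sums over the bidegrees of its right argument. A sum over
  an infinite set is 0 by convention, so additivity of the product relies on the finiteness shown
  here.\<close>

lemma ext_total:
  assumes "f \<in> gtotal (ext_algebra A P)"
  shows "f x \<noteq> 0 \<Longrightarrow> x \<in> rbasis P" "finite (ext_bidegree P ` {x \<in> rbasis P. f x \<noteq> 0})"
proof -
  have "(\<forall>x. f x \<noteq> 0 \<longrightarrow> x \<in> rbasis P) \<and> finite (ext_bidegree P ` {x \<in> rbasis P. f x \<noteq> 0})"
    using ext_vector_space assms
  proof (induction rule: gtotal_induct)
    case zero
    show ?case by (simp add: zero_fun_apply)
  next
    case (add f g)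
    let ?B = "\<lambda>f. ext_bidegree P ` {x \<in> rbasis P. f x \<noteq> 0}"
    have "?B (f + g) \<subseteq> ?B f \<union> ?B g" by (auto simp: plus_fun_apply)
    then have "finite (?B (f + g))" using add(3,4) by (simp add: finite_subset)
    moreover have "x \<in> rbasis P" if "(f + g) x \<noteq> 0" for x
      using that add(3,4) by (cases "f x = 0") (auto simp: plus_fun_apply)
    ultimately show ?case by blast
  next
    case (scale c f)
    have "ext_bidegree P ` {x \<in> rbasis P. c * f x \<noteq> 0} \<subseteq> ext_bidegree P ` {x \<in> rbasis P. f x \<noteq> 0}"
      by auto
    then show ?case using scale by (auto intro: finite_subset)
  next
    case (comp g f)
    then have "ext_bidegree P ` {x \<in> rbasis P. f x \<noteq> 0} \<subseteq> {g}" by auto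
    then have "finite (ext_bidegree P ` {x \<in> rbasis P. f x \<noteq> 0})" by (rule finite_subset) simp
    then show ?case using comp by simp
  qed
  then show "f x \<noteq> 0 \<Longrightarrow> x \<in> rbasis P" "finite (ext_bidegree P ` {x \<in> rbasis P. f x \<noteq> 0})" by blast+
qed

lemma ext_component_comp [simp]: "ext_component P g f \<in> gcomp (ext_algebra A P) g"
  by (simp add: ext_component_def)

lemma ext_component_same: "f \<in> gcomp (ext_algebra A P) g \<Longrightarrow> ext_component P g f = f"
  by (auto simp: ext_component_def fun_eq_iff)

lemma ext_component_add: "ext_component P g (f + h) = ext_component P g f + ext_component P g h"
  and ext_component_scale: "ext_component P g (\<lambda>x. c * f x) = (\<lambda>x. c * ext_component P g f x)"
  by (auto simp: ext_component_def fun_eq_iff plus_fun_apply)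

section \<open>The Yoneda product\<close>

context connected_algebra
begin

lemma yoneda_lift_iff: "yoneda_lift A P i s \<alpha> \<phi> \<longleftrightarrow>
    semilin id P \<phi> \<and> shifts P P (int i) s \<phi> \<and>
    (\<forall>p\<in>rmodule P. sg i (rdiff P (\<phi> p)) = \<phi> (rdiff P p)) \<and>
    (\<forall>p\<in>rdegree P (- int i). raugmentation A P (\<phi> p) = pairing A \<alpha> p)"
  by (simp add: yoneda_lift_def semilinear_iff shifts_iff sg_def)

context
  fixes P :: "('x, 'a) resolution"
  assumes P: "minimal_resolution A P"
begin

abbreviation "E \<equiv> ext_algebra A P"

lemma yoneda_lift_exists:
  assumes "\<alpha> \<in> gcomp E (i, s)"
  obtains \<phi> where "yoneda_lift A P i s \<alpha> \<phi>"
proof (rule comparison[OF P P hom_id(1), of \<alpha> i s])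
  show "x \<in> rbasis P \<and> hdeg P x = i \<and> ideg P x = - s" if "\<alpha> x \<noteq> 0" for x
    using assms that by (auto simp: ext_bidegree_def)
qed (use that yoneda_lift_iff in blast)

text \<open>Two lifts of the same class agree modulo the augmentation ideal, so the chosen lift may
  be replaced by any convenient one.\<close>

lemma yoneda_homogeneous_eq:
  assumes "yoneda_lift A P i s \<alpha> \<phi>"
  shows "yoneda_homogeneous A P \<beta> (i, s) \<alpha> = (\<lambda>x. if x \<in> rbasis P then pairing A \<beta> (\<phi> (e x)) else 0)"
proof -
  define \<chi> where "\<chi> = (SOME \<phi>. yoneda_lift A P i s \<alpha> \<phi>)"
  have \<chi>: "yoneda_lift A P i s \<alpha> \<chi>" unfolding \<chi>_def using assms by (rule someI[where P = "yoneda_lift A P i s \<alpha>"])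
  have "pairing A \<beta> (\<chi> (e x)) = pairing A \<beta> (\<phi> (e x))" if "x \<in> rbasis P" for x
    by (rule cochain_maps_agree(2)[OF P P hom_id(1)])
      (use \<chi> assms that in \<open>auto simp: yoneda_lift_iff\<close>)
  then show ?thesis by (auto simp: yoneda_homogeneous_def \<chi>_def fun_eq_iff)
qed

lemma yoneda_homogeneous_add:
  assumes "\<alpha> \<in> gcomp E g" "\<alpha>' \<in> gcomp E g"
  shows "yoneda_homogeneous A P \<beta> g (\<alpha> + \<alpha>') =
    yoneda_homogeneous A P \<beta> g \<alpha> + yoneda_homogeneous A P \<beta> g \<alpha>'"
proof -
  obtain i s where g: "g = (i, s)" by (cases g)
  obtain \<phi> \<phi>' where l: "yoneda_lift A P i s \<alpha> \<phi>" "yoneda_lift A P i s \<alpha>' \<phi>'"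
    using assms yoneda_lift_exists unfolding g by metis
  have "yoneda_lift A P i s (\<alpha> + \<alpha>') (\<lambda>p. \<phi> p + \<phi>' p)"
    unfolding yoneda_lift_iff
  proof (intro conjI ballI)
    show "semilin id P (\<lambda>p. \<phi> p + \<phi>' p)" "shifts P P (int i) s (\<lambda>p. \<phi> p + \<phi>' p)"
      using l by (auto simp: yoneda_lift_iff intro: semilin_plus shifts_plus)
    fix p assume p: "p \<in> rmodule P"
    have "\<phi> p \<in> rmodule P" "\<phi>' p \<in> rmodule P"
      using l p shifts_rmodule by (auto simp: yoneda_lift_iff)
    then show "sg i (rdiff P (\<phi> p + \<phi>' p)) = \<phi> (rdiff P p) + \<phi>' (rdiff P p)"
      using l p by (simp add: yoneda_lift_iff semilin_add[OF diff_semilin[OF P]])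
  next
    fix p assume "p \<in> rdegree P (- int i)"
    then show "raugmentation A P (\<phi> p + \<phi>' p) = pairing A (\<alpha> + \<alpha>') p"
      using l by (simp add: yoneda_lift_iff raugmentation_def pairing_add plus_fun_def pairing_fun)
  qed
  from yoneda_homogeneous_eq[OF this] yoneda_homogeneous_eq[OF l(1)] yoneda_homogeneous_eq[OF l(2)]
  show ?thesis by (auto simp: g fun_eq_iff plus_fun_apply pairing_add)
qed

lemma yoneda_homogeneous_scale:
  assumes "\<alpha> \<in> gcomp E g"
  shows "yoneda_homogeneous A P \<beta> g (\<lambda>x. c * \<alpha> x) = (\<lambda>x. c * yoneda_homogeneous A P \<beta> g \<alpha> x)"
proof -
  obtain i s where g: "g = (i, s)" by (cases g)
  obtain \<phi> where l: "yoneda_lift A P i s \<alpha> \<phi>"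
    using assms yoneda_lift_exists unfolding g by metis
  \<comment> \<open>Lifts are only known to respect the action of \<open>A\<close>, so the scalar
    acts through the central element \<open>c 1\<close> of degree 0.\<close>
  let ?c = "sc c one"
  have comm: "a \<star> ?c = ?c \<star> a" for a by (simp add: mul_scale)
  have c0: "?c \<in> gcomp A 0" by (rule gA(3)[OF one_gcomp])
  have act_c: "act ?c q \<in> rbidegree A P j m" if "q \<in> rbidegree A P j m" for q j m
    using rbidegree_act[OF that c0] by simp
  have "yoneda_lift A P i s (\<lambda>x. c * \<alpha> x) (\<lambda>p. act ?c (\<phi> p))"
    unfolding yoneda_lift_iff
  proof (intro conjI ballI)
    show "semilin id P (\<lambda>p. act ?c (\<phi> p))"
      using l by (simp add: yoneda_lift_iff semilin_def act_simps comm)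
    show "shifts P P (int i) s (\<lambda>p. act ?c (\<phi> p))"
      using l act_c by (simp add: yoneda_lift_iff shifts_def)
    fix p assume p: "p \<in> rmodule P"
    have "\<phi> p \<in> rmodule P" using l p shifts_rmodule by (auto simp: yoneda_lift_iff)
    then show "sg i (rdiff P (act ?c (\<phi> p))) = act ?c (\<phi> (rdiff P p))"
      using l p by (simp add: yoneda_lift_iff semilin_act[OF diff_semilin[OF P]] flip: sg_simps(9))
  next
    fix p assume "p \<in> rdegree P (- int i)"
    then show "raugmentation A P (act ?c (\<phi> p)) = pairing A (\<lambda>x. c * \<alpha> x) p"
      using l by (simp add: yoneda_lift_iff raugmentation_def pairing_act pairing_fun)
  qed
  from yoneda_homogeneous_eq[OF this] yoneda_homogeneous_eq[OF l]
  show ?thesis by (auto simp: g fun_eq_iff pairing_act)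
qed

lemma yoneda_homogeneous_zero: "yoneda_homogeneous A P \<beta> g 0 = 0"
  using yoneda_homogeneous_add[of 0 g 0 \<beta>] by (simp add: zero_fun_apply)

text \<open>Bidegrees that do not occur in \<open>\<alpha>\<close> contribute the product with a
  zero class. Products with different right factors can thus be summed over a common index
  set.\<close>

lemma yoneda_product_superset:
  assumes "finite S" "ext_bidegree P ` {x \<in> rbasis P. \<alpha> x \<noteq> 0} \<subseteq> S"
  shows "yoneda_product A P \<beta> \<alpha> = (\<Sum>g\<in>S. yoneda_homogeneous A P \<beta> g (ext_component P g \<alpha>))"
  unfolding yoneda_product_def
proof (rule sum.mono_neutral_left[OF assms], intro ballI)
  fix g assume "g \<in> S - ext_bidegree P ` {x \<in> rbasis P. \<alpha> x \<noteq> 0}"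
  then have "ext_component P g \<alpha> = 0" by (auto simp: ext_component_def fun_eq_iff zero_fun_apply)
  then show "yoneda_homogeneous A P \<beta> g (ext_component P g \<alpha>) = 0"
    by (simp only: yoneda_homogeneous_zero)
qed

lemma yoneda_product_lift:
  assumes "\<alpha> \<in> gcomp E (i, s)" "yoneda_lift A P i s \<alpha> \<phi>"
  shows "yoneda_product A P \<beta> \<alpha> = (\<lambda>x. if x \<in> rbasis P then pairing A \<beta> (\<phi> (e x)) else 0)"
proof -
  have "ext_bidegree P ` {x \<in> rbasis P. \<alpha> x \<noteq> 0} \<subseteq> {(i, s)}" using assms(1) by auto
  from yoneda_product_superset[OF _ this] show ?thesis
    using ext_component_same[OF assms(1)] yoneda_homogeneous_eq[OF assms(2)] by simp
qed

lemma pairing_product: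
  assumes "\<alpha> \<in> gcomp E (i, s)" "yoneda_lift A P i s \<alpha> \<phi>" "p \<in> rmodule P"
  shows "pairing A (yoneda_product A P \<beta> \<alpha>) p = pairing A \<beta> (\<phi> p)"
proof -
  have "semilin id P \<phi>" using assms(2) by (simp add: yoneda_lift_iff)
  show ?thesis
    unfolding yoneda_product_lift[OF assms(1,2)]
      pairing_semilin[OF hom_id(1) \<open>semilin id P \<phi>\<close> assms(3), of \<beta>]
    by (intro pairing_cong) (use assms(3) in \<open>auto simp: rmodule_def\<close>)
qed

lemma product_add_left:
  "yoneda_product A P (\<beta> + \<beta>') \<alpha> = yoneda_product A P \<beta> \<alpha> + yoneda_product A P \<beta>' \<alpha>"
  and product_scale_left:
  "yoneda_product A P (\<lambda>x. c * \<beta> x) \<alpha> = (\<lambda>x. c * yoneda_product A P \<beta> \<alpha> x)"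
proof -
  have 1: "yoneda_homogeneous A P (\<beta> + \<beta>') g a = yoneda_homogeneous A P \<beta> g a + yoneda_homogeneous A P \<beta>' g a"
    for g a by (auto simp: yoneda_homogeneous_def Let_def fun_eq_iff plus_fun_def pairing_fun)
  have 2: "yoneda_homogeneous A P (\<lambda>x. c * \<beta> x) g a = (\<lambda>x. c * yoneda_homogeneous A P \<beta> g a x)"
    for g a by (auto simp: yoneda_homogeneous_def Let_def fun_eq_iff pairing_fun)
  interpret V: vector_space "gscale E" by (rule ext_vector_space)
  show "yoneda_product A P (\<beta> + \<beta>') \<alpha> = yoneda_product A P \<beta> \<alpha> + yoneda_product A P \<beta>' \<alpha>"
    by (simp only: yoneda_product_def 1 sum.distrib)
  show "yoneda_product A P (\<lambda>x. c * \<beta> x) \<alpha> = (\<lambda>x. c * yoneda_product A P \<beta> \<alpha> x)"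
    unfolding yoneda_product_def 2 by (rule V.scale_sum_right[unfolded ext_algebra_simps, symmetric])
qed

lemma product_add_right:
  assumes "\<alpha> \<in> gtotal E" "\<alpha>' \<in> gtotal E"
  shows "yoneda_product A P \<beta> (\<alpha> + \<alpha>') = yoneda_product A P \<beta> \<alpha> + yoneda_product A P \<beta> \<alpha>'"
proof -
  let ?B = "\<lambda>\<alpha>. ext_bidegree P ` {x \<in> rbasis P. \<alpha> x \<noteq> 0}"
  let ?S = "?B \<alpha> \<union> ?B \<alpha>'"
  have S: "finite ?S" using ext_total(2)[OF assms(1)] ext_total(2)[OF assms(2)] by blast
  have "?B (\<alpha> + \<alpha>') \<subseteq> ?S" by (auto simp: plus_fun_apply)
  note * = yoneda_product_superset[OF S this] yoneda_product_superset[OF S, of \<alpha>]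
    yoneda_product_superset[OF S, of \<alpha>']
  have "yoneda_product A P \<beta> (\<alpha> + \<alpha>') =
      (\<Sum>g\<in>?S. yoneda_homogeneous A P \<beta> g (ext_component P g \<alpha> + ext_component P g \<alpha>'))"
    unfolding *(1) ext_component_add ..
  also have "\<dots> = (\<Sum>g\<in>?S. yoneda_homogeneous A P \<beta> g (ext_component P g \<alpha>)) +
      (\<Sum>g\<in>?S. yoneda_homogeneous A P \<beta> g (ext_component P g \<alpha>'))"
    by (simp only: yoneda_homogeneous_add[OF ext_component_comp ext_component_comp] sum.distrib)
  finally show ?thesis using *(2,3) by (simp only: Un_upper1 Un_upper2)
qed

lemma product_scale_right:
  assumes "\<alpha> \<in> gtotal E"
  shows "yoneda_product A P \<beta> (\<lambda>x. c * \<alpha> x) = (\<lambda>x. c * yoneda_product A P \<beta> \<alpha> x)"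
proof -
  interpret V: vector_space "gscale E" by (rule ext_vector_space)
  let ?B = "\<lambda>\<alpha>. ext_bidegree P ` {x \<in> rbasis P. \<alpha> x \<noteq> 0}"
  have S: "finite (?B \<alpha>)" by (rule ext_total(2)[OF assms])
  have "?B (\<lambda>x. c * \<alpha> x) \<subseteq> ?B \<alpha>" by auto
  show ?thesis
    unfolding yoneda_product_superset[OF S \<open>?B (\<lambda>x. c * \<alpha> x) \<subseteq> ?B \<alpha>\<close>] ext_component_scale
      yoneda_homogeneous_scale[OF ext_component_comp] yoneda_product_def[of A P \<beta> \<alpha>]
    by (rule V.scale_sum_right[unfolded ext_algebra_simps, symmetric])
qed

lemma product_zero: "yoneda_product A P \<beta> 0 = 0" "yoneda_product A P 0 \<beta> = 0"
  using product_add_right[OF gtotal_zero[OF ext_vector_space] gtotal_zero[OF ext_vector_space], of \<beta>]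
    product_add_left[of 0 0 \<beta>] by simp_all

lemma product_comp:
  assumes \<beta>: "\<beta> \<in> gcomp E g" and \<alpha>: "\<alpha> \<in> gcomp E h"
  shows "yoneda_product A P \<beta> \<alpha> \<in> gcomp E (g + h)"
proof -
  obtain j t i s where g: "g = (j, t)" "h = (i, s)" by (cases g, cases h)
  obtain \<phi> where l: "yoneda_lift A P i s \<alpha> \<phi>" using yoneda_lift_exists \<alpha> g by blast
  have "ext_bidegree P x = g + h" if x: "x \<in> rbasis P" and n: "pairing A \<beta> (\<phi> (e x)) \<noteq> 0" for x
  proof -
    have "\<phi> (e x) \<in> rbidegree A P (- int (hdeg P x) + int i) (ideg P x + s)"
      using l x by (intro shifts_e) (auto simp: yoneda_lift_iff)
    from pairing_bidegree[OF this n] obtain y where y: "\<beta> y \<noteq> 0"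
      "- int (hdeg P y) = - int (hdeg P x) + int i" "ideg P y = ideg P x + s" by blast
    then have "hdeg P y = j" "- ideg P y = t" using \<beta> g by (auto simp: ext_bidegree_def)
    then show ?thesis using y g by (simp add: ext_bidegree_def)
  qed
  then show ?thesis using yoneda_product_lift[OF \<alpha>[unfolded g] l] by auto
qed

text \<open>The signs (-1)^i and (-1)^j of the two lifts multiply to that of the composite.
  Associativity of the Yoneda product thereby becomes associativity of composition.\<close>

lemma lift_product:
  assumes \<beta>: "\<beta> \<in> gcomp E (j, t)" "yoneda_lift A P j t \<beta> \<chi>"
    and \<alpha>: "\<alpha> \<in> gcomp E (i, s)" "yoneda_lift A P i s \<alpha> \<phi>"
  shows "yoneda_lift A P (j + i) (t + s) (yoneda_product A P \<beta> \<alpha>) (\<lambda>p. \<chi> (\<phi> p))"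
  unfolding yoneda_lift_iff
proof (intro conjI ballI)
  have l: "semilin id P \<phi>" "semilin id P \<chi>" "shifts P P (int i) s \<phi>" "shifts P P (int j) t \<chi>"
    using \<alpha>(2) \<beta>(2) by (simp_all add: yoneda_lift_iff)
  note m = shifts_rmodule[OF l(1,3)]
  show "semilin id P (\<lambda>p. \<chi> (\<phi> p))" using semilin_comp[OF l(1,2) m] by simp
  show "shifts P P (int (j + i)) (t + s) (\<lambda>p. \<chi> (\<phi> p))"
    using shifts_comp[OF l(3,4)] by (simp add: add.commute)
  fix p assume p: "p \<in> rmodule P"
  have "sg (j + i) (rdiff P (\<chi> (\<phi> p))) = sg i (sg j (rdiff P (\<chi> (\<phi> p))))"
    by (simp add: sg_def)
  also have "\<dots> = sg i (\<chi> (rdiff P (\<phi> p)))" using \<beta>(2) m[OF p] by (simp add: yoneda_lift_iff)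
  also have "\<dots> = \<chi> (sg i (rdiff P (\<phi> p)))"
    by (rule semilin_sg[OF l(2) diff_rmodule[OF P m[OF p]], symmetric])
  also have "\<dots> = \<chi> (\<phi> (rdiff P p))" using \<alpha>(2) p by (simp add: yoneda_lift_iff)
  finally show "sg (j + i) (rdiff P (\<chi> (\<phi> p))) = \<chi> (\<phi> (rdiff P p))" .
next
  fix p assume p: "p \<in> rdegree P (- int (j + i))"
  have l: "semilin id P \<phi>" "shifts P P (int i) s \<phi>" using \<alpha>(2) by (simp_all add: yoneda_lift_iff)
  have "\<phi> p \<in> rdegree P (- int j)" using shifts_rdegree[OF l p] by simp
  then show "raugmentation A P (\<chi> (\<phi> p)) = pairing A (yoneda_product A P \<beta> \<alpha>) p"
    using \<beta>(2) pairing_product[OF \<alpha> rdegree_rmodule[OF p]] by (simp add: yoneda_lift_iff)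
qed

lemma unit_comp: "unit_class P \<in> gcomp E 0"
proof -
  obtain q where q: "q \<in> rbasis P" "hdeg P q = 0" "ideg P q = 0"
    "\<And>x. x \<in> rbasis P \<Longrightarrow> hdeg P x = 0 \<Longrightarrow> x = q"
    by (rule unit_basis[OF P]) (rule that)
  have "ext_bidegree P x = 0" if "x \<in> rbasis P" "hdeg P x = 0" for x
    using q(2,3) unfolding q(4)[OF that] by (simp add: ext_bidegree_def zero_prod_def)
  then show ?thesis by (simp add: unit_class_def)
qed

text \<open>Closure is proved in the same induction as associativity, since additivity in the right
  argument is available only for elements of \<open>gtotal E\<close>.\<close>

lemma product_assoc:
  assumes "\<beta> \<in> gtotal E" "\<alpha> \<in> gtotal E"
  shows "yoneda_product A P (yoneda_product A P \<gamma> \<beta>) \<alpha> = yoneda_product A P \<gamma> (yoneda_product A P \<beta> \<alpha>)"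
    and "yoneda_product A P \<beta> \<alpha> \<in> gtotal E"
proof -
  let ?Y = "yoneda_product A P"
  note V = ext_vector_space[of A P]
  have hom: "?Y (?Y \<gamma> \<beta>) \<alpha> = ?Y \<gamma> (?Y \<beta> \<alpha>)" if \<beta>: "\<beta> \<in> gcomp E g" and \<alpha>: "\<alpha> \<in> gcomp E h" for \<alpha> \<beta> g h
  proof -
    obtain j t i s where g: "g = (j, t)" "h = (i, s)" by (cases g, cases h)
    note \<beta>' = \<beta>[unfolded g] and \<alpha>' = \<alpha>[unfolded g]
    obtain \<phi> where \<phi>: "yoneda_lift A P i s \<alpha> \<phi>" using yoneda_lift_exists[OF \<alpha>'] by blast
    obtain \<chi> where \<chi>: "yoneda_lift A P j t \<beta> \<chi>" using yoneda_lift_exists[OF \<beta>'] by blast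
    have c: "?Y \<beta> \<alpha> \<in> gcomp E (j + i, t + s)" using product_comp[OF \<beta>' \<alpha>'] by simp
    have sm: "semilin id P \<phi>" "shifts P P (int i) s \<phi>" using \<phi> by (simp_all add: yoneda_lift_iff)
    have "\<phi> (e x) \<in> rmodule P" if "x \<in> rbasis P" for x
      using that by (intro shifts_rmodule[OF sm]) simp
    then have "(if x \<in> rbasis P then pairing A (?Y \<gamma> \<beta>) (\<phi> (e x)) else 0) =
        (if x \<in> rbasis P then pairing A \<gamma> (\<chi> (\<phi> (e x))) else 0)" for x
      by (simp add: pairing_product[OF \<beta>' \<chi>])
    then show ?thesis
      by (simp only: yoneda_product_lift[OF c lift_product[OF \<beta>' \<chi> \<alpha>' \<phi>], of \<gamma>]
          yoneda_product_lift[OF \<alpha>' \<phi>, of "?Y \<gamma> \<beta>"])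
  qed
  have hom2: "?Y (?Y \<gamma> \<beta>) \<alpha> = ?Y \<gamma> (?Y \<beta> \<alpha>) \<and> ?Y \<beta> \<alpha> \<in> gtotal E" if \<alpha>: "\<alpha> \<in> gcomp E h" for \<alpha> h
    using V assms(1)
  proof (induction rule: gtotal_induct)
    case zero
    show ?case using gtotal_zero[OF V] by (simp only: product_zero simp_thms)
  next
    case (add x y)
    then show ?case
      using gcomp_gtotal[OF V \<alpha>] gtotal_add[OF V]
      by (simp only: product_add_left product_add_right simp_thms)
  next
    case (scale c x)
    then show ?case
      using gcomp_gtotal[OF V \<alpha>] gtotal_scale[OF V, of _ c]
      by (simp only: product_scale_left product_scale_right ext_algebra_simps simp_thms)
  next
    case (comp g x)
    then show ?case using hom[OF comp \<alpha>] gcomp_gtotal[OF V product_comp[OF comp \<alpha>]] by blast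
  qed
  have "?Y (?Y \<gamma> \<beta>) \<alpha> = ?Y \<gamma> (?Y \<beta> \<alpha>) \<and> ?Y \<beta> \<alpha> \<in> gtotal E"
    using V assms(2)
  proof (induction rule: gtotal_induct)
    case zero
    show ?case using gtotal_zero[OF V] by (simp only: product_zero simp_thms)
  next
    case (add x y)
    then show ?case
      using gtotal_add[OF V] by (simp only: product_add_right simp_thms)
  next
    case (scale c x)
    then show ?case
      using gtotal_scale[OF V, of _ c]
      by (simp only: product_scale_right ext_algebra_simps simp_thms)
  next
    case (comp g x)
    then show ?case using hom2 by blast
  qed
  then show "?Y (?Y \<gamma> \<beta>) \<alpha> = ?Y \<gamma> (?Y \<beta> \<alpha>)" "?Y \<beta> \<alpha> \<in> gtotal E" by simp_all
qed

text \<open>For the unit as right factor the identity is a lift. For the unit as left factor the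
  augmentation of a lift of \<open>\<alpha>\<close> is evaluated: in degree \<open>i\<close> it is
  \<open>\<alpha>\<close> by the lifting condition, and in other degrees it vanishes for reasons of
  degree.\<close>

lemma product_unit:
  assumes "\<alpha> \<in> gtotal E"
  shows "yoneda_product A P \<alpha> (unit_class P) = \<alpha>" "yoneda_product A P (unit_class P) \<alpha> = \<alpha>"
proof -
  note V = ext_vector_space[of A P]
  have u: "unit_class P \<in> gcomp E (0, 0)" using unit_comp by (simp add: zero_prod_def)
  have "yoneda_lift A P 0 0 (unit_class P) (\<lambda>p. p)"
    by (simp add: yoneda_lift_iff semilin_id shifts_plus raugmentation_def)
  from yoneda_product_lift[OF u this] show "yoneda_product A P \<alpha> (unit_class P) = \<alpha>"
    using ext_total(1)[OF assms] by (auto simp: fun_eq_iff)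
  show "yoneda_product A P (unit_class P) \<alpha> = \<alpha>"
    using V assms
  proof (induction rule: gtotal_induct)
    case zero
    show ?case by (rule product_zero)
  next
    case (add x y)
    then show ?case by (simp only: product_add_right)
  next
    case (scale c x)
    then show ?case by (simp only: product_scale_right ext_algebra_simps)
  next
    case (comp g \<alpha>)
    obtain i s where g: "g = (i, s)" by (cases g)
    note \<alpha> = comp[unfolded g]
    obtain \<phi> where \<phi>: "yoneda_lift A P i s \<alpha> \<phi>" using yoneda_lift_exists[OF \<alpha>] by blast
    have "pairing A (unit_class P) (\<phi> (e x)) = \<alpha> x" if x: "x \<in> rbasis P" for x
    proof (cases "hdeg P x = i")
      case True
      then show ?thesis
        using \<phi> e_rdegree[OF x] by (auto simp: yoneda_lift_iff raugmentation_def)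
    next
      case False
      have s: "\<phi> (e x) \<in> rbidegree A P (- int (hdeg P x) + int i) (ideg P x + s)"
        using \<phi> x by (intro shifts_e) (auto simp: yoneda_lift_iff)
      have "pairing A (unit_class P) (\<phi> (e x)) = 0"
      proof (rule ccontr)
        assume n: "pairing A (unit_class P) (\<phi> (e x)) \<noteq> 0"
        then show False
          using pairing_bidegree[OF s n] False by (auto simp: unit_class_def split: if_splits)
      qed
      moreover have "\<alpha> x = 0" using \<alpha> False by (auto simp: ext_bidegree_def)
      ultimately show ?thesis by simp
    qed
    then show ?case
      using \<alpha> by (auto simp: yoneda_product_lift[OF \<alpha> \<phi>] fun_eq_iff)
  qed
qed

theorem ext_graded_algebra: "graded_algebra E"
  unfolding graded_algebra_def
proof (intro conjI allI ballI)
  show "graded_space E" by (rule ext_graded_space)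
  show "gone E \<in> gcomp E 0" using unit_comp by simp
  show "gmult E x y \<in> gcomp E (g + h)" if "x \<in> gcomp E g" "y \<in> gcomp E h" for g h x y
    using product_comp that by (simp only: ext_algebra_simps(3))
qed (simp_all only: ext_algebra_simps product_assoc product_unit product_add_left product_add_right
    product_scale_left product_scale_right)

end

section \<open>Independence of the minimal resolution\<close>

corollary comparison_augmented:
  fixes P :: "('x, 'a) resolution" and Q :: "('y, 'a) resolution"
  assumes P: "minimal_resolution A P" and Q: "minimal_resolution A Q"
    and \<sigma>: "graded_algebra_hom A A \<sigma>"
  obtains u where "semilin \<sigma> P u" "shifts P Q 0 0 u"
    "\<And>p. p \<in> rmodule P \<Longrightarrow> rdiff Q (u p) = u (rdiff P p)"
    "\<And>p. p \<in> rdegree P 0 \<Longrightarrow> raugmentation A Q (u p) = raugmentation A P p"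
proof (rule comparison[OF P Q \<sigma>, of "unit_class P" 0 0])
  show "x \<in> rbasis P \<and> hdeg P x = 0 \<and> ideg P x = - 0" if "unit_class P x \<noteq> (0::'k)" for x
    using unit_comp[OF P] that by (simp add: ext_bidegree_def zero_prod_def)
qed (use that in \<open>simp add: raugmentation_def\<close>)

text \<open>Classes are pulled back along comparison maps \<open>u\<close> and \<open>v\<close> in
  both directions. The composites \<open>u v\<close> and \<open>v u\<close> agree with the identity
  modulo the augmentation ideal, so the pullbacks are inverse to each other.\<close>

theorem ext_algebra_unique:
  fixes P :: "('x, 'a) resolution" and Q :: "('y, 'a) resolution"
  assumes P: "minimal_resolution A P" and Q: "minimal_resolution A Q"
  shows "isomorphic_graded_algebras (ext_algebra A P) (ext_algebra A Q)"
proof -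
  obtain u where u: "semilin id Q u" "shifts Q P 0 0 u" "\<And>p. p \<in> rmodule Q \<Longrightarrow> rdiff P (u p) = u (rdiff Q p)"
      "\<And>p. p \<in> rdegree Q 0 \<Longrightarrow> raugmentation A P (u p) = raugmentation A Q p"
    by (rule comparison_augmented[OF Q P hom_id(1)]) (rule that)
  obtain v where v: "semilin id P v" "shifts P Q 0 0 v" "\<And>p. p \<in> rmodule P \<Longrightarrow> rdiff Q (v p) = v (rdiff P p)"
      "\<And>p. p \<in> rdegree P 0 \<Longrightarrow> raugmentation A Q (v p) = raugmentation A P p"
    by (rule comparison_augmented[OF P Q hom_id(1)]) (rule that)
  note um = shifts_rmodule[OF u(1,2)] and vm = shifts_rmodule[OF v(1,2)]
  note ud = shifts_rdegree[OF u(1,2), simplified] and vd = shifts_rdegree[OF v(1,2), simplified]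
  define U where "U \<alpha> = (\<lambda>y. if y \<in> rbasis Q then pairing A \<alpha> (u (e y)) else 0)" for \<alpha>
  define V where "V \<beta> = (\<lambda>x. if x \<in> rbasis P then pairing A \<beta> (v (e x)) else 0)" for \<beta>
  let ?E = "ext_algebra A P" and ?F = "ext_algebra A Q"
  have pU: "pairing A (U \<alpha>) q = pairing A \<alpha> (u q)" if "q \<in> rmodule Q" for \<alpha> q
    unfolding pairing_semilin[OF hom_id(1) u(1) that]
    by (rule pairing_cong) (use that in \<open>auto simp: U_def rmodule_def\<close>)
  have pV: "pairing A (V \<beta>) p = pairing A \<beta> (v p)" if "p \<in> rmodule P" for \<beta> p
    unfolding pairing_semilin[OF hom_id(1) v(1) that]
    by (rule pairing_cong) (use that in \<open>auto simp: V_def rmodule_def\<close>)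
  have uv: "pairing A \<alpha> (u (v p)) = pairing A \<alpha> p" if "p \<in> rmodule P" for \<alpha> p
  proof (rule cochain_maps_agree(2)[OF P P hom_id(1), where i = 0 and s = 0])
    show "semilin id P (\<lambda>p. u (v p))" using semilin_comp[OF v(1) u(1) vm] by simp
    show "shifts P P (int 0) 0 (\<lambda>p. u (v p))" using shifts_comp[OF v(2) u(2)] by simp
  qed (use that in \<open>auto simp: semilin_id shifts_plus u v vm vd\<close>)
  have vu: "pairing A \<alpha> (v (u p)) = pairing A \<alpha> p" if "p \<in> rmodule Q" for \<alpha> p
  proof (rule cochain_maps_agree(2)[OF Q Q hom_id(1), where i = 0 and s = 0])
    show "semilin id Q (\<lambda>p. v (u p))" using semilin_comp[OF u(1) v(1) um] by simp
    show "shifts Q Q (int 0) 0 (\<lambda>p. v (u p))" using shifts_comp[OF u(2) v(2)] by simp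
  qed (use that in \<open>auto simp: semilin_id shifts_plus u v um ud\<close>)
  have gl: "graded_linear ?E ?F U"
    unfolding graded_linear_def
  proof (intro conjI allI ballI)
    fix g \<alpha> assume \<alpha>: "\<alpha> \<in> gcomp ?E g"
    have "ext_bidegree Q y = g" if y: "y \<in> rbasis Q" and n: "pairing A \<alpha> (u (e y)) \<noteq> 0" for y
      using pairing_bidegree[OF shifts_e[OF u(2) y] n] \<alpha> by (auto simp: ext_bidegree_def)
    then show "U \<alpha> \<in> gcomp ?F g" by (auto simp: U_def)
  qed (auto simp: U_def fun_eq_iff plus_fun_def pairing_fun)
  have gl': "graded_linear ?F ?E V"
    unfolding graded_linear_def
  proof (intro conjI allI ballI)
    fix g \<alpha> assume \<alpha>: "\<alpha> \<in> gcomp ?F g"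
    have "ext_bidegree P y = g" if y: "y \<in> rbasis P" and n: "pairing A \<alpha> (v (e y)) \<noteq> 0" for y
      using pairing_bidegree[OF shifts_e[OF v(2) y] n] \<alpha> by (auto simp: ext_bidegree_def)
    then show "V \<alpha> \<in> gcomp ?E g" by (auto simp: V_def)
  qed (auto simp: V_def fun_eq_iff plus_fun_def pairing_fun)
  have iso: "graded_linear_iso ?E ?F U"
  proof (rule graded_linear_isoI[OF ext_vector_space ext_vector_space gl gl'])
    fix \<alpha> assume "\<alpha> \<in> gtotal ?E"
    then show "V (U \<alpha>) = \<alpha>"
      using ext_total(1)[of \<alpha>] by (auto simp: V_def pU vm uv fun_eq_iff)
  next
    fix \<beta> assume "\<beta> \<in> gtotal ?F"
    then show "U (V \<beta>) = \<beta>"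
      using ext_total(1)[of \<beta>] by (auto simp: U_def pV um vu fun_eq_iff)
  qed
  have "U (yoneda_product A P \<beta> \<alpha>) = yoneda_product A Q (U \<beta>) (U \<alpha>)" if "\<alpha> \<in> gtotal ?E" for \<alpha> \<beta>
    using ext_vector_space that
  proof (induction rule: gtotal_induct)
    case zero
    have "U 0 = 0" by (auto simp: U_def fun_eq_iff zero_fun_def pairing_fun)
    then show ?case by (simp only: product_zero[OF P] product_zero[OF Q])
  next
    case (add x y)
    have "U (f + g) = U f + U g" for f g by (auto simp: U_def fun_eq_iff plus_fun_def pairing_fun)
    then show ?case
      using add graded_linear_gtotal[OF ext_vector_space ext_vector_space gl]
      by (simp only: product_add_right[OF P] product_add_right[OF Q])
  next
    case (scale c x)
    have "U (\<lambda>x. c * f x) = (\<lambda>x. c * U f x)" for f by (auto simp: U_def fun_eq_iff pairing_fun)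
    then show ?case
      using scale graded_linear_gtotal[OF ext_vector_space ext_vector_space gl]
      by (simp only: product_scale_right[OF P] product_scale_right[OF Q] ext_algebra_simps)
  next
    case (comp g \<alpha>)
    obtain i s where g: "g = (i, s)" by (cases g)
    note \<alpha> = comp[unfolded g]
    obtain \<phi> where \<phi>: "yoneda_lift A P i s \<alpha> \<phi>" using yoneda_lift_exists[OF P \<alpha>] by blast
    have \<phi>': "semilin id P \<phi>" "shifts P P (int i) s \<phi>"
      "\<And>p. p \<in> rmodule P \<Longrightarrow> sg i (rdiff P (\<phi> p)) = \<phi> (rdiff P p)"
      "\<And>p. p \<in> rdegree P (- int i) \<Longrightarrow> raugmentation A P (\<phi> p) = pairing A \<alpha> p"
      using \<phi> by (simp_all add: yoneda_lift_iff)
    note \<phi>m = shifts_rmodule[OF \<phi>'(1,2)]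
    have U\<alpha>: "U \<alpha> \<in> gcomp ?F (i, s)" using gl \<alpha> unfolding graded_linear_def by blast
    \<comment> \<open>Carrying a lift \<open>\<phi>\<close> over by the comparison maps gives a lift
      of the pulled-back class, and this yields multiplicativity.\<close>
    have lift: "yoneda_lift A Q i s (U \<alpha>) (\<lambda>q. v (\<phi> (u q)))"
      unfolding yoneda_lift_iff
    proof (intro conjI ballI)
      have "semilin id Q (\<lambda>q. \<phi> (u q))" using semilin_comp[OF u(1) \<phi>'(1) um] by simp
      then show "semilin id Q (\<lambda>q. v (\<phi> (u q)))"
        using semilin_comp[OF _ v(1)] \<phi>m um by (metis comp_id)
      show "shifts Q Q (int i) s (\<lambda>q. v (\<phi> (u q)))"
        using shifts_comp[OF shifts_comp[OF u(2) \<phi>'(2)] v(2)] by simp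
      fix q assume q: "q \<in> rmodule Q"
      have "sg i (rdiff Q (v (\<phi> (u q)))) = sg i (v (rdiff P (\<phi> (u q))))"
        by (simp add: v(3) \<phi>m um q)
      also have "\<dots> = v (sg i (rdiff P (\<phi> (u q))))"
        by (rule semilin_sg[OF v(1) diff_rmodule[OF P \<phi>m[OF um[OF q]]], symmetric])
      also have "\<dots> = v (\<phi> (u (rdiff Q q)))" by (simp add: \<phi>'(3) um q u(3))
      finally show "sg i (rdiff Q (v (\<phi> (u q)))) = v (\<phi> (u (rdiff Q q)))" .
    next
      fix q assume q: "q \<in> rdegree Q (- int i)"
      have "\<phi> (u q) \<in> rdegree P 0" using shifts_rdegree[OF \<phi>'(1,2) ud[OF q]] by simp
      then show "raugmentation A Q (v (\<phi> (u q))) = pairing A (U \<alpha>) q"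
        using v(4) \<phi>'(4)[OF ud[OF q]] pU[OF rdegree_rmodule[OF q]] by simp
    qed
    show ?case
      unfolding yoneda_product_lift[OF Q U\<alpha> lift]
      by (auto simp: U_def[of "yoneda_product A P \<beta> \<alpha>"] fun_eq_iff pairing_product[OF P \<alpha> \<phi>] um vm \<phi>m pU uv)
  qed
  moreover have "U (unit_class P) = unit_class Q"
  proof
    fix y
    show "U (unit_class P) y = unit_class Q y"
    proof (cases "y \<in> rbasis Q \<and> hdeg Q y = 0")
      case True
      then show ?thesis using u(4)[of "e y"] e_rdegree[of y Q]
        by (simp add: U_def raugmentation_def unit_class_def)
    next
      case False
      have "U (unit_class P) \<in> gcomp ?F 0" using gl unit_comp[OF P] unfolding graded_linear_def by blast
      then show ?thesis using False by (auto simp: unit_class_def ext_bidegree_def zero_prod_def)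
    qed
  qed
  ultimately show ?thesis
    unfolding isomorphic_graded_algebras_def graded_algebra_iso_def using iso by auto
qed

end

section \<open>Lifts of automorphisms\<close>

context connected_algebra
begin

lemma resolution_twist_iff: "resolution_twist A \<sigma> P \<phi> \<longleftrightarrow>
    semilin \<sigma> P \<phi> \<and> shifts P P 0 0 \<phi> \<and> bij_betw \<phi> (rmodule P) (rmodule P) \<and>
    (\<forall>p\<in>rmodule P. rdiff P (\<phi> p) = \<phi> (rdiff P p)) \<and>
    (\<forall>p\<in>rdegree P 0. raugmentation A P (\<phi> p) = raugmentation A P p)"
  by (simp add: resolution_twist_def semilinear_iff shifts_iff)

lemma graded_algebra_iso_hom:
  assumes "graded_algebra_iso A A \<sigma>"
  shows "graded_algebra_hom A A \<sigma>" "graded_algebra_hom A A (inv \<sigma>)" "\<sigma> (inv \<sigma> a) = a" "inv \<sigma> (\<sigma> a) = a"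
proof -
  have b: "bij \<sigma>" and im: "\<And>g. \<sigma> ` gcomp A g = gcomp A g"
    using assms by (auto simp: graded_algebra_iso_def graded_linear_iso_def)
  have s: "\<sigma> (inv \<sigma> a) = a" and i: "inv \<sigma> (\<sigma> a) = a" for a
    using b by (simp_all add: bij_is_surj bij_is_inj surj_f_inv_f)
  then show "\<sigma> (inv \<sigma> a) = a" "inv \<sigma> (\<sigma> a) = a" by blast+
  show h: "graded_algebra_hom A A \<sigma>"
    using assms by (auto simp: graded_algebra_iso_def graded_linear_iso_def graded_algebra_hom_def)
  have inj: "inv \<sigma> x = y" if "x = \<sigma> y" for x y using that i by simp
  note hp = hom_props[OF h]
  show "graded_algebra_hom A A (inv \<sigma>)"
    unfolding graded_algebra_hom_def graded_linear_def
  proof (intro conjI allI ballI)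
    fix g x assume "x \<in> gcomp A g"
    then show "inv \<sigma> x \<in> gcomp A g" using im[of g] i by (metis imageE)
  qed (rule inj, simp add: hp s)+
qed

section \<open>Strict invertibility of lifts of an automorphism\<close>

context
  fixes P :: "('x, 'a) resolution"
  assumes P: "minimal_resolution A P"
begin

text \<open>By induction on the homological degree. The differential of a generator of negative
  internal degree would have coefficients of negative degree, hence vanish; exactness would then
  make the generator a boundary, contradicting minimality.\<close>

lemma ideg_nonneg: "x \<in> rbasis P \<Longrightarrow> 0 \<le> ideg P x"
proof (induction "hdeg P x" arbitrary: x)
  case 0
  obtain q where q: "q \<in> rbasis P" "hdeg P q = 0" "ideg P q = 0"
    "\<And>x. x \<in> rbasis P \<Longrightarrow> hdeg P x = 0 \<Longrightarrow> x = q"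
    by (rule unit_basis[OF P]) (rule that)
  then show ?case using 0 by (metis order_refl)
next
  case (Suc n)
  show ?case
  proof (rule ccontr)
    assume neg: "\<not> 0 \<le> ideg P x"
    have d: "rdiff P (e x) \<in> rbidegree A P (- int (hdeg P x) + 1) (ideg P x)"
      by (rule diff_e[OF P Suc.prems])
    have "rdiff P (e x) = 0"
    proof (rule poly_mapping_eqI, rule ccontr)
      fix y assume y: "Poly_Mapping.lookup (rdiff P (e x)) y \<noteq> Poly_Mapping.lookup 0 y"
      then have "y \<in> Poly_Mapping.keys (rdiff P (e x))" by (simp add: in_keys_iff)
      from lower_keys[OF P Suc.prems this] have "0 \<le> ideg P y" using Suc by simp
      moreover have "Poly_Mapping.lookup (rdiff P (e x)) y \<in> gcomp A (ideg P x - ideg P y)"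
        using d by (simp add: rbidegree_iff)
      ultimately show False using y neg gcomp_negative[of "ideg P x - ideg P y"] by auto
    qed
    then obtain p where p: "p \<in> rbidegree A P (- int (hdeg P x) - 1) (ideg P x)" "rdiff P p = e x"
      using exact_homogeneous[OF P e_rbidegree[OF Suc.prems]] Suc.hyps(2) by auto
    from diff_minimal[OF P rbidegree_rmodule[OF p(1)], of x] p(2) show False by simp
  qed
qed

text \<open>Coefficients of \<open>p - \<theta> p\<close> at a generator have augmentation 0, hence
  positive degree if nonzero. So this difference map strictly lowers the internal degree of
  generators, and as these degrees are nonnegative it is locally nilpotent. The argument covers
  resolutions with infinitely many generators.\<close>

lemma bij_of_unipotent:
  assumes \<theta>: "semilin id P \<theta>" "shifts P P 0 0 \<theta>"
    and N: "\<And>p y. p \<in> rmodule P \<Longrightarrow> \<epsilon> (Poly_Mapping.lookup (\<theta> p - p) y) = 0"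
  shows "bij_betw \<theta> (rmodule P) (rmodule P)"
proof -
  define \<nu> where "\<nu> p = p - \<theta> p" for p
  have \<nu>: "semilin id P \<nu>" unfolding \<nu>_def by (rule semilin_minus_fun[OF semilin_id(1) \<theta>(1)])
  have \<nu>s: "shifts P P 0 0 \<nu>" unfolding \<nu>_def by (rule shifts_plus(2)[OF shifts_plus(4) \<theta>(2)])
  \<comment> \<open>The filtration by internal degree of the generators involved:
    \<open>\<nu>\<close> lowers it by one step, \<open>F 0\<close> is zero, and every element lies
    in some \<open>F b\<close>.\<close>
  define F where "F b = {p \<in> rmodule P. \<forall>x\<in>Poly_Mapping.keys p. ideg P x < int b}" for b :: nat
  have low: "ideg P y < ideg P x" if x: "x \<in> rbasis P" and y: "Poly_Mapping.lookup (\<nu> (e x)) y \<noteq> 0" for x y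
  proof -
    have h: "Poly_Mapping.lookup (\<nu> (e x)) y \<in> gcomp A (ideg P x - ideg P y)"
      using shifts_e[OF \<nu>s x] by (simp add: rbidegree_iff)
    have "\<epsilon> (Poly_Mapping.lookup (\<nu> (e x)) y) = 0"
      using N[of "e x" y] x unfolding \<nu>_def by (simp add: lookup_minus)
    then have "ideg P x - ideg P y \<noteq> 0" using h y gcomp_0 by fastforce
    moreover have "\<not> ideg P x - ideg P y < 0" using h y gcomp_negative by blast
    ultimately show ?thesis by linarith
  qed
  have step: "\<nu> p \<in> F b" if p: "p \<in> F (Suc b)" for p b
  proof -
    have pm: "p \<in> rmodule P" using p by (simp add: F_def)
    have "ideg P y < int b" if y: "y \<in> Poly_Mapping.keys (\<nu> p)" for y
    proof -
      have "Poly_Mapping.lookup (\<nu> p) y \<noteq> 0" using y by (simp add: in_keys_iff)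
      then have "(\<Sum>x\<in>Poly_Mapping.keys p. Poly_Mapping.lookup p x \<star> Poly_Mapping.lookup (\<nu> (e x)) y) \<noteq> 0"
        by (simp add: semilin_expand[OF \<nu> pm] lin_ext_def lookup_sum)
      then obtain x where x: "x \<in> Poly_Mapping.keys p" "Poly_Mapping.lookup (\<nu> (e x)) y \<noteq> 0"
        by (metis (no_types, lifting) mul_zero(2) sum.neutral)
      then have "ideg P y < ideg P x" using low pm by (auto simp: rmodule_def)
      then show ?thesis using x p by (auto simp: F_def)
    qed
    then show ?thesis using shifts_rmodule[OF \<nu> \<nu>s pm] by (simp add: F_def)
  qed
  have F0: "p = 0" if "p \<in> F 0" for p
  proof (rule poly_mapping_eqI, rule ccontr)
    fix x assume "Poly_Mapping.lookup p x \<noteq> Poly_Mapping.lookup 0 x"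
    then have "x \<in> Poly_Mapping.keys p" by (simp add: in_keys_iff)
    then have "x \<in> rbasis P" "ideg P x < 0" using that by (auto simp: F_def rmodule_def)
    then show False using ideg_nonneg[of x] by simp
  qed
  have all: "\<exists>b. p \<in> F b" if p: "p \<in> rmodule P" for p
  proof -
    let ?S = "(\<lambda>x. nat (ideg P x)) ` Poly_Mapping.keys p"
    have "ideg P x < int (Suc (Max ?S))" if "x \<in> Poly_Mapping.keys p" for x
    proof -
      have "nat (ideg P x) \<le> Max ?S" using that by (intro Max_ge) auto
      then show ?thesis by linarith
    qed
    then show ?thesis using p unfolding F_def by blast
  qed
  have surj: "\<exists>q\<in>rmodule P. \<theta> q = p" if "p \<in> F b" for p b
    using that
  proof (induction b arbitrary: p)
    case 0
    then have "p = 0" by (rule F0)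
    then show ?case using semilin_zero[OF \<theta>(1)] by (intro bexI[of _ 0]) simp_all
  next
    case (Suc b)
    then obtain q where q: "q \<in> rmodule P" "\<theta> q = \<nu> p" using step by blast
    have p: "p \<in> rmodule P" using Suc by (simp add: F_def)
    have "\<theta> (p + q) = p" using semilin_add[OF \<theta>(1) p q(1)] q(2) by (simp add: \<nu>_def)
    then show ?case using p q(1) by (metis rmodule_simps(2))
  qed
  have ker: "p = 0" if "p \<in> F b" "\<theta> p = 0" for p b
    using that
  proof (induction b)
    case 0
    then show ?case using F0 by blast
  next
    case (Suc b)
    then have "p \<in> F b" using step[of p b] by (simp add: \<nu>_def)
    then show ?case using Suc by blast
  qed
  have "inj_on \<theta> (rmodule P)"
  proof (rule inj_onI)
    fix p q assume pq: "p \<in> rmodule P" "q \<in> rmodule P" "\<theta> p = \<theta> q"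
    then have "\<theta> (p - q) = 0" by (simp add: semilin_diff[OF \<theta>(1)])
    moreover obtain b where "p - q \<in> F b" using all pq by fastforce
    ultimately have "p - q = 0" using ker by blast
    then show "p = q" by simp
  qed
  moreover have "\<theta> ` rmodule P = rmodule P"
    using shifts_rmodule[OF \<theta>] surj all by fastforce
  ultimately show ?thesis by (simp add: bij_betw_def)
qed

text \<open>Lifts \<open>u\<close> of \<open>\<sigma>\<close> and \<open>v\<close> of its inverse
  exist by comparison. Both composites lift the identity and are unipotent, hence bijective; one
  gives injectivity of \<open>u\<close>, the other surjectivity.\<close>

theorem twist_exists:
  assumes \<sigma>: "graded_algebra_iso A A \<sigma>"
  shows "\<exists>\<phi>. resolution_twist A \<sigma> P \<phi>"
proof -
  note h = graded_algebra_iso_hom[OF \<sigma>]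
  have bij: "bij_betw (\<lambda>p. v (u p)) (rmodule P) (rmodule P)"
    if u: "semilin \<rho> P u" "shifts P P 0 0 u" "\<And>p. p\<in>rmodule P \<Longrightarrow> rdiff P (u p) = u (rdiff P p)"
      "\<And>p. p\<in>rdegree P 0 \<Longrightarrow> raugmentation A P (u p) = raugmentation A P p"
    and v: "semilin \<rho>' P v" "shifts P P 0 0 v" "\<And>p. p\<in>rmodule P \<Longrightarrow> rdiff P (v p) = v (rdiff P p)"
      "\<And>p. p\<in>rdegree P 0 \<Longrightarrow> raugmentation A P (v p) = raugmentation A P p"
    and inv: "\<And>a. \<rho>' (\<rho> a) = a" for u v \<rho> \<rho>'
  proof (rule bij_of_unipotent)
    note um = shifts_rmodule[OF u(1,2)] and ud = shifts_rdegree[OF u(1,2), of _ 0, simplified]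
    have "\<rho>' \<circ> \<rho> = id" using inv by auto
    then show l: "semilin id P (\<lambda>p. v (u p))" using semilin_comp[OF u(1) v(1) um] by simp
    show s: "shifts P P 0 0 (\<lambda>p. v (u p))" using shifts_comp[OF u(2) v(2)] by simp
    show "\<epsilon> (Poly_Mapping.lookup (v (u p) - p) y) = 0" if "p \<in> rmodule P" for p y
      by (rule cochain_maps_agree(1)[OF P P hom_id(1), where i = 0 and s = 0 and \<psi> = "\<lambda>p. p"])
        (use l s u v um ud that in \<open>auto simp: semilin_id shifts_plus\<close>)
  qed
  obtain u where u: "semilin \<sigma> P u" "shifts P P 0 0 u" "\<And>p. p\<in>rmodule P \<Longrightarrow> rdiff P (u p) = u (rdiff P p)"
      "\<And>p. p\<in>rdegree P 0 \<Longrightarrow> raugmentation A P (u p) = raugmentation A P p"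
    by (rule comparison_augmented[OF P P h(1)]) (rule that)
  obtain v where v: "semilin (inv \<sigma>) P v" "shifts P P 0 0 v" "\<And>p. p\<in>rmodule P \<Longrightarrow> rdiff P (v p) = v (rdiff P p)"
      "\<And>p. p\<in>rdegree P 0 \<Longrightarrow> raugmentation A P (v p) = raugmentation A P p"
    by (rule comparison_augmented[OF P P h(2)]) (rule that)
  have vu: "bij_betw (\<lambda>p. v (u p)) (rmodule P) (rmodule P)" by (rule bij[OF u v h(4)])
  have uv: "bij_betw (\<lambda>p. u (v p)) (rmodule P) (rmodule P)" by (rule bij[OF v u h(3)])
  have "bij_betw u (rmodule P) (rmodule P)"
    unfolding bij_betw_def
  proof
    show "inj_on u (rmodule P)" using vu by (auto simp: bij_betw_def inj_on_def)
    have "rmodule P \<subseteq> u ` v ` rmodule P" using uv by (auto simp: bij_betw_def image_image)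
    then show "u ` rmodule P = rmodule P"
      using shifts_rmodule[OF u(1,2)] shifts_rmodule[OF v(1,2)] by blast
  qed
  then show ?thesis using u by (auto simp: resolution_twist_iff)
qed

theorem inverse_twist:
  assumes \<sigma>: "graded_algebra_iso A A \<sigma>" and \<phi>: "resolution_twist A \<sigma> P \<phi>"
  defines "\<psi> \<equiv> inv_into (rmodule P) \<phi>"
  shows "semilin (inv \<sigma>) P \<psi>" "shifts P P 0 0 \<psi>"
    "\<And>p. p \<in> rmodule P \<Longrightarrow> rdiff P (\<psi> p) = \<psi> (rdiff P p)"
    "\<And>p. p \<in> rmodule P \<Longrightarrow> \<phi> (\<psi> p) = p" "\<And>p. p \<in> rmodule P \<Longrightarrow> \<psi> (\<phi> p) = p"
proof -
  note h = graded_algebra_iso_hom[OF \<sigma>]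
  have \<phi>': "semilin \<sigma> P \<phi>" "shifts P P 0 0 \<phi>" "bij_betw \<phi> (rmodule P) (rmodule P)"
    "\<And>p. p\<in>rmodule P \<Longrightarrow> rdiff P (\<phi> p) = \<phi> (rdiff P p)"
    using \<phi> by (simp_all add: resolution_twist_iff)
  note m = shifts_rmodule[OF \<phi>'(1,2)]
  have pm: "\<psi> p \<in> rmodule P" if "p \<in> rmodule P" for p
    using \<phi>'(3) that unfolding \<psi>_def by (metis bij_betw_def inv_into_into)
  show pp: "\<phi> (\<psi> p) = p" if "p \<in> rmodule P" for p
    using bij_betw_inv_into_right[OF \<phi>'(3) that] by (simp add: \<psi>_def)
  show pp': "\<psi> (\<phi> p) = p" if "p \<in> rmodule P" for p
    using bij_betw_inv_into_left[OF \<phi>'(3) that] by (simp add: \<psi>_def)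
  have eqI: "\<psi> p = q" if "q \<in> rmodule P" "p = \<phi> q" for p q using pp' that by simp
  show l: "semilin (inv \<sigma>) P \<psi>"
    unfolding semilin_def
  proof (intro conjI ballI allI)
    fix p q assume "p \<in> rmodule P" "q \<in> rmodule P"
    then show "\<psi> (p + q) = \<psi> p + \<psi> q"
      by (intro eqI) (simp_all add: pm pp semilin_add[OF \<phi>'(1)])
  next
    fix a p assume "p \<in> rmodule P"
    then show "\<psi> (act a p) = act (inv \<sigma> a) (\<psi> p)"
      by (intro eqI) (simp_all add: pm pp semilin_act[OF \<phi>'(1)] h)
  qed
  show "rdiff P (\<psi> p) = \<psi> (rdiff P p)" if "p \<in> rmodule P" for p
    using that by (intro eqI[symmetric]) (simp_all add: diff_rmodule[OF P] pm pp flip: \<phi>'(4))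
  show "shifts P P 0 0 \<psi>"
  proof (rule shiftsI[OF h(2) l])
    fix x assume x: "x \<in> rbasis P"
    let ?j = "- int (hdeg P x)" and ?q = "\<psi> (e x)"
    have q: "?q \<in> rmodule P" using x pm by simp
    have fq: "\<phi> ?q = e x" using x pp by simp
    \<comment> \<open>A bijection of the whole module that preserves bidegrees need not visibly have
      an inverse that does. The projection \<open>r\<close> to the cohomological degree of
      \<open>x\<close> and the projection to its internal degree both commute with
      \<open>\<phi>\<close>, which forces \<open>?q\<close> to equal its own projections.\<close>
    define r where "r = lin_ext id (\<lambda>z. if - int (hdeg P z) = ?j then e z else 0)"
    have r: "semilin id P r" unfolding r_def by (rule semilin_lin_ext[OF hom_id(1)])
    have re: "r (e z) = (if - int (hdeg P z) = ?j then e z else 0)" for z by (simp add: r_def)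
    have rd: "r p \<in> rdegree P ?j" if "p \<in> rmodule P" for p
      unfolding r_def
    proof (rule lin_ext_rdegree)
      fix z assume "z \<in> Poly_Mapping.keys p"
      then have z: "z \<in> rbasis P" using that by (auto simp: rmodule_def)
      show "(if - int (hdeg P z) = ?j then e z else 0) \<in> rdegree P ?j"
        using e_rdegree[OF z] by (auto simp: rdegree_closed)
    qed
    have rm: "r p \<in> rmodule P" if "p \<in> rmodule P" for p by (rule rdegree_rmodule[OF rd[OF that]])
    have r1: "r p = p" if "p \<in> rdegree P ?j" for p
      by (rule semilin_eq[OF r semilin_id(1) rdegree_rmodule[OF that]])
        (use rdegree_keys[OF that] re in auto)
    have r0: "r p = 0" if "p \<in> rdegree P i" "i \<noteq> ?j" for p i
    proof (rule semilin_eq[OF r semilin_zero_fun rdegree_rmodule[OF that(1)]])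
      fix z assume "z \<in> Poly_Mapping.keys p"
      then have "- int (hdeg P z) \<noteq> ?j" using rdegree_keys[OF that(1)] that(2) by blast
      then show "r (e z) = 0" by (simp only: re if_False)
    qed
    have comm: "\<phi> (r p) = r (\<phi> p)" if "p \<in> rmodule P" for p
    proof (rule semilin_eqI[OF _ _ _ that])
      show "semilin \<sigma> P (\<lambda>p. \<phi> (r p))" using semilin_comp[OF r \<phi>'(1) rm] by simp
      show "semilin \<sigma> P (\<lambda>p. r (\<phi> p))" using semilin_comp[OF \<phi>'(1) r m] by simp
      fix z assume z: "z \<in> rbasis P"
      have fz: "\<phi> (e z) \<in> rdegree P (- int (hdeg P z))"
        using rbidegree_rdegree[OF shifts_e[OF \<phi>'(2) z]] by simp
      show "\<phi> (r (e z)) = r (\<phi> (e z))"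
        using r1[of "\<phi> (e z)"] r0[OF fz] fz semilin_zero[OF \<phi>'(1)]
        by (cases "- int (hdeg P z) = ?j") (auto simp: re)
    qed
    have "r ?q = \<psi> (\<phi> (r ?q))" using pp' rm q by simp
    also have "\<dots> = ?q" by (simp add: comm q fq r1 e_rdegree[OF x])
    finally have "?q \<in> rdegree P ?j" using rd[OF q] by simp
    then have b: "rproj P (ideg P x) ?q \<in> rbidegree A P ?j (ideg P x)" by (rule rproj_in)
    have "\<phi> (rproj P (ideg P x) ?q) = rproj P (ideg P x) (e x)"
      using rproj_commute[OF \<phi>'(1,2) q] fq by simp
    also have "\<dots> = e x" using rproj_comp[OF e_rbidegree[OF x]] by simp
    finally have "\<psi> (e x) = rproj P (ideg P x) ?q"
      by (intro eqI rbidegree_rmodule[OF b]) simp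
    then show "\<psi> (e x) \<in> rbidegree A P (?j + 0) (ideg P x + 0)" using b by simp
  qed
qed

end

end

section \<open>Skew extensions\<close>

text \<open>Reduces every identity for the skew multiplication to monomials, where it is an explicit
  formula.\<close>

lemma poly_additive_eq:
  fixes f h :: "'a::comm_monoid_add poly \<Rightarrow> 'b::ab_group_add"
  assumes "\<And>p q. f (p + q) = f p + f q" "\<And>p q. h (p + q) = h p + h q"
    and "\<And>a n. f (monom a n) = h (monom a n)"
  shows "f p = h p"
proof -
  have z: "f 0 = 0" "h 0 = 0" using assms(1)[of 0 0] assms(2)[of 0 0] by simp_all
  have s: "f (\<Sum>i\<in>S. w i) = (\<Sum>i\<in>S. f (w i))" "h (\<Sum>i\<in>S. w i) = (\<Sum>i\<in>S. h (w i))"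
    for S :: "nat set" and w
    by (induction S rule: infinite_finite_induct) (simp_all add: z assms(1,2))
  have "f (\<Sum>i\<le>degree p. monom (coeff p i) i) = h (\<Sum>i\<le>degree p. monom (coeff p i) i)"
    unfolding s assms(3) ..
  then show ?thesis by (simp only: poly_as_sum_of_monoms)
qed

section \<open>The skew extension as a connected algebra\<close>

locale skew_polynomials = connected_algebra A
  for A :: "(int, 'k::field, 'a::ab_group_add) galgebra" +
  fixes \<sigma> :: "'a \<Rightarrow> 'a" and l :: nat
  assumes \<sigma>: "graded_algebra_iso A A \<sigma>" and l: "l \<ge> 1"
begin

abbreviation "B \<equiv> skew_extension A \<sigma> l"

lemma B_simps [simp]:
  "gscale B c = map_poly (sc c)" "gone B = monom one 0"
  "p \<in> gcomp B m \<longleftrightarrow> (\<forall>n. coeff p n \<in> gcomp A (m - int l * int n))"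
  by (simp_all add: skew_extension_def)

lemma \<sigma>_hom: "graded_algebra_hom A A \<sigma>" and \<sigma>_inv_hom: "graded_algebra_hom A A (inv \<sigma>)"
  and \<sigma>_inv [simp]: "\<sigma> (inv \<sigma> a) = a" "inv \<sigma> (\<sigma> a) = a"
  using graded_algebra_iso_hom[OF \<sigma>] by blast+

lemma hom_power: "graded_algebra_hom A A \<rho> \<Longrightarrow> graded_algebra_hom A A (\<rho> ^^ n)"
  by (induction n) (auto simp: graded_algebra_hom_def graded_linear_def)

lemmas \<sigma>n = hom_props[OF hom_power[OF \<sigma>_hom]] and \<sigma>1 = hom_props[OF \<sigma>_hom]

lemma \<sigma>n_inv [simp]: "(\<sigma> ^^ n) ((inv \<sigma> ^^ n) a) = a" "(inv \<sigma> ^^ n) ((\<sigma> ^^ n) a) = a"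
proof -
  have *: "(f ^^ n) ((g ^^ n) a) = a" if "\<And>a. f (g a) = a" for f g :: "'a \<Rightarrow> 'a"
  proof (induction n)
    case (Suc n)
    have "(f ^^ Suc n) ((g ^^ Suc n) a) = (f ^^ n) (f (g ((g ^^ n) a)))"
      by (simp only: funpow_Suc_right[of n f] funpow.simps(2)[of n g] o_apply)
    then show ?case using Suc that by simp
  qed simp
  show "(\<sigma> ^^ n) ((inv \<sigma> ^^ n) a) = a" "(inv \<sigma> ^^ n) ((\<sigma> ^^ n) a) = a"
    by (rule *, simp)+
qed

text \<open>The degree of a sum is only bounded, not determined, by the degrees of its terms; with
  arbitrary upper bounds a common range of summation can be used.\<close>

lemma B_mult_superset:
  assumes "degree p \<le> N" "degree q \<le> M"
  shows "gmult B p q = (\<Sum>i\<le>N. \<Sum>j\<le>M. monom (coeff p i \<star> (\<sigma> ^^ i) (coeff q j)) (i + j))"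
proof -
  have inner: "(\<Sum>j\<le>degree q. monom (coeff p i \<star> (\<sigma> ^^ i) (coeff q j)) (i + j)) =
      (\<Sum>j\<le>M. monom (coeff p i \<star> (\<sigma> ^^ i) (coeff q j)) (i + j))" for i
    using assms(2) by (intro sum.mono_neutral_left) (auto simp: coeff_eq_0 \<sigma>n)
  have "gmult B p q = (\<Sum>i\<le>degree p. \<Sum>j\<le>M. monom (coeff p i \<star> (\<sigma> ^^ i) (coeff q j)) (i + j))"
    by (simp add: skew_extension_def inner)
  also have "\<dots> = (\<Sum>i\<le>N. \<Sum>j\<le>M. monom (coeff p i \<star> (\<sigma> ^^ i) (coeff q j)) (i + j))"
    using assms(1) by (intro sum.mono_neutral_left) (auto simp: coeff_eq_0)
  finally show ?thesis .
qed

lemma B_mult_add: "gmult B (p + p') q = gmult B p q + gmult B p' q"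
  "gmult B q (p + p') = gmult B q p + gmult B q p'"
proof -
  let ?N = "max (degree p) (degree p')"
  have N: "degree p \<le> ?N" "degree p' \<le> ?N" "degree (p + p') \<le> ?N"
    by (auto intro: degree_add_le)
  show "gmult B (p + p') q = gmult B p q + gmult B p' q"
    unfolding B_mult_superset[OF N(1) order_refl] B_mult_superset[OF N(2) order_refl]
      B_mult_superset[OF N(3) order_refl]
    by (simp add: mul_add add_monom[symmetric] sum.distrib)
  show "gmult B q (p + p') = gmult B q p + gmult B q p'"
    unfolding B_mult_superset[OF order_refl N(1)] B_mult_superset[OF order_refl N(2)]
      B_mult_superset[OF order_refl N(3)]
    by (simp add: mul_add \<sigma>n add_monom[symmetric] sum.distrib)
qed

lemma B_mult_monom [simp]: "gmult B (monom a i) (monom b j) = monom (a \<star> (\<sigma> ^^ i) b) (i + j)"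
proof -
  have "gmult B (monom a i) (monom b j) = (\<Sum>i'\<le>i. \<Sum>j'\<le>j.
      monom (coeff (monom a i) i' \<star> (\<sigma> ^^ i') (coeff (monom b j) j')) (i' + j'))"
    by (rule B_mult_superset[OF degree_monom_le degree_monom_le])
  also have "\<dots> = (\<Sum>i'\<le>i. \<Sum>j'\<le>j. if j' = j then (if i' = i then monom (a \<star> (\<sigma> ^^ i) b) (i + j) else 0) else 0)"
    by (intro sum.cong refl) (auto simp: \<sigma>n)
  finally show ?thesis by simp
qed

lemma B_scale_coeff: "coeff (map_poly (sc c) p) n = sc c (coeff p n)"
  by (simp add: coeff_map_poly)

lemma B_scale_monom [simp]: "map_poly (sc c) (monom a n) = monom (sc c a) n"
  by (simp add: map_poly_monom)

lemma B_scale_add: "map_poly (sc c) (p + q) = map_poly (sc c) p + map_poly (sc c) q"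
  by (rule poly_eqI) (simp add: B_scale_coeff scale_right_distrib)

lemma B_assoc: "gmult B (gmult B p q) r = gmult B p (gmult B q r)"
proof (rule poly_additive_eq[of "\<lambda>p. gmult B (gmult B p q) r"])
  fix a i
  show "gmult B (gmult B (monom a i) q) r = gmult B (monom a i) (gmult B q r)"
  proof (rule poly_additive_eq[of "\<lambda>q. gmult B (gmult B (monom a i) q) r"])
    fix b j
    show "gmult B (gmult B (monom a i) (monom b j)) r = gmult B (monom a i) (gmult B (monom b j) r)"
    proof (rule poly_additive_eq[of "\<lambda>r. gmult B (gmult B (monom a i) (monom b j)) r"])
      fix c n
      show "gmult B (gmult B (monom a i) (monom b j)) (monom c n) =
          gmult B (monom a i) (gmult B (monom b j) (monom c n))"
        by (simp add: \<sigma>n mul_assoc funpow_add add.assoc)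
    qed (simp_all only: B_mult_add)
  qed (simp_all only: B_mult_add)
qed (simp_all only: B_mult_add)

lemma B_scale_mult: "gmult B (map_poly (sc c) p) q = map_poly (sc c) (gmult B p q)"
  "gmult B p (map_poly (sc c) q) = map_poly (sc c) (gmult B p q)"
proof -
  show "gmult B (map_poly (sc c) p) q = map_poly (sc c) (gmult B p q)"
  proof (rule poly_additive_eq[of "\<lambda>p. gmult B (map_poly (sc c) p) q"])
    fix a i
    show "gmult B (map_poly (sc c) (monom a i)) q = map_poly (sc c) (gmult B (monom a i) q)"
      by (rule poly_additive_eq[of "\<lambda>q. gmult B (map_poly (sc c) (monom a i)) q"])
        (simp_all only: B_mult_add B_scale_add, simp add: mul_scale)
  qed (simp_all only: B_mult_add B_scale_add)
  show "gmult B p (map_poly (sc c) q) = map_poly (sc c) (gmult B p q)"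
  proof (rule poly_additive_eq[of "\<lambda>p. gmult B p (map_poly (sc c) q)"])
    fix a i
    show "gmult B (monom a i) (map_poly (sc c) q) = map_poly (sc c) (gmult B (monom a i) q)"
      by (rule poly_additive_eq[of "\<lambda>q. gmult B (monom a i) (map_poly (sc c) q)"])
        (simp_all only: B_mult_add B_scale_add, simp add: mul_scale \<sigma>n)
  qed (simp_all only: B_mult_add B_scale_add)
qed

lemma B_one: "gmult B (monom one 0) p = p" "gmult B p (monom one 0) = p"
proof -
  show "gmult B (monom one 0) p = p"
    by (rule poly_additive_eq[of "\<lambda>p. gmult B (monom one 0) p" "\<lambda>p. p"])
      (simp_all only: B_mult_add, simp)
  show "gmult B p (monom one 0) = p"
    by (rule poly_additive_eq[of "\<lambda>p. gmult B p (monom one 0)" "\<lambda>p. p"])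
      (simp_all only: B_mult_add, simp add: \<sigma>n)
qed

lemma B_graded_space: "graded_space B"
proof (rule graded_spaceI[where \<pi> = "\<lambda>n g p. gproj A (g - int l * int n) (coeff p n)"])
  show V: "vector_space (gscale B)"
    by unfold_locales
      (auto intro!: poly_eqI simp: B_scale_coeff scale_right_distrib scale_left_distrib)
  interpret vB: vector_space "gscale B" by (rule V)
  show "vB.subspace (gcomp B g)" for g
    by (rule vB.subspaceI) (simp_all add: gA B_scale_coeff)
next
  fix n g h x assume x: "x \<in> gcomp B h" and hg: "h \<noteq> g"
  have "coeff x n \<in> gcomp A (h - int l * int n)" using x by simp
  from gproj_comp[OF graded_space this] show "gproj A (g - int l * int n) (coeff x n) = 0"
    using hg by simp
next
  fix g x assume x: "x \<in> gcomp B g" "x \<noteq> 0"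
  then obtain n where n: "coeff x n \<noteq> 0" by (auto simp: poly_eq_iff)
  have "coeff x n \<in> gcomp A (g - int l * int n)" using x(1) by simp
  from gproj_comp[OF graded_space this, of "g - int l * int n"] show "\<exists>n. gproj A (g - int l * int n) (coeff x n) \<noteq> 0"
    using n by (intro exI[of _ n]) simp
qed (simp add: gproj_A_add)

lemma monom_gcomp: "a \<in> gcomp A i \<Longrightarrow> monom a n \<in> gcomp B (i + int l * int n)"
  using gA(1) by simp

lemma B_gtotal: "gtotal B = UNIV"
proof -
  note V = graded_space_vector_space[OF B_graded_space]
  have "monom a n \<in> gtotal B" for a n
  proof -
    have "a \<in> gtotal A" by simp
    with graded_space_vector_space[OF graded_space] show ?thesis
    proof (induction rule: gtotal_induct)
      case zero show ?case using gtotal_zero[OF V] by simp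
    next
      case (add x y)
      then show ?case using gtotal_add[OF V] by (simp add: add_monom[symmetric])
    next
      case (scale c x)
      then show ?case using gtotal_scale[OF V scale(2), of c] by simp
    next
      case (comp i x)
      from gcomp_gtotal[OF V monom_gcomp[OF comp]] show ?case .
    qed
  qed
  then have "(\<Sum>i\<le>degree p. monom (coeff p i) i) \<in> gtotal B" for p by (intro gtotal_sum[OF V])
  then show ?thesis by (auto simp: poly_as_sum_of_monoms)
qed

lemma B_connected: "connected_graded_algebra B"
proof -
  \<comment> \<open>The coefficient of \<open>z^n\<close> in degree \<open>g\<close> has degree
    \<open>g - l n\<close>. Here \<open>l \<ge> 1\<close> enters: it leaves nothing in negative
    degrees and only constant polynomials in degree 0.\<close>
  have neg: "g - int l * int n < 0" if "g < 0 \<or> g = 0 \<and> n \<noteq> 0" for g n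
  proof (cases "g < 0")
    case True
    have "0 \<le> int l * int n" by simp
    with True show ?thesis by linarith
  next
    case False
    with that l have "0 < int l * int n" by simp
    with False that show ?thesis by linarith
  qed
  have "graded_algebra B"
    unfolding graded_algebra_def
  proof (intro conjI allI ballI)
    show "gone B \<in> gcomp B 0" using monom_gcomp[OF one_gcomp, of 0] by simp
  next
    fix g h x y assume x: "x \<in> gcomp B g" and y: "y \<in> gcomp B h"
    have "monom (coeff x i \<star> (\<sigma> ^^ i) (coeff y j)) (i + j) \<in> gcomp B (g + h)" for i j
    proof -
      have "coeff x i \<star> (\<sigma> ^^ i) (coeff y j) \<in> gcomp A (g - int l * int i + (h - int l * int j))"
        using x y by (intro mul_gcomp \<sigma>n(5)) simp_all
      from monom_gcomp[OF this, of "i + j"] show ?thesis by (simp add: algebra_simps)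
    qed
    then show "gmult B x y \<in> gcomp B (g + h)"
      unfolding B_mult_superset[OF order_refl order_refl]
      by (intro gcomp_sum[OF B_graded_space])
  qed (simp_all only: B_graded_space B_simps B_assoc B_mult_add B_scale_mult B_one)
  moreover have "gcomp B i = {0}" if "i < 0" for i
  proof -
    have "x = 0" if "x \<in> gcomp B i" for x
      by (rule poly_eqI) (use that gcomp_negative[OF neg] \<open>i < 0\<close> in auto)
    then show ?thesis using gcomp_zero[OF B_graded_space] by blast
  qed
  moreover have "gcomp B 0 = range (\<lambda>c. gscale B c (gone B))"
  proof (intro set_eqI iffI)
    fix x assume x: "x \<in> gcomp B 0"
    have c: "coeff x n \<in> gcomp A (- (int l * int n))" for n using x by simp
    obtain c where "coeff x 0 = sc c one" using gcomp_0[of "coeff x 0"] c[of 0] by auto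
    moreover have "coeff x n = 0" if "n \<noteq> 0" for n
      using gcomp_negative[OF neg, of 0 n] c[of n] that by simp
    ultimately have "x = monom (sc c one) 0" by (intro poly_eqI) auto
    then show "x \<in> range (\<lambda>c. gscale B c (gone B))" by auto
  next
    fix x assume "x \<in> range (\<lambda>c. gscale B c (gone B))"
    then obtain c where x: "x = monom (sc c one) 0" by auto
    have "monom (sc c one) 0 \<in> gcomp B (0 + int l * int 0)"
      by (rule monom_gcomp) (rule gA(3)[OF one_gcomp])
    then show "x \<in> gcomp B 0" unfolding x by simp
  qed
  ultimately show ?thesis by (simp add: connected_graded_algebra_def B_gtotal del: B_simps(3))
qed

sublocale B: connected_algebra B by unfold_locales (rule B_connected)

text \<open>\<open>z\<close> has positive degree, so only the constant term is seen by the
  augmentation.\<close>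

lemma aug_B: "augmentation B p = \<epsilon> (coeff p 0)"
  by (rule B.aug_unique[symmetric, of "\<lambda>p. \<epsilon> (coeff p 0)"])
    (auto simp: B_scale_coeff intro!: aug_homogeneous elim: allE[of _ 0])

end

section \<open>The cone of multiplication by z\<close>

text \<open>The resolution \<open>P\<close> of \<open>A\<close> induces the resolution of \<open>B = A[z;\<sigma>]\<close> that is the cone of right
  multiplication by \<open>z\<close> on \<open>B \<otimes>\<^sub>A P\<close>, \<open>b \<otimes> p \<mapsto> b z \<otimes> \<psi> p\<close>, where \<open>\<psi>\<close> is the inverse of a lift
  \<open>\<phi>\<close> of \<open>\<sigma>\<close> to \<open>P\<close>. The Boolean in a basis element marks the shifted copy.\<close>

locale skew_cone = skew_polynomials A \<sigma> l
  for A :: "(int, 'k::field, 'a::ab_group_add) galgebra" and \<sigma> l +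
  fixes P :: "('x, 'a) resolution" and \<phi>
  assumes P: "minimal_resolution A P" and \<phi>: "resolution_twist A \<sigma> P \<phi>"
begin

declare B_simps(2) [simp del]

definition "\<psi> = inv_into (rmodule P) \<phi>"

lemmas \<psi> = inverse_twist[OF P \<sigma> \<phi>, folded \<psi>_def]

lemma \<phi>_props: "semilin \<sigma> P \<phi>" "shifts P P 0 0 \<phi>"
    "\<And>p. p \<in> rmodule P \<Longrightarrow> rdiff P (\<phi> p) = \<phi> (rdiff P p)"
  using \<phi> by (simp_all add: resolution_twist_iff)

abbreviation "d \<equiv> rdiff P"

lemmas dm = diff_rmodule[OF P] and dl = diff_semilin[OF P]
  and \<phi>m = shifts_rmodule[OF \<phi>_props(1,2)] and \<psi>m = shifts_rmodule[OF \<psi>(1,2)]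

text \<open>The element \<open>z^n \<otimes> p\<close> in the copy \<open>b\<close>. The power
  \<open>\<sigma> ^^ n\<close> comes from writing coefficients on the left:
  \<open>z^n a = \<sigma>^n(a) z^n\<close>. Calculations in the cone take place on these
  elements.\<close>

definition emb :: "nat \<Rightarrow> bool \<Rightarrow> ('x \<Rightarrow>\<^sub>0 'a) \<Rightarrow> ('x \<times> bool \<Rightarrow>\<^sub>0 'a poly)" where
  "emb n b p = Abs_poly_mapping (\<lambda>(x, c). if c = b then monom ((\<sigma> ^^ n) (Poly_Mapping.lookup p x)) n else 0)"

lemma lookup_emb: "Poly_Mapping.lookup (emb n b p) (x, c) =
    (if c = b then monom ((\<sigma> ^^ n) (Poly_Mapping.lookup p x)) n else 0)"
proof -
  have "finite {y. (\<lambda>(x, c). if c = b then monom ((\<sigma> ^^ n) (Poly_Mapping.lookup p x)) n else 0) y \<noteq> 0}"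
    by (rule finite_subset[of _ "Poly_Mapping.keys p \<times> {b}"])
      (auto simp: in_keys_iff \<sigma>n split: if_splits)
  from lookup_Abs_poly_mapping[OF this] show ?thesis by (simp add: emb_def)
qed

lemma poly_mapping_pair_eqI:
  "(\<And>x c. Poly_Mapping.lookup p (x, c) = Poly_Mapping.lookup q (x, c)) \<Longrightarrow> p = q"
  by (rule poly_mapping_eqI) auto

lemma \<sigma>n_minus: "(\<sigma> ^^ n) (- a) = - (\<sigma> ^^ n) a"
  using \<sigma>n(1)[of n a "- a"] by (simp add: \<sigma>n(6) add_eq_0_iff)

lemma emb_add: "emb n b (p + q) = emb n b p + emb n b q"
  and emb_zero [simp]: "emb n b 0 = 0"
  and emb_minus: "emb n b (- p) = - emb n b p"
  by (rule poly_mapping_pair_eqI; simp add: lookup_emb lookup_add \<sigma>n add_monom \<sigma>n_minus minus_monom)+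

lemma emb_sg: "emb n b (sg i p) = sg i (emb n b p)"
  by (simp add: sg_def emb_minus)

lemma act_emb: "B.act (monom one i) (emb n b p) = emb (i + n) b p"
  by (rule poly_mapping_pair_eqI) (simp add: lookup_emb funpow_add)

lemma act_emb_0: "B.act (monom a 0) (emb 0 b p) = emb 0 b (act a p)"
  by (rule poly_mapping_pair_eqI) (simp add: lookup_emb)

text \<open>From \<open>a z = z \<sigma>\<inverse>(a)\<close>. This matches the semilinearity of
  \<open>\<psi>\<close> and makes \<open>z \<otimes> \<psi> p\<close> linear over \<open>A\<close>
  in \<open>p\<close>.\<close>

lemma act_emb_1: "B.act (monom a 0) (emb 1 b p) = emb 1 b (act (inv \<sigma> a) p)"
  by (rule poly_mapping_pair_eqI) (simp add: lookup_emb \<sigma>1)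

lemma B_e: "B.e (x, b) = emb 0 b (e x)"
  by (rule poly_mapping_pair_eqI) (auto simp: lookup_emb lookup_single when_def B_simps(2))

text \<open>On the shifted copy the first term is the twisted multiplication by \<open>z\<close>,
  and the minus sign is that of a shifted complex. With this sign the two terms
  \<open>z \<otimes> \<psi> (d p)\<close> in \<open>D D\<close> cancel, since \<open>\<psi>\<close>
  commutes with \<open>d\<close>.\<close>

definition D0 :: "'x \<times> bool \<Rightarrow> ('x \<times> bool \<Rightarrow>\<^sub>0 'a poly)" where
  "D0 = (\<lambda>(x, b). if b then emb 1 False (\<psi> (e x)) - emb 0 True (d (e x)) else emb 0 False (d (e x)))"

text \<open>Raising the internal degree by \<open>l\<close> on the shifted copy compensates for the
  degree of \<open>z\<close>, so that \<open>D\<close> preserves internal degrees.\<close>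

definition C :: "('x \<times> bool, 'a poly) resolution" where
  "C = \<lparr>rbasis = rbasis P \<times> UNIV, hdeg = (\<lambda>(x, b). hdeg P x + of_bool b),
     ideg = (\<lambda>(x, b). ideg P x + int l * of_bool b), rdiff = B.lin_ext id D0\<rparr>"

lemma C_simps [simp]: "(x, b) \<in> rbasis C \<longleftrightarrow> x \<in> rbasis P" "hdeg C (x, b) = hdeg P x + of_bool b"
  "ideg C (x, b) = ideg P x + int l * of_bool b"
  by (simp_all add: C_def)

abbreviation "D \<equiv> rdiff C"

lemma D_semilin: "B.semilin id C D"
  by (simp add: C_def B.semilin_lin_ext[OF B.hom_id(1)])

lemma D_e: "D (B.e (x, b)) = D0 (x, b)"
proof -
  have "B.lin_ext id D0 (B.e (x, b)) = D0 (x, b)" by (rule B.lin_ext_e) simp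
  then show ?thesis by (simp add: C_def)
qed

lemma emb_rmodule [simp]: "p \<in> rmodule P \<Longrightarrow> emb n b p \<in> rmodule C"
  by (simp add: rmodule_iff lookup_emb split_paired_All \<sigma>n)

lemma emb_rdegree: "p \<in> rdegree P j \<Longrightarrow> emb n b p \<in> rdegree C (j - of_bool b)"
  by (auto simp: rdegree_iff B.rdegree_iff lookup_emb \<sigma>n)

lemma emb_rbidegree:
  assumes "p \<in> rbidegree A P j m"
  shows "emb n b p \<in> rbidegree B C (j - of_bool b) (m + int l * int n + int l * of_bool b)"
proof -
  have "Poly_Mapping.lookup (emb n b p) (x, c) \<in>
      gcomp B (m + int l * int n + int l * of_bool b - ideg C (x, c))" for x c
  proof (cases "c = b")
    case True
    have "(\<sigma> ^^ n) (Poly_Mapping.lookup p x) \<in> gcomp A (m - ideg P x)"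
      using assms by (intro \<sigma>n(5)) (simp add: rbidegree_iff)
    from monom_gcomp[OF this, of n] show ?thesis using True by (simp add: lookup_emb algebra_simps)
  next
    case False
    then show ?thesis using B.gA(1) by (simp add: lookup_emb)
  qed
  then show ?thesis using emb_rdegree[OF rbidegree_rdegree[OF assms]]
    unfolding B.rbidegree_iff split_paired_All by blast
qed

text \<open>A \<open>B\<close>-linear map on one copy is determined by an \<open>A\<close>-linear
  map on \<open>P\<close>; powers of \<open>z\<close> are simply carried along. Every map on the
  cone is evaluated on elements \<open>emb n b p\<close> in this way.\<close>

lemma cone_map:
  assumes F: "B.semilin id C F"
    and f: "\<And>p q. p \<in> rmodule P \<Longrightarrow> q \<in> rmodule P \<Longrightarrow> f (p + q) = f p + f q"
      "\<And>a p. p \<in> rmodule P \<Longrightarrow> f (act a p) = B.act (monom a 0) (f p)"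
    and e: "\<And>x. x \<in> rbasis P \<Longrightarrow> F (B.e (x, b)) = f (e x)"
    and p: "p \<in> rmodule P"
  shows "F (emb n b p) = B.act (monom one n) (f p)"
proof -
  have k: "e x \<in> rmodule P" if "x \<in> Poly_Mapping.keys p" for x using p that by (auto simp: rmodule_def)
  have f0: "f 0 = 0" using f(1)[of 0 0] by simp
  have emb_sum: "emb 0 b (\<Sum>i\<in>S. w i) = (\<Sum>i\<in>S. emb 0 b (w i))" for S :: "'x set" and w
    by (induction S rule: infinite_finite_induct) (simp_all add: emb_add)
  have f_sum: "f (\<Sum>i\<in>S. w i) = (\<Sum>i\<in>S. f (w i))" if "\<And>i. i \<in> S \<Longrightarrow> w i \<in> rmodule P" for S :: "'x set" and w
    using that by (induction S rule: infinite_finite_induct) (simp_all add: f0 f rmodule_sum)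
  let ?c = "Poly_Mapping.lookup p"
  have "F (emb 0 b (\<Sum>x\<in>Poly_Mapping.keys p. act (?c x) (e x))) =
      f (\<Sum>x\<in>Poly_Mapping.keys p. act (?c x) (e x))"
  proof -
    have "F (emb 0 b (\<Sum>x\<in>Poly_Mapping.keys p. act (?c x) (e x))) =
        (\<Sum>x\<in>Poly_Mapping.keys p. F (emb 0 b (act (?c x) (e x))))"
      unfolding emb_sum using k by (intro B.semilin_sum[OF F]) simp
    also have "\<dots> = (\<Sum>x\<in>Poly_Mapping.keys p. f (act (?c x) (e x)))"
    proof (rule sum.cong[OF refl])
      fix x assume x: "x \<in> Poly_Mapping.keys p"
      have "F (B.act (monom (?c x) 0) (B.e (x, b))) = B.act (id (monom (?c x) 0)) (F (B.e (x, b)))"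
        using k[OF x] by (intro B.semilin_act[OF F]) (simp add: B_e)
      then show "F (emb 0 b (act (?c x) (e x))) = f (act (?c x) (e x))"
        using e[of x] k[OF x] by (simp add: B_e act_emb_0 f(2))
    qed
    also have "\<dots> = f (\<Sum>x\<in>Poly_Mapping.keys p. act (?c x) (e x))"
      using k by (intro f_sum[symmetric]) simp
    finally show ?thesis .
  qed
  then have 0: "F (emb 0 b p) = f p" using expand[of p] by simp
  have "F (B.act (monom one n) (emb 0 b p)) = B.act (id (monom one n)) (F (emb 0 b p))"
    using p by (intro B.semilin_act[OF F]) simp
  then show ?thesis by (simp add: act_emb 0)
qed

lemma D_emb_False: "p \<in> rmodule P \<Longrightarrow> D (emb n False p) = emb n False (d p)"
proof -
  assume p: "p \<in> rmodule P"
  have "D (emb n False p) = B.act (monom one n) (emb 0 False (d p))"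
    by (rule cone_map[OF D_semilin _ _ _ p])
      (simp_all add: semilin_add[OF dl] semilin_act[OF dl] emb_add act_emb_0 D_e D0_def)
  then show ?thesis by (simp add: act_emb)
qed

lemma B_act_diff: "B.act a (p - q) = B.act a p - B.act a q"
  using B.act_simps(1)[of a p "- q"] by (simp add: B.act_simps)

lemma D_emb_True:
  assumes p: "p \<in> rmodule P"
  shows "D (emb n True p) = emb (Suc n) False (\<psi> p) - emb n True (d p)"
proof -
  have "D (emb n True p) = B.act (monom one n) (emb 1 False (\<psi> p) - emb 0 True (d p))"
    by (rule cone_map[OF D_semilin _ _ _ p, where f = "\<lambda>p. emb 1 False (\<psi> p) - emb 0 True (d p)"])
      (simp_all only: semilin_add[OF dl] semilin_act[OF dl] semilin_add[OF \<psi>(1)] semilin_act[OF \<psi>(1)]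
        emb_add act_emb_0 act_emb_1 D_e D0_def B_act_diff id_apply case_prod_conv if_True add_diff_add)
  then show ?thesis by (simp add: act_emb B_act_diff)
qed

text \<open>The coordinate dual to \<open>emb\<close>: the \<open>p\<close> for which
  \<open>z^n \<otimes> p\<close> is the summand in the copy \<open>b\<close>. The power of
  \<open>inv \<sigma>\<close> moves the coefficient back to the right of \<open>z^n\<close>.\<close>

definition part :: "nat \<Rightarrow> bool \<Rightarrow> ('x \<times> bool \<Rightarrow>\<^sub>0 'a poly) \<Rightarrow> ('x \<Rightarrow>\<^sub>0 'a)" where
  "part n b c = Abs_poly_mapping (\<lambda>x. (inv \<sigma> ^^ n) (coeff (Poly_Mapping.lookup c (x, b)) n))"

lemmas \<sigma>in = hom_props[OF hom_power[OF \<sigma>_inv_hom]]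

lemma lookup_part: "Poly_Mapping.lookup (part n b c) x = (inv \<sigma> ^^ n) (coeff (Poly_Mapping.lookup c (x, b)) n)"
proof -
  have "finite {x. (inv \<sigma> ^^ n) (coeff (Poly_Mapping.lookup c (x, b)) n) \<noteq> 0}"
  proof (rule finite_subset[of _ "fst ` Poly_Mapping.keys c"], rule subsetI)
    fix x assume "x \<in> {x. (inv \<sigma> ^^ n) (coeff (Poly_Mapping.lookup c (x, b)) n) \<noteq> 0}"
    then have "Poly_Mapping.lookup c (x, b) \<noteq> 0" by (auto simp: \<sigma>in(6))
    then have "(x, b) \<in> Poly_Mapping.keys c" by (simp add: in_keys_iff)
    then show "x \<in> fst ` Poly_Mapping.keys c" by (rule image_eqI[rotated]) simp
  qed simp
  from lookup_Abs_poly_mapping[OF this] show ?thesis by (simp add: part_def)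
qed

lemma part_add: "part n b (p + q) = part n b p + part n b q"
  by (rule poly_mapping_eqI) (simp add: lookup_part lookup_add \<sigma>in)

lemma part_zero [simp]: "part n b 0 = 0"
  by (rule poly_mapping_eqI) (simp add: lookup_part \<sigma>in)

lemma part_minus: "part n b (- p) = - part n b p"
  using part_add[of n b p "- p"] by (simp add: add_eq_0_iff)

lemma part_diff: "part n b (p - q) = part n b p - part n b q"
  using part_add[of n b p "- q"] by (simp add: part_minus)

lemma part_sum: "part n b (\<Sum>i\<in>S. w i) = (\<Sum>i\<in>S. part n b (w i))"
  by (induction S rule: infinite_finite_induct) (simp_all add: part_add)

lemma part_emb: "part n b (emb m c p) = (if n = m \<and> b = c then p else 0)"
  by (rule poly_mapping_eqI) (auto simp: lookup_part lookup_emb \<sigma>in)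

lemma part_eqI:
  assumes "\<And>n b. part n b p = part n b q"
  shows "p = q"
proof (rule poly_mapping_pair_eqI, rule poly_eqI)
  fix x b n
  have "(\<sigma> ^^ n) (Poly_Mapping.lookup (part n b p) x) = (\<sigma> ^^ n) (Poly_Mapping.lookup (part n b q) x)"
    by (simp only: assms)
  then show "coeff (Poly_Mapping.lookup p (x, b)) n = coeff (Poly_Mapping.lookup q (x, b)) n"
    by (simp add: lookup_part)
qed

lemma part_bounded: "\<exists>N. \<forall>n>N. \<forall>b. part n b c = 0"
proof -
  define N where "N = Max (insert 0 (degree ` Poly_Mapping.lookup c ` Poly_Mapping.keys c))"
  have N: "degree (Poly_Mapping.lookup c y) \<le> N" for y
  proof (cases "y \<in> Poly_Mapping.keys c")
    case True
    then show ?thesis unfolding N_def by (intro Max_ge) auto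
  next
    case False
    then show ?thesis by (simp add: in_keys_iff)
  qed
  have "part n b c = 0" if "n > N" for n b
  proof (rule poly_mapping_eqI)
    fix x
    have "coeff (Poly_Mapping.lookup c (x, b)) n = 0"
      by (rule coeff_eq_0[OF le_less_trans[OF N that]])
    then show "Poly_Mapping.lookup (part n b c) x = Poly_Mapping.lookup 0 x"
      by (simp add: lookup_part \<sigma>in)
  qed
  then show ?thesis by blast
qed

lemma part_rmodule: "c \<in> rmodule C \<Longrightarrow> part n b c \<in> rmodule P"
  by (simp add: rmodule_iff lookup_part split_paired_All \<sigma>in)

lemma part_rdegree: "c \<in> rdegree C j \<Longrightarrow> part n b c \<in> rdegree P (j + of_bool b)"
  by (auto simp: rdegree_iff B.rdegree_iff lookup_part \<sigma>in)

text \<open>Each element is the finite sum of its summands \<open>z^n \<otimes> p\<close> in both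
  copies, since the degrees of its coefficients are bounded.\<close>

lemma cone_induct [consumes 1, case_names add emb]:
  assumes c: "c \<in> rmodule C"
    and add: "\<And>p q. p \<in> rmodule C \<Longrightarrow> q \<in> rmodule C \<Longrightarrow> Q p \<Longrightarrow> Q q \<Longrightarrow> Q (p + q)"
    and emb: "\<And>n b p. p \<in> rmodule P \<Longrightarrow> Q (emb n b p)"
  shows "Q c"
proof -
  obtain N where N: "\<And>n b. n > N \<Longrightarrow> part n b c = 0" using part_bounded by blast
  let ?w = "\<lambda>(n, b). emb n b (part n b c)"
  have w: "?w y \<in> rmodule C" "Q (?w y)" for y
    using emb part_rmodule[OF c] by (auto split: prod.split)
  have s: "(\<Sum>y\<in>S. ?w y) \<in> rmodule C \<and> Q (\<Sum>y\<in>S. ?w y)" if "finite S" for S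
    using that
  proof (induction S rule: finite_induct)
    case empty
    show ?case using emb[of 0 0 False] by simp
  next
    case (insert y S)
    then show ?case using add[OF w(1)[of y] _ w(2)[of y]] w(1)[of y] by simp
  qed
  have "(\<Sum>y\<in>{..N} \<times> UNIV. ?w y) = c"
  proof (rule part_eqI)
    fix n b
    have "part n b (\<Sum>y\<in>{..N} \<times> UNIV. ?w y) = (\<Sum>y\<in>{..N} \<times> UNIV. if y = (n, b) then part n b c else 0)"
      unfolding part_sum
    proof (rule sum.cong[OF refl])
      fix y
      show "part n b (?w y) = (if y = (n, b) then part n b c else 0)"
        by (cases y) (auto simp: part_emb)
    qed
    also have "\<dots> = (if (n, b) \<in> {..N} \<times> UNIV then part n b c else 0)" by (rule sum.delta) simp
    finally show "part n b (\<Sum>y\<in>{..N} \<times> UNIV. ?w y) = part n b c"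
      using N[of n b] by (cases "n \<le> N") simp_all
  qed
  then show ?thesis using s[of "{..N} \<times> UNIV"] by simp
qed

lemma part_D:
  assumes "c \<in> rmodule C"
  shows "part n True (D c) = - d (part n True c)" "part 0 False (D c) = d (part 0 False c)"
    "part (Suc n) False (D c) = d (part (Suc n) False c) + \<psi> (part n True c)"
proof -
  have "part n True (D c) = - d (part n True c) \<and> part 0 False (D c) = d (part 0 False c) \<and>
    part (Suc n) False (D c) = d (part (Suc n) False c) + \<psi> (part n True c)"
    using assms
  proof (induction rule: cone_induct)
    case (add p q)
    then show ?case
      by (simp add: B.semilin_add[OF D_semilin] part_add semilin_add[OF dl] semilin_add[OF \<psi>(1)] part_rmodule)
  next
    case (emb m b p)
    then show ?case
      using semilin_zero[OF dl] semilin_zero[OF \<psi>(1)]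
      by (cases b) (auto simp: D_emb_True D_emb_False part_emb part_diff)
  qed
  then show "part n True (D c) = - d (part n True c)" "part 0 False (D c) = d (part 0 False c)"
    "part (Suc n) False (D c) = d (part (Suc n) False c) + \<psi> (part n True c)" by blast+
qed

lemma D_D: "c \<in> rmodule C \<Longrightarrow> D c \<in> rmodule C \<and> D (D c) = 0"
proof (induction rule: cone_induct)
  case (add p q)
  then show ?case by (simp add: B.semilin_add[OF D_semilin])
next
  case (emb n b p)
  then show ?case
    using diff_diff[OF P] semilin_zero[OF \<psi>(1)]
    by (cases b) (auto simp: D_emb_True D_emb_False B.semilin_diff[OF D_semilin] dm \<psi>m \<psi>(3))
qed

text \<open>As \<open>\<psi>\<close> is bijective, multiplication by \<open>z\<close> identifies the
  shifted copy with everything divisible by \<open>z\<close> in the unshifted copy. These two pieces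
  cancel, so a cycle is represented by its coefficient of \<open>z^0\<close>.\<close>

lemma D_homotopy:
  assumes c: "c \<in> rdegree C j" and 0: "D c = 0"
  obtains w where "w \<in> rdegree C (j - 1)" "c = D w + emb 0 False (part 0 False c)"
proof -
  obtain N where N: "\<And>n b. n > N \<Longrightarrow> part n b c = 0" using part_bounded by blast
  have cm: "c \<in> rmodule C" by (rule B.rdegree_rmodule[OF c])
  \<comment> \<open>The boundary of \<open>z^n \<otimes> \<phi> q\<close> in the shifted copy has
    unshifted component \<open>z^(n+1) \<otimes> q\<close>. Hence \<open>D w\<close> accounts for
    all positive powers of \<open>z\<close> in the unshifted part of \<open>c\<close>; beyond
    \<open>N\<close> there are none.\<close>
  define w where "w = (\<Sum>n\<le>N. emb n True (\<phi> (part (Suc n) False c)))"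
  have "part (Suc n) False c \<in> rdegree P j" for n using part_rdegree[OF c, of "Suc n" False] by simp
  then have "\<phi> (part (Suc n) False c) \<in> rdegree P j" for n
    using shifts_rdegree[OF \<phi>_props(1,2)] by force
  then have wd: "w \<in> rdegree C (j - 1)"
    unfolding w_def using emb_rdegree[of _ j _ True] by (intro B.rdegree_sum) simp
  then have wm: "w \<in> rmodule C" by (rule B.rdegree_rmodule)
  have wF: "part n False w = 0" for n
    by (simp add: w_def part_sum part_emb)
  have wT: "part n True w = \<phi> (part (Suc n) False c)" for n
  proof -
    have "part n True w = (\<Sum>i\<le>N. if i = n then \<phi> (part (Suc n) False c) else 0)"
      unfolding w_def part_sum by (rule sum.cong) (auto simp: part_emb)
    then show ?thesis using N[of "Suc n" False] semilin_zero[OF \<phi>_props(1)] by auto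
  qed
  have "c - D w = emb 0 False (part 0 False c)"
  proof (rule part_eqI)
    fix n b
    \<comment> \<open>For a cycle the shifted components are forced by the unshifted ones, so they
      agree with those of \<open>D w\<close> automatically.\<close>
    have dF: "d (part (Suc m) False c) + \<psi> (part m True c) = 0" for m
      using part_D(3)[OF cm, of m] 0 by simp
    show "part n b (c - D w) = part n b (emb 0 False (part 0 False c))"
    proof (cases b)
      case True
      have "part n True c = \<phi> (\<psi> (part n True c))" by (simp add: \<psi>(4) part_rmodule[OF cm])
      also have "\<psi> (part n True c) = - d (part (Suc n) False c)"
        using dF[of n] by (simp add: add_eq_0_iff)
      also have "\<phi> \<dots> = - d (\<phi> (part (Suc n) False c))"
        by (simp add: semilin_minus[OF \<phi>_props(1)] dm part_rmodule[OF cm] \<phi>_props(3))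
      finally show ?thesis using True by (simp add: part_diff part_D(1)[OF wm] wT part_emb)
    next
      case False
      show ?thesis
      proof (cases n)
        case 0
        then show ?thesis using False semilin_zero[OF dl]
          by (simp add: part_diff part_D(2)[OF wm] wF part_emb)
      next
        case (Suc m)
        have "\<psi> (\<phi> (part (Suc m) False c)) = part (Suc m) False c"
          by (simp add: \<psi>(5) part_rmodule[OF cm])
        then show ?thesis using False Suc semilin_zero[OF dl]
          by (simp add: part_diff part_D(3)[OF wm] wF wT part_emb)
      qed
    qed
  qed
  then have "c = D w + emb 0 False (part 0 False c)" by (simp add: algebra_simps)
  with wd show ?thesis by (rule that)
qed

section \<open>Minimality and exactness of the cone\<close>

lemma pairing_emb_0: "pairing B f (emb 0 b p) = pairing A (\<lambda>x. f (x, b)) p"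
proof -
  have emb_sum: "emb 0 b (\<Sum>i\<in>S. w i) = (\<Sum>i\<in>S. emb 0 b (w i))" for S :: "'x set" and w
    by (induction S rule: infinite_finite_induct) (simp_all add: emb_add)
  have "pairing B f (emb 0 b (\<Sum>x\<in>Poly_Mapping.keys p. act (Poly_Mapping.lookup p x) (e x))) =
      (\<Sum>x\<in>Poly_Mapping.keys p. \<epsilon> (Poly_Mapping.lookup p x) * f (x, b))"
    unfolding emb_sum B.pairing_sum
  proof (rule sum.cong[OF refl])
    fix x
    have "emb 0 b (act (Poly_Mapping.lookup p x) (e x)) = B.act (monom (Poly_Mapping.lookup p x) 0) (B.e (x, b))"
      by (simp only: B_e act_emb_0)
    then show "pairing B f (emb 0 b (act (Poly_Mapping.lookup p x) (e x))) =
        \<epsilon> (Poly_Mapping.lookup p x) * f (x, b)"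
      by (simp only: B.pairing_act B.pairing_e aug_B) simp
  qed
  then show ?thesis unfolding expand[symmetric] by (simp add: pairing_def)
qed

lemma raug_emb_0: "raugmentation B C (emb 0 False p) = raugmentation A P p"
  "raugmentation B C (emb 0 True p) = 0"
proof -
  have "(\<lambda>x. unit_class C (x, False)) = (unit_class P :: 'x \<Rightarrow> 'k)"
    "(\<lambda>x. unit_class C (x, True)) = (\<lambda>x. 0 :: 'k)"
    by (simp_all add: unit_class_def fun_eq_iff)
  then show "raugmentation B C (emb 0 False p) = raugmentation A P p"
    "raugmentation B C (emb 0 True p) = 0"
    by (simp_all add: raugmentation_def pairing_emb_0 pairing_fun)
qed

text \<open>The term with an extra \<open>z\<close> has constant coefficient 0, and the terms with
  \<open>d\<close> inherit minimality from \<open>P\<close>.\<close>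

lemma D_minimal: "c \<in> rmodule C \<Longrightarrow> augmentation B (Poly_Mapping.lookup (D c) y) = 0"
proof (induction rule: cone_induct)
  case (add p q)
  then show ?case by (simp add: B.semilin_add[OF D_semilin] lookup_add)
next
  case (emb n b p)
  obtain x c where "y = (x, c)" by (cases y)
  then show ?case
    using diff_minimal[OF P emb, of x] aug_hom[OF hom_power[OF \<sigma>_hom]]
    by (cases b) (auto simp: D_emb_True D_emb_False[OF emb] D_emb_True[OF emb] lookup_emb lookup_minus aug_B)
qed

text \<open>By \<open>D_homotopy\<close> only \<open>1 \<otimes> p\<close> with \<open>p\<close> a
  cycle of \<open>P\<close> remains, and exactness of \<open>P\<close> makes it a boundary. In
  degree 0 the augmentation of \<open>p\<close> vanishes because boundaries in the cone have
  augmentation 0.\<close>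

theorem cone_minimal_resolution: "minimal_resolution B C"
proof -
  have sh: "B.shifts C C 1 0 D"
  proof (rule B.shiftsI[OF B.hom_id(1) D_semilin])
    fix y assume "y \<in> rbasis C"
    then obtain x b where y: "y = (x, b)" and x: "x \<in> rbasis P" by (cases y) auto
    have 1: "emb 0 b (d (e x)) \<in> rbidegree B C (- int (hdeg C y) + 1) (ideg C y + 0)"
      using emb_rbidegree[OF diff_e[OF P x], of 0 b] by (simp add: y algebra_simps)
    have 2: "emb 1 False (\<psi> (e x)) \<in> rbidegree B C (- int (hdeg C (x, True)) + 1) (ideg C (x, True) + 0)"
      using emb_rbidegree[OF shifts_e[OF \<psi>(2) x], of 1 False] by (simp add: algebra_simps)
    show "D (B.e y) \<in> rbidegree B C (- int (hdeg C y) + 1) (ideg C y + 0)"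
      using 1 2 unfolding y D_e D0_def by (cases b) (auto simp del: C_simps intro: B.rbidegree_closed)
  qed
  have Dd: "D p \<in> rdegree C (j + 1)" if "p \<in> rdegree C j" for p j
    by (rule B.shifts_rdegree[OF D_semilin sh that])
  have neg: "{p \<in> rdegree C j. D p = 0} = D ` rdegree C (j - 1)" if j: "j < 0" for j
  proof (intro set_eqI iffI)
    fix c assume "c \<in> {p \<in> rdegree C j. D p = 0}"
    then have c: "c \<in> rdegree C j" "D c = 0" by simp_all
    obtain w where w: "w \<in> rdegree C (j - 1)" "c = D w + emb 0 False (part 0 False c)"
      by (rule D_homotopy[OF c])
    have "part 0 False c \<in> rdegree P j" using part_rdegree[OF c(1), of 0 False] by simp
    moreover have "d (part 0 False c) = 0" using part_D(2)[OF B.rdegree_rmodule[OF c(1)]] c(2) by simp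
    ultimately obtain r where r: "r \<in> rdegree P (j - 1)" "part 0 False c = d r"
      using diff_exact[OF P j] by blast
    have "w + emb 0 False r \<in> rdegree C (j - 1)"
      using w(1) emb_rdegree[OF r(1), of 0 False] by (simp add: B.rdegree_closed)
    moreover have "c = D (w + emb 0 False r)"
      using w r(2) B.rdegree_rmodule[OF w(1)] rdegree_rmodule[OF r(1)]
      by (simp add: B.semilin_add[OF D_semilin] D_emb_False)
    ultimately show "c \<in> D ` rdegree C (j - 1)" by blast
  next
    fix c assume "c \<in> D ` rdegree C (j - 1)"
    then obtain w where w: "w \<in> rdegree C (j - 1)" "c = D w" by blast
    then show "c \<in> {p \<in> rdegree C j. D p = 0}"
      using Dd[OF w(1)] D_D[OF B.rdegree_rmodule[OF w(1)]] by simp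
  qed
  have zero: "{p \<in> rdegree C 0. raugmentation B C p = 0} = D ` rdegree C (- 1)"
  proof (intro set_eqI iffI)
    fix c assume "c \<in> {p \<in> rdegree C 0. raugmentation B C p = 0}"
    then have c: "c \<in> rdegree C 0" "raugmentation B C c = 0" by simp_all
    have "D c = 0" using B.rdegree_positive[OF _ Dd[OF c(1)]] by simp
    then obtain w where w: "w \<in> rdegree C (0 - 1)" "c = D w + emb 0 False (part 0 False c)"
      by (rule D_homotopy[OF c(1)])
    have "raugmentation B C (D w) = 0"
      unfolding raugmentation_def by (intro B.pairing_minimal D_minimal B.rdegree_rmodule[OF w(1)])
    then have "raugmentation A P (part 0 False c) = 0"
      using arg_cong[OF w(2), of "raugmentation B C"] c(2)
      by (simp add: raug_emb_0 flip: raug_emb_0(1)) (simp add: raugmentation_def B.pairing_add)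
    moreover have "part 0 False c \<in> rdegree P 0" using part_rdegree[OF c(1), of 0 False] by simp
    ultimately obtain r where r: "r \<in> rdegree P (- 1)" "part 0 False c = d r"
      using diff_exact_0[OF P] by blast
    have "w + emb 0 False r \<in> rdegree C (- 1)"
      using w(1) emb_rdegree[OF r(1), of 0 False] by (simp add: B.rdegree_closed)
    moreover have "c = D (w + emb 0 False r)"
      using w r(2) B.rdegree_rmodule[OF w(1)] rdegree_rmodule[OF r(1)]
      by (simp add: B.semilin_add[OF D_semilin] D_emb_False)
    ultimately show "c \<in> D ` rdegree C (- 1)" by blast
  next
    fix c assume "c \<in> D ` rdegree C (- 1)"
    then obtain w where w: "w \<in> rdegree C (- 1)" "c = D w" by blast
    have "raugmentation B C (D w) = 0"
      unfolding raugmentation_def by (intro B.pairing_minimal D_minimal B.rdegree_rmodule[OF w(1)])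
    then show "c \<in> {p \<in> rdegree C 0. raugmentation B C p = 0}"
      using Dd[OF w(1)] w(2) by simp
  qed
  obtain q where q: "q \<in> rbasis P" "hdeg P q = 0" "ideg P q = 0"
    "\<And>x. x \<in> rbasis P \<Longrightarrow> hdeg P x = 0 \<Longrightarrow> x = q"
    by (rule unit_basis[OF P]) (rule that)
  have "y = (q, False)" if "y \<in> rbasis C" "hdeg C y = 0" for y
    using that q(4)[of "fst y"] by (cases y) (auto simp: of_bool_def split: if_splits)
  then have "{y \<in> rbasis C. hdeg C y = 0} = {(q, False)}"
    using q(1,2) by auto
  then have "\<exists>y. {x \<in> rbasis C. hdeg C x = 0} = {y} \<and> ideg C y = 0"
    using q(3) by (intro exI[of _ "(q, False)"]) simp
  then show ?thesis
    unfolding minimal_resolution_def B.semilinear_iff B.shifts_iff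
    using D_semilin sh neg zero D_minimal by (simp add: B.positive_part_iff)
qed

end

section \<open>The Ext-algebra of the cone\<close>

context connected_algebra
begin

lemma sg_mult: "sg n c = (- 1) ^ n * (c :: 'b::field)"
  by (simp add: sg_def)

context
  fixes P :: "('x, 'a) resolution"
  assumes P: "minimal_resolution A P"
begin

text \<open>For \<open>\<chi> = \<phi>\<close> this is (-1)^i times the automorphism
  \<open>\<tau>\<close> on classes of cohomological degree \<open>i\<close>. With the sign built in,
  the commutation rule with \<open>\<omega>\<close> becomes one linear statement on the whole
  Ext-algebra.\<close>

definition sign_twist :: "(('x \<Rightarrow>\<^sub>0 'a) \<Rightarrow> ('x \<Rightarrow>\<^sub>0 'a)) \<Rightarrow> ('x \<Rightarrow> 'k) \<Rightarrow> 'x \<Rightarrow> 'k" where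
  "sign_twist \<chi> f = (\<lambda>x. if x \<in> rbasis P then sg (hdeg P x) (pairing A f (\<chi> (e x))) else 0)"

lemma sign_twist_linear:
  assumes "shifts P P 0 0 \<chi>"
  shows "graded_linear (ext_algebra A P) (ext_algebra A P) (sign_twist \<chi>)"
  unfolding graded_linear_def
proof (intro conjI allI ballI)
  fix g f assume f: "f \<in> gcomp (ext_algebra A P) g"
  have "ext_bidegree P x = g" if x: "x \<in> rbasis P" and n: "pairing A f (\<chi> (e x)) \<noteq> 0" for x
    using pairing_bidegree[OF shifts_e[OF assms x] n] f by (auto simp: ext_bidegree_def)
  then show "sign_twist \<chi> f \<in> gcomp (ext_algebra A P) g" by (auto simp: sign_twist_def)
qed (auto simp: sign_twist_def fun_eq_iff plus_fun_def pairing_fun sg_mult distrib_left)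

text \<open>\<open>\<chi>\<close> preserves the homological degree, so the two signs coincide and
  cancel.\<close>

lemma sign_twist_inverse:
  assumes \<chi>: "graded_algebra_hom A A \<rho>" "semilin \<rho> P \<chi>" "shifts P P 0 0 \<chi>"
    and \<chi>': "graded_algebra_hom A A \<rho>'" "semilin \<rho>' P \<chi>'"
    and inv: "\<And>p. p \<in> rmodule P \<Longrightarrow> \<chi>' (\<chi> p) = p"
    and f: "f \<in> gtotal (ext_algebra A P)"
  shows "sign_twist \<chi> (sign_twist \<chi>' f) = f"
proof
  fix x
  show "sign_twist \<chi> (sign_twist \<chi>' f) x = f x"
  proof (cases "x \<in> rbasis P")
    case True
    have b: "\<chi> (e x) \<in> rdegree P (- int (hdeg P x))"
      using rbidegree_rdegree[OF shifts_e[OF \<chi>(3) True]] by simp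
    have "pairing A (sign_twist \<chi>' f) (\<chi> (e x)) =
        pairing A (\<lambda>y. (- 1) ^ hdeg P x * pairing A f (\<chi>' (e y))) (\<chi> (e x))"
      by (rule pairing_cong) (use rdegree_keys[OF b] in \<open>auto simp: sign_twist_def sg_mult\<close>)
    also have "\<dots> = sg (hdeg P x) (pairing A f (\<chi>' (\<chi> (e x))))"
      by (simp add: pairing_fun sg_mult pairing_semilin[OF \<chi>' rdegree_rmodule[OF b]])
    finally show ?thesis using True by (simp add: sign_twist_def inv)
  next
    case False
    then show ?thesis using ext_total(1)[OF f, of x] by (auto simp: sign_twist_def)
  qed
qed

end

end

section \<open>Products with classes on the two copies\<close>

context skew_cone
begin

abbreviation "EA \<equiv> ext_algebra A P"
abbreviation "EC \<equiv> ext_algebra B C"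

definition incl :: "('x \<Rightarrow> 'k) \<Rightarrow> 'x \<times> bool \<Rightarrow> 'k" where
  "incl f = (\<lambda>(x, b). if b then 0 else f x)"

definition shifted :: "('x \<Rightarrow> 'k) \<Rightarrow> 'x \<times> bool \<Rightarrow> 'k" where
  "shifted f = (\<lambda>(x, b). if b then f x else 0)"

definition "\<omega> = shifted (unit_class P)"

lemma incl_linear: "graded_linear EA EC incl"
  by (auto simp: graded_linear_def incl_def fun_eq_iff plus_fun_apply ext_bidegree_def split: if_splits)

lemma cone_bidegree [simp]: "ext_bidegree C (x, b) = ext_bidegree P x + (of_bool b, - int l * of_bool b)"
  by (simp add: ext_bidegree_def)

lemma \<omega>_comp: "\<omega> \<in> gcomp EC (1, - int l)"
  using unit_comp[OF P] by (auto simp: \<omega>_def shifted_def zero_prod_def split: if_splits)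

lemma B_hom_id: "graded_algebra_hom B B id" by (rule B.hom_id(1))

text \<open>Sign and conjugation on the shifted copy are forced by the component
  \<open>z \<otimes> \<psi>\<close> of \<open>D\<close>. If the lift there is
  \<open>\<plusminus> t\<close>, compatibility with the sign rule requires
  \<open>(-1)^i \<psi> (\<plusminus> t) = \<theta> \<psi>\<close>, that is
  \<open>\<plusminus> t = (-1)^i \<phi> \<theta> \<psi>\<close>.\<close>

lemma cone_lift:
  assumes \<alpha>: "\<alpha> \<in> gcomp EA (i, s)" and l: "yoneda_lift A P i s \<alpha> \<theta>"
  obtains \<Phi> where "yoneda_lift B C i s (incl \<alpha>) \<Phi>"
    "\<And>x. x \<in> rbasis P \<Longrightarrow> \<Phi> (B.e (x, False)) = emb 0 False (\<theta> (e x))"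
    "\<And>x. x \<in> rbasis P \<Longrightarrow> \<Phi> (B.e (x, True)) = sg i (emb 0 True (\<phi> (\<theta> (\<psi> (e x)))))"
proof -
  have \<theta>: "semilin id P \<theta>" "shifts P P (int i) s \<theta>"
    "\<And>p. p \<in> rmodule P \<Longrightarrow> sg i (d (\<theta> p)) = \<theta> (d p)"
    "\<And>p. p \<in> rdegree P (- int i) \<Longrightarrow> raugmentation A P (\<theta> p) = pairing A \<alpha> p"
    using l by (simp_all add: yoneda_lift_iff)
  note \<theta>m = shifts_rmodule[OF \<theta>(1,2)]
  let ?t = "\<lambda>p. \<phi> (\<theta> (\<psi> p))"
  define \<Phi> where "\<Phi> = B.lin_ext id
    (\<lambda>(x, b). if b then sg i (emb 0 True (?t (e x))) else emb 0 False (\<theta> (e x)))"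
  have \<Phi>: "B.semilin id C \<Phi>" unfolding \<Phi>_def by (rule B.semilin_lin_ext[OF B_hom_id])
  have e: "\<Phi> (B.e (x, b)) = (if b then sg i (emb 0 True (?t (e x))) else emb 0 False (\<theta> (e x)))" for x b
  proof -
    have "\<Phi> (B.e (x, b)) = (\<lambda>(x, b). if b then sg i (emb 0 True (?t (e x))) else emb 0 False (\<theta> (e x))) (x, b)"
      unfolding \<Phi>_def by (rule B.lin_ext_e) simp
    then show ?thesis by simp
  qed
  have tm: "?t p \<in> rmodule P" if "p \<in> rmodule P" for p using that \<phi>m \<theta>m \<psi>m by simp
  have t: "?t (p + q) = ?t p + ?t q" "?t (act a p) = act a (?t p)"
    if "p \<in> rmodule P" "q \<in> rmodule P" for p q a
    using that \<psi>m \<theta>m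
    by (simp_all add: semilin_add[OF \<psi>(1)] semilin_add[OF \<theta>(1)] semilin_add[OF \<phi>_props(1)]
        semilin_act[OF \<psi>(1)] semilin_act[OF \<theta>(1)] semilin_act[OF \<phi>_props(1)])
  have \<Phi>F: "\<Phi> (emb n False p) = emb n False (\<theta> p)" if p: "p \<in> rmodule P" for n p
  proof -
    have "\<Phi> (emb n False p) = B.act (monom one n) (emb 0 False (\<theta> p))"
      by (rule cone_map[OF \<Phi> _ _ _ p])
        (simp_all add: semilin_add[OF \<theta>(1)] semilin_act[OF \<theta>(1)] emb_add act_emb_0 e)
    then show ?thesis by (simp add: act_emb)
  qed
  have \<Phi>T: "\<Phi> (emb n True p) = sg i (emb n True (?t p))" if p: "p \<in> rmodule P" for n p
  proof -
    have "\<Phi> (emb n True p) = B.act (monom one n) (sg i (emb 0 True (?t p)))"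
      by (rule cone_map[OF \<Phi> _ _ _ p, where f = "\<lambda>p. sg i (emb 0 True (?t p))"])
        (simp_all add: t(1) t(2)[OF _ rmodule_simps(1)] emb_add act_emb_0 e B.sg_simps(9))
    then show ?thesis by (simp add: act_emb B.sg_simps(9))
  qed
  have "yoneda_lift B C i s (incl \<alpha>) \<Phi>"
    unfolding B.yoneda_lift_iff
  proof (intro conjI ballI)
    show "B.semilin id C \<Phi>" by (rule \<Phi>)
    show "B.shifts C C (int i) s \<Phi>"
    proof (rule B.shiftsI[OF B_hom_id \<Phi>])
      fix y assume "y \<in> rbasis C"
      then obtain x b where y: "y = (x, b)" and x: "x \<in> rbasis P" by (cases y) auto
      have "\<theta> (e x) \<in> rbidegree A P (- int (hdeg P x) + int i) (ideg P x + s)"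
        by (rule shifts_e[OF \<theta>(2) x])
      from emb_rbidegree[OF this, of 0 False]
      have 1: "emb 0 False (\<theta> (e x)) \<in> rbidegree B C (- int (hdeg P x) + int i) (ideg P x + s)" by simp
      have "shifts P P (int i) s ?t"
        using shifts_comp[OF shifts_comp[OF \<psi>(2) \<theta>(2)] \<phi>_props(2)] by simp
      then have "?t (e x) \<in> rbidegree A P (- int (hdeg P x) + int i) (ideg P x + s)"
        by (rule shifts_e[OF _ x])
      from emb_rbidegree[OF this, of 0 True]
      have 2: "emb 0 True (?t (e x)) \<in> rbidegree B C (- int (hdeg C (x, True)) + int i) (ideg C (x, True) + s)"
        by (simp add: algebra_simps)
      show "\<Phi> (B.e y) \<in> rbidegree B C (- int (hdeg C y) + int i) (ideg C y + s)"
        using 1 B.rbidegree_closed(4)[OF 2, of i] unfolding y e by (cases b) simp_all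
    qed
    fix c assume "c \<in> rmodule C"
    then have "\<Phi> c \<in> rmodule C \<and> sg i (D (\<Phi> c)) = \<Phi> (D c)"
    proof (induction rule: cone_induct)
      case (add p q)
      then show ?case
        using D_D by (simp add: B.semilin_add[OF \<Phi>] B.semilin_add[OF D_semilin])
    next
      case (emb n b p)
      have m: "\<Phi> (emb n b p) \<in> rmodule C"
        using emb tm \<theta>m B.rmodule_simps(6)[of _ C i] by (cases b) (simp_all add: \<Phi>T \<Phi>F)
      \<comment> \<open>The conjugate obeys the sign rule of \<open>\<theta>\<close>, since
        \<open>\<phi>\<close> and \<open>\<psi>\<close> commute with \<open>d\<close> strictly. This
        settles the component of the equation inside the shifted copy.\<close>
      have "?t (d p) = \<phi> (\<theta> (d (\<psi> p)))" using emb by (simp add: \<psi>(3))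
      also have "\<dots> = \<phi> (sg i (d (\<theta> (\<psi> p))))" using emb by (simp add: \<theta>(3) \<psi>m)
      also have "\<dots> = sg i (d (?t p))"
        using emb by (simp add: semilin_sg[OF \<phi>_props(1)] dm \<theta>m \<psi>m \<phi>_props(3))
      finally have td: "?t (d p) = sg i (d (?t p))" .
      have "sg i (D (\<Phi> (emb n b p))) = \<Phi> (D (emb n b p))"
      proof (cases b)
        case True
        have "sg i (D (sg i (emb n True (?t p)))) = D (emb n True (?t p))"
          using tm[OF emb] by (simp add: B.semilin_sg[OF D_semilin])
        then show ?thesis
          using True emb \<theta>m \<psi>m tm dm td
          by (simp add: \<Phi>T D_emb_True B.semilin_diff[OF \<Phi>] \<Phi>F \<psi>(5) emb_sg)
      next
        case False
        then show ?thesis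
          using emb \<theta>m dm by (simp add: \<Phi>F D_emb_False \<theta>(3)[symmetric] emb_sg)
      qed
      with m show ?case by simp
    qed
    then show "sg i (D (\<Phi> c)) = \<Phi> (D c)" by simp
  next
    fix c assume c: "c \<in> rdegree C (- int i)"
    show "raugmentation B C (\<Phi> c) = pairing B (incl \<alpha>) c"
      unfolding raugmentation_def B.pairing_semilin[OF B_hom_id \<Phi> B.rdegree_rmodule[OF c]]
    proof (rule B.pairing_cong)
      fix y assume y: "y \<in> Poly_Mapping.keys c"
      obtain x b where xb: "y = (x, b)" by (cases y)
      have x: "x \<in> rbasis P" "hdeg P x + of_bool b = i" using B.rdegree_keys[OF c y] by (auto simp: xb)
      have "raugmentation B C (\<Phi> (B.e y)) = incl \<alpha> y"
      proof (cases b)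
        case True
        have "raugmentation B C (sg i q) = sg i (raugmentation B C q)" for q
          by (simp add: raugmentation_def B.pairing_sg)
        then show ?thesis using True by (simp add: xb e incl_def raug_emb_0)
      next
        case False
        then show ?thesis using x \<theta>(4)[of "e x"] e_rdegree[OF x(1)]
          by (simp add: xb e incl_def raug_emb_0)
      qed
      then show "pairing B (unit_class C) (\<Phi> (B.e y)) = incl \<alpha> y" by (simp add: raugmentation_def)
    qed
  qed
  then show ?thesis using that e by simp
qed

lemma product_incl:
  assumes \<alpha>: "\<alpha> \<in> gcomp EA (i, s)" and l: "yoneda_lift A P i s \<alpha> \<theta>"
  shows "yoneda_product B C \<gamma> (incl \<alpha>) = (\<lambda>(x, b). if x \<in> rbasis P then
    if b then sg i (pairing A (\<lambda>x. \<gamma> (x, True)) (\<phi> (\<theta> (\<psi> (e x)))))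
    else pairing A (\<lambda>x. \<gamma> (x, False)) (\<theta> (e x)) else 0)"
proof -
  obtain \<Phi> where \<Phi>: "yoneda_lift B C i s (incl \<alpha>) \<Phi>"
    "\<And>x. x \<in> rbasis P \<Longrightarrow> \<Phi> (B.e (x, False)) = emb 0 False (\<theta> (e x))"
    "\<And>x. x \<in> rbasis P \<Longrightarrow> \<Phi> (B.e (x, True)) = sg i (emb 0 True (\<phi> (\<theta> (\<psi> (e x)))))"
    by (rule cone_lift[OF \<alpha> l]) (rule that)
  have "incl \<alpha> \<in> gcomp EC (i, s)" using incl_linear \<alpha> unfolding graded_linear_def by blast
  from B.yoneda_product_lift[OF cone_minimal_resolution this \<Phi>(1)]
  have Y: "yoneda_product B C \<gamma> (incl \<alpha>) = (\<lambda>y. if y \<in> rbasis C then pairing B \<gamma> (\<Phi> (B.e y)) else 0)" .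
  show ?thesis
    unfolding Y by (auto simp: fun_eq_iff \<Phi>(2,3) pairing_emb_0 B.pairing_sg)
qed

text \<open>On the unshifted copy the lift of \<open>incl \<alpha>\<close> is a lift of
  \<open>\<alpha>\<close> over \<open>A\<close>; on the shifted copy it stays there, where
  \<open>incl \<beta>\<close> vanishes.\<close>

lemma incl_hom: "graded_algebra_hom EA EC incl"
  unfolding graded_algebra_hom_def
proof (intro conjI ballI)
  note lin = incl_linear
  show "graded_linear EA EC incl" by (rule lin)
  show "incl (gone EA) = gone EC"
    by (auto simp: incl_def unit_class_def fun_eq_iff)
  fix \<beta> \<alpha> assume \<beta>: "\<beta> \<in> gtotal EA" and \<alpha>: "\<alpha> \<in> gtotal EA"
  note V = ext_vector_space[of A P]
  have i_lin: "linear_on_total EA (gscale EC) incl" using lin by (simp add: graded_linear_iff)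
  have i_tot: "incl a \<in> gtotal EC" if "a \<in> gtotal EA" for a
    by (rule graded_linear_gtotal[OF V ext_vector_space lin that])
  have "incl (gmult EA \<beta> \<alpha>) = gmult EC (incl \<beta>) (incl \<alpha>)"
  proof (rule linear_on_total_eq[OF V _ _ _ \<alpha>])
    show "linear_on_total EA (gscale EC) (\<lambda>\<alpha>. incl (gmult EA \<beta> \<alpha>))"
      using i_lin product_assoc(2)[OF P \<beta>] product_add_right[OF P] product_scale_right[OF P]
      unfolding linear_on_total_def by simp
    show "linear_on_total EA (gscale EC) (\<lambda>\<alpha>. gmult EC (incl \<beta>) (incl \<alpha>))"
      using i_lin i_tot B.product_add_right[OF cone_minimal_resolution]
        B.product_scale_right[OF cone_minimal_resolution]
      unfolding linear_on_total_def by simp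
    fix g \<alpha> assume a: "\<alpha> \<in> gcomp EA g"
    obtain i s where g: "g = (i, s)" by (cases g)
    note a' = a[unfolded g]
    obtain \<theta> where \<theta>: "yoneda_lift A P i s \<alpha> \<theta>" by (rule yoneda_lift_exists[OF P a'])
    show "incl (gmult EA \<beta> \<alpha>) = gmult EC (incl \<beta>) (incl \<alpha>)"
      unfolding ext_algebra_simps product_incl[OF a' \<theta>] yoneda_product_lift[OF P a' \<theta>]
      by (auto simp: incl_def fun_eq_iff pairing_fun)
  qed
  then show "incl (gmult EA \<beta> \<alpha>) = gmult EC (incl \<beta>) (incl \<alpha>)" .
qed

text \<open>The map between the copies kills the component with \<open>z\<close>, and the minus sign
  in the shifted copy is the sign demanded of a lift of odd degree. Right multiplication by
  \<open>\<omega>\<close> thus moves the unshifted part of a class to the shifted copy.\<close>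

lemma product_\<omega>: "yoneda_product B C \<gamma> \<omega> = (\<lambda>(x, b). if x \<in> rbasis P \<and> b then \<gamma> (x, False) else 0)"
proof -
  define \<Phi> where "\<Phi> = B.lin_ext id (\<lambda>(x, b). if b then emb 0 False (e x) else 0)"
  have \<Phi>: "B.semilin id C \<Phi>" unfolding \<Phi>_def by (rule B.semilin_lin_ext[OF B_hom_id])
  have e: "\<Phi> (B.e (x, b)) = (if b then emb 0 False (e x) else 0)" for x b
  proof -
    have "\<Phi> (B.e (x, b)) = (\<lambda>(x, b). if b then emb 0 False (e x) else 0) (x, b)"
      unfolding \<Phi>_def by (rule B.lin_ext_e) simp
    then show ?thesis by simp
  qed
  have \<Phi>F: "\<Phi> (emb n False p) = 0" if p: "p \<in> rmodule P" for n p
  proof -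
    have "\<Phi> (emb n False p) = B.act (monom one n) 0"
      by (rule cone_map[OF \<Phi> _ _ _ p, where f = "\<lambda>p. 0"]) (simp_all add: B.act_simps e)
    then show ?thesis by (simp add: B.act_simps)
  qed
  have \<Phi>T: "\<Phi> (emb n True p) = emb n False p" if p: "p \<in> rmodule P" for n p
  proof -
    have "\<Phi> (emb n True p) = B.act (monom one n) (emb 0 False p)"
      by (rule cone_map[OF \<Phi> _ _ _ p]) (simp_all add: emb_add act_emb_0 e)
    then show ?thesis by (simp add: act_emb)
  qed
  have "yoneda_lift B C 1 (- int l) \<omega> \<Phi>"
    unfolding B.yoneda_lift_iff
  proof (intro conjI ballI)
    show "B.semilin id C \<Phi>" by (rule \<Phi>)
    show "B.shifts C C (int 1) (- int l) \<Phi>"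
    proof (rule B.shiftsI[OF B_hom_id \<Phi>])
      fix y assume "y \<in> rbasis C"
      then obtain x b where y: "y = (x, b)" and x: "x \<in> rbasis P" by (cases y) auto
      show "\<Phi> (B.e y) \<in> rbidegree B C (- int (hdeg C y) + int 1) (ideg C y + - int l)"
        using emb_rbidegree[OF e_rbidegree[OF x], of 0 False]
        unfolding y e by (cases b) (simp_all add: B.rbidegree_closed)
    qed
    fix c assume "c \<in> rmodule C"
    then have "\<Phi> c \<in> rmodule C \<and> sg 1 (D (\<Phi> c)) = \<Phi> (D c)"
    proof (induction rule: cone_induct)
      case (add p q)
      then show ?case
        using D_D by (simp add: B.semilin_add[OF \<Phi>] B.semilin_add[OF D_semilin])
    next
      case (emb n b p)
      then show ?case
        using dm \<psi>m B.semilin_zero[OF D_semilin]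
        by (cases b) (simp_all add: \<Phi>F \<Phi>T D_emb_True D_emb_False B.semilin_diff[OF \<Phi>])
    qed
    then show "sg 1 (D (\<Phi> c)) = \<Phi> (D c)" by simp
  next
    fix c assume c: "c \<in> rdegree C (- int 1)"
    show "raugmentation B C (\<Phi> c) = pairing B \<omega> c"
      unfolding raugmentation_def B.pairing_semilin[OF B_hom_id \<Phi> B.rdegree_rmodule[OF c]]
    proof (rule B.pairing_cong)
      fix y assume y: "y \<in> Poly_Mapping.keys c"
      obtain x b where xb: "y = (x, b)" by (cases y)
      have "pairing B (unit_class C) (emb 0 False (e x)) = unit_class P x"
        using raug_emb_0(1)[of "e x"] by (simp add: raugmentation_def)
      then show "pairing B (unit_class C) (\<Phi> (B.e y)) = \<omega> y"
        by (simp add: xb e \<omega>_def shifted_def)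
    qed
  qed
  from B.yoneda_product_lift[OF cone_minimal_resolution \<omega>_comp this]
  show ?thesis by (auto simp: fun_eq_iff e pairing_emb_0)
qed

abbreviation "S \<equiv> sign_twist P \<phi>"
abbreviation "S' \<equiv> sign_twist P \<psi>"

lemma S_inverse:
  assumes "f \<in> gtotal EA"
  shows "S (S' f) = f" "S' (S f) = f"
  by (rule sign_twist_inverse[OF P \<sigma>_hom \<phi>_props(1,2) \<sigma>_inv_hom \<psi>(1,5) assms]
      sign_twist_inverse[OF P \<sigma>_inv_hom \<psi>(1,2) \<sigma>_hom \<phi>_props(1) \<psi>(4) assms]; simp)+

text \<open>The condition on \<open>\<phi>\<close> concerns degree 0; on other generators both sides
  vanish, since \<open>\<phi>\<close> preserves the homological degree and the unit class lives in
  degree 0.\<close>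

lemma pairing_unit_\<phi>: "p \<in> rmodule P \<Longrightarrow> pairing A (unit_class P) (\<phi> p) = pairing A (unit_class P) p"
proof -
  assume p: "p \<in> rmodule P"
  have "pairing A (unit_class P) (\<phi> (e x)) = unit_class P x" if x: "x \<in> rbasis P" for x
  proof (cases "hdeg P x = 0")
    case True
    then have "raugmentation A P (\<phi> (e x)) = raugmentation A P (e x)"
      using \<phi> e_rdegree[OF x] by (simp add: resolution_twist_iff)
    then show ?thesis by (simp add: raugmentation_def)
  next
    case False
    have "pairing A (unit_class P) (\<phi> (e x)) = 0"
    proof (rule ccontr)
      assume n: "pairing A (unit_class P) (\<phi> (e x)) \<noteq> 0"
      show False using pairing_bidegree[OF shifts_e[OF \<phi>_props(2) x] n] False
        by (auto simp: unit_class_def split: if_splits)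
    qed
    then show ?thesis using False by (simp add: unit_class_def)
  qed
  then show ?thesis
    unfolding pairing_semilin[OF \<sigma>_hom \<phi>_props(1) p]
    by (intro pairing_cong) (use p in \<open>auto simp: rmodule_def\<close>)
qed

text \<open>Evaluate the unit class on \<open>\<phi> \<theta> \<psi>\<close>: \<open>\<phi>\<close>
  disappears because it preserves the augmentation, and \<open>\<theta>\<close> turns the unit class
  into \<open>\<alpha>\<close>. What is left is \<open>\<alpha>\<close> after \<open>\<psi>\<close>
  with the sign (-1)^i, which is \<open>S' \<alpha>\<close>.\<close>

lemma \<omega>_product: "\<alpha> \<in> gtotal EA \<Longrightarrow> yoneda_product B C \<omega> (incl \<alpha>) = shifted (S' \<alpha>)"
proof -
  assume \<alpha>: "\<alpha> \<in> gtotal EA"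
  note V = ext_vector_space[of A P]
  have i_lin: "linear_on_total EA (gscale EC) incl" using incl_linear by (simp add: graded_linear_iff)
  have i_tot: "incl a \<in> gtotal EC" if "a \<in> gtotal EA" for a
    by (rule graded_linear_gtotal[OF V ext_vector_space incl_linear that])
  show ?thesis
  proof (rule linear_on_total_eq[OF V _ _ _ \<alpha>])
    show "linear_on_total EA (gscale EC) (\<lambda>\<alpha>. yoneda_product B C \<omega> (incl \<alpha>))"
      using i_lin i_tot B.product_add_right[OF cone_minimal_resolution]
        B.product_scale_right[OF cone_minimal_resolution]
      unfolding linear_on_total_def by simp
    show "linear_on_total EA (gscale EC) (\<lambda>\<alpha>. shifted (S' \<alpha>))"
      using sign_twist_linear[OF P \<psi>(2)]
      by (auto simp: linear_on_total_def graded_linear_def shifted_def fun_eq_iff plus_fun_apply)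
    fix g \<alpha> assume a: "\<alpha> \<in> gcomp EA g"
    obtain i s where g: "g = (i, s)" by (cases g)
    note a' = a[unfolded g]
    obtain \<theta> where \<theta>: "yoneda_lift A P i s \<alpha> \<theta>" by (rule yoneda_lift_exists[OF P a'])
    have \<theta>m: "\<theta> p \<in> rmodule P" if "p \<in> rmodule P" for p
      using \<theta> that shifts_rmodule by (auto simp: yoneda_lift_iff)
    have "sg i (pairing A (unit_class P) (\<phi> (\<theta> (\<psi> (e x))))) = S' \<alpha> x" if x: "x \<in> rbasis P" for x
    proof -
      have "pairing A (unit_class P) (\<phi> (\<theta> (\<psi> (e x)))) = pairing A (unit_class P) (\<theta> (\<psi> (e x)))"
        using x by (intro pairing_unit_\<phi> \<theta>m \<psi>m) simp
      also have "\<dots> = pairing A \<alpha> (\<psi> (e x))"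
        using pairing_product[OF P a' \<theta> \<psi>m[of "e x"], of "unit_class P"] x
          product_unit(2)[OF P gcomp_gtotal[OF V a]] by simp
      finally have *: "pairing A (unit_class P) (\<phi> (\<theta> (\<psi> (e x)))) = pairing A \<alpha> (\<psi> (e x))" .
      \<comment> \<open>The lift carries the sign of the degree \<open>i\<close> of
        \<open>\<alpha>\<close>, while \<open>S'\<close> uses the degree of \<open>x\<close>; the
        two agree wherever the value is nonzero.\<close>
      have "hdeg P x = i" if n: "pairing A \<alpha> (\<psi> (e x)) \<noteq> 0"
        using pairing_bidegree[OF shifts_e[OF \<psi>(2) x] n] a' by (auto simp: ext_bidegree_def)
      then show ?thesis using x * by (cases "pairing A \<alpha> (\<psi> (e x)) = 0") (auto simp: sign_twist_def[OF P])
    qed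
    then show "yoneda_product B C \<omega> (incl \<alpha>) = shifted (S' \<alpha>)"
      unfolding product_incl[OF a' \<theta>]
      by (auto simp: fun_eq_iff \<omega>_def shifted_def pairing_fun sign_twist_def[OF P])
  qed
qed

end

section \<open>The Ext-algebra of the polynomial ring and the main theorem\<close>

definition base_field :: "(int, 'k::field, 'k) galgebra" where
  "base_field = \<lparr>gscale = (*), gcomp = (\<lambda>m. if m = 0 then UNIV else {0}), gmult = (*), gone = 1\<rparr>"

definition trivial_resolution :: "(unit, 'k::field) resolution" where
  "trivial_resolution = \<lparr>rbasis = UNIV, hdeg = (\<lambda>_. 0), ideg = (\<lambda>_. 0), rdiff = (\<lambda>_. 0)\<rparr>"

lemma trivial_resolution_simps [simp]:
  "rbasis trivial_resolution = UNIV" "hdeg trivial_resolution x = 0" "ideg trivial_resolution x = 0"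
  "rdiff trivial_resolution p = 0"
  by (simp_all add: trivial_resolution_def)

lemma base_field_simps [simp]:
  "gscale base_field = (*)" "gcomp base_field m = (if m = 0 then UNIV else {0})"
  "gmult base_field = (*)" "gone base_field = 1"
  by (simp_all add: base_field_def)

lemma base_field_total: "gtotal base_field = UNIV"
proof -
  interpret vector_space "(*) :: 'a \<Rightarrow> 'a \<Rightarrow> 'a::field" by unfold_locales (auto simp: algebra_simps)
  have "x \<in> gtotal base_field" for x :: 'a
    unfolding gtotal_def base_field_simps by (rule span_base) (auto intro: exI[of _ 0])
  then show ?thesis by blast
qed

lemma base_field_connected: "connected_graded_algebra base_field"
proof -
  have "graded_space (base_field :: (int, 'a::field, 'a) galgebra)"
  proof (rule graded_spaceI[where \<pi> = "\<lambda>(_::unit) g x. if g = 0 then x else 0"])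
    show "vector_space (gscale base_field)" by unfold_locales (auto simp: algebra_simps)
    interpret vector_space "gscale base_field :: 'a \<Rightarrow> 'a \<Rightarrow> 'a" by unfold_locales (auto simp: algebra_simps)
    show "subspace (gcomp base_field g)" for g by (rule subspaceI) auto
  qed (auto split: if_splits)
  then have "graded_algebra (base_field :: (int, 'a::field, 'a) galgebra)"
    unfolding graded_algebra_def base_field_total by (auto simp: algebra_simps)
  then show ?thesis
    unfolding connected_graded_algebra_def base_field_total by auto
qed

interpretation base: connected_algebra base_field
  by unfold_locales (rule base_field_connected)

lemma trivial_minimal: "minimal_resolution base_field trivial_resolution"
proof -
  have aug: "augmentation base_field x = x" for x :: 'a
    by (rule base.aug_unique[symmetric, of "\<lambda>x. x"]) auto
  have t: "rdegree (trivial_resolution :: (unit, 'a) resolution) j = (if j = 0 then UNIV else {0})" for j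
    by (auto simp: base.rdegree_iff trivial_resolution_def intro!: poly_mapping_eqI)
  have "raugmentation base_field trivial_resolution p = Poly_Mapping.lookup p ()" for p :: "unit \<Rightarrow>\<^sub>0 'a"
    unfolding raugmentation_def
    by (subst base.pairing_superset[of UNIV])
      (auto simp: UNIV_unit aug unit_class_def trivial_resolution_def)
  then have r: "{p. raugmentation base_field trivial_resolution p = 0} = {0 :: unit \<Rightarrow>\<^sub>0 'a}"
    by (auto intro!: poly_mapping_eqI)
  have d: "rdiff (trivial_resolution :: (unit, 'a) resolution) = (\<lambda>_. 0)"
    by (simp add: trivial_resolution_def)
  show ?thesis
    unfolding minimal_resolution_def base.semilinear_iff base.shifts_iff t d
    using r by (auto simp: base.semilin_def base.shifts_def base.act_simps base.rbidegree_closed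
        base.positive_part_iff)
qed

lemma base_iso_id: "graded_algebra_iso base_field base_field id"
  by (auto simp: graded_algebra_iso_def graded_linear_iso_def graded_linear_def base_field_total)

text \<open>An equality of records, so resolutions over \<open>poly_algebra l\<close> are literally
  resolutions over the skew extension and results on the cone apply to them.\<close>

lemma poly_algebra_eq_skew: "l \<ge> 1 \<Longrightarrow> poly_algebra l = skew_extension base_field id l"
proof -
  assume l: "l \<ge> 1"
  interpret skew_polynomials base_field id l by unfold_locales (rule base_iso_id l)+
  have 1: "smult = (\<lambda>c. map_poly ((*) c))" for c :: 'a
    by (intro ext poly_eqI) (simp add: coeff_map_poly)
  have m: "gmult (skew_extension base_field id l) (monom a i) (monom b j) = monom (a * b) (i + j)"
    for a b :: 'a and i j
    by (simp only: B_mult_monom base_field_simps id_funpow id_apply)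
  have 2: "p * q = gmult (skew_extension base_field id l) p q" for p q :: "'a poly"
  proof (rule poly_additive_eq[of "\<lambda>p. p * q"])
    fix a i
    show "monom a i * q = gmult (skew_extension base_field id l) (monom a i) q"
      by (rule poly_additive_eq[of "\<lambda>q. monom a i * q"])
        (simp_all only: B_mult_add distrib_left mult_monom m)
  qed (simp_all only: B_mult_add distrib_right)
  have 3: "{p. \<forall>n. coeff p n \<noteq> 0 \<longrightarrow> int l * int n = m} = gcomp (skew_extension base_field id l) m" for m
    by (auto simp: set_eq_iff)
  show ?thesis
    unfolding poly_algebra_def 3
    using 1 2 by (simp add: skew_extension_def monom_0 one_pCons fun_eq_iff)
qed

text \<open>The cone over the trivial resolution has just two generators. The classes dual to them
  are the unit and \<open>\<omega>\<close>, and they are transported to the given resolution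
  \<open>Q\<close> by uniqueness of the Ext-algebra.\<close>

lemma ext_poly_algebra:
  fixes Q :: "('y, 'k::field poly) resolution"
  assumes l: "l \<ge> 1" and Q: "minimal_resolution (poly_algebra l) Q"
  defines "E \<equiv> ext_algebra (poly_algebra l) Q"
  obtains \<zeta> \<kappa>\<^sub>0 \<kappa>\<^sub>1 where "graded_algebra E" "\<zeta> \<in> gcomp E (1, - int l)" "gmult E \<zeta> \<zeta> = 0"
    "linear_on_total E (*) \<kappa>\<^sub>0" "linear_on_total E (*) \<kappa>\<^sub>1"
    "\<kappa>\<^sub>0 (gone E) = 1" "\<kappa>\<^sub>1 (gone E) = 0" "\<kappa>\<^sub>0 \<zeta> = 0" "\<kappa>\<^sub>1 \<zeta> = 1"
    "\<And>g. g \<in> gtotal E \<Longrightarrow> g = gscale E (\<kappa>\<^sub>0 g) (gone E) + gscale E (\<kappa>\<^sub>1 g) \<zeta>"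
    "\<And>g h. g \<in> gcomp E h \<Longrightarrow> \<kappa>\<^sub>0 g \<noteq> 0 \<Longrightarrow> h = 0"
    "\<And>g h. g \<in> gcomp E h \<Longrightarrow> \<kappa>\<^sub>1 g \<noteq> 0 \<Longrightarrow> h = (1, - int l)"
proof -
  interpret F: skew_cone "base_field :: (int, 'k, 'k) galgebra" id l trivial_resolution "\<lambda>p. p"
  proof unfold_locales
    show "resolution_twist base_field id trivial_resolution (\<lambda>p. p :: unit \<Rightarrow>\<^sub>0 'k)"
      by (simp add: base.resolution_twist_iff base.semilin_id base.shifts_plus bij_betw_def)
  qed (rule base_iso_id l trivial_minimal)+
  note eq = poly_algebra_eq_skew[OF l, where 'a = 'k]
  have Q': "minimal_resolution F.B Q" using Q unfolding eq .
  have E: "E = ext_algebra F.B Q" unfolding E_def eq ..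
  have ga: "graded_algebra E" unfolding E by (rule F.B.ext_graded_algebra[OF Q'])
  obtain \<theta> where \<theta>: "graded_algebra_iso E F.EC \<theta>"
    using F.B.ext_algebra_unique[OF Q' F.cone_minimal_resolution]
    unfolding isomorphic_graded_algebras_def E by blast
  note V = graded_algebra_vector_space[OF ga]
  have gl: "graded_linear E F.EC \<theta>" and bij: "bij_betw \<theta> (gtotal E) (gtotal F.EC)"
    and im: "\<And>g. \<theta> ` gcomp E g = gcomp F.EC g" and one: "\<theta> (gone E) = gone F.EC"
    using \<theta> by (auto simp only: graded_algebra_iso_def graded_linear_iso_def)
  have \<theta>l: "\<theta> (x + y) = \<theta> x + \<theta> y" "\<theta> (gscale E c x) = (\<lambda>u. c * \<theta> x u)"
    if "x \<in> gtotal E" "y \<in> gtotal E" for x y c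
    using gl that by (auto simp: graded_linear_def)
  have inj: "x = y" if "\<theta> x = \<theta> y" "x \<in> gtotal E" "y \<in> gtotal E" for x y
    using bij that by (auto simp: bij_betw_def inj_on_def)
  have "F.\<omega> \<in> \<theta> ` gcomp E (1, - int l)" unfolding im by (rule F.\<omega>_comp)
  then obtain \<zeta> where \<zeta>': "F.\<omega> = \<theta> \<zeta>" "\<zeta> \<in> gcomp E (1, - int l)" by (rule imageE)
  note \<zeta> = \<zeta>'(2) \<zeta>'(1)[symmetric]
  have "gone E \<in> gcomp E 0" using ga by (simp only: graded_algebra_def)
  then have tot: "\<zeta> \<in> gtotal E" "gone E \<in> gtotal E"
    using \<zeta>(1) gcomp_gtotal[OF V] by blast+
  have u: "unit_class F.C (x, b) = (if b then 0 else 1 :: 'k)" "F.\<omega> (x, b) = (if b then 1 else 0)" for x b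
    by (simp_all add: unit_class_def F.\<omega>_def F.shifted_def)
  \<comment> \<open>A class on the cone is a function on two generators, so its values there are its
    coordinates.\<close>
  let ?k0 = "\<lambda>g. \<theta> g ((), False)" and ?k1 = "\<lambda>g. \<theta> g ((), True)"
  have dec: "g = gscale E (?k0 g) (gone E) + gscale E (?k1 g) \<zeta>" if g: "g \<in> gtotal E" for g
  proof (rule inj[OF _ g gtotal_add[OF V gtotal_scale[OF V tot(2)] gtotal_scale[OF V tot(1)]]])
    have "\<theta> (gscale E (?k0 g) (gone E) + gscale E (?k1 g) \<zeta>) =
        (\<lambda>y. ?k0 g * gone F.EC y) + (\<lambda>y. ?k1 g * F.\<omega> y)"
      using \<theta>l(1)[OF gtotal_scale[OF V tot(2)] gtotal_scale[OF V tot(1)]]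
        \<theta>l(2)[OF tot(2) tot(1)] \<theta>l(2)[OF tot(1) tot(2)] one \<zeta>(2) by simp
    also have "\<dots> = \<theta> g" by (auto simp: fun_eq_iff plus_fun_apply u)
    finally show "\<theta> g = \<theta> (gscale E (?k0 g) (gone E) + gscale E (?k1 g) \<zeta>)" ..
  qed
  have b: "h = ext_bidegree F.C y" if "g \<in> gcomp E h" "\<theta> g y \<noteq> 0" for g h y
  proof -
    have "\<theta> g \<in> gcomp F.EC h" using im[of h] that(1) by blast
    then show ?thesis using that(2) unfolding ext_algebra_simps by blast
  qed
  have k0: "h = 0" if "g \<in> gcomp E h" "?k0 g \<noteq> 0" for g h
    using b[OF that] by (simp add: zero_prod_def ext_bidegree_def)
  have k1: "h = (1, - int l)" if "g \<in> gcomp E h" "?k1 g \<noteq> 0" for g h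
    using b[OF that] by (simp add: ext_bidegree_def)
  \<comment> \<open>The square has cohomological degree 2, where the cone has no generator, so both
    coordinates vanish.\<close>
  have zz: "gmult E \<zeta> \<zeta> \<in> gcomp E (2, - 2 * int l)"
    using graded_algebra_mult_gcomp[OF ga \<zeta>(1) \<zeta>(1)] by (simp add: numeral_2_eq_2)
  have "gmult E \<zeta> \<zeta> = 0"
  proof -
    interpret vector_space "gscale E" by (rule V)
    have "?k0 (gmult E \<zeta> \<zeta>) = 0" "?k1 (gmult E \<zeta> \<zeta>) = 0"
      using k0[OF zz] k1[OF zz] by (auto simp: zero_prod_def)
    with dec[OF gcomp_gtotal[OF V zz]] show ?thesis by simp
  qed
  then show ?thesis
  proof (rule that[OF ga \<zeta>(1)])
    show "linear_on_total E (*) ?k0" "linear_on_total E (*) ?k1"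
      using \<theta>l by (auto simp: linear_on_total_def plus_fun_apply)
    show "?k0 (gone E) = 1" "?k1 (gone E) = 0" "?k0 \<zeta> = 0" "?k1 \<zeta> = 1"
      using one \<zeta>(2) by (simp_all add: u)
  qed (fact dec k0 k1)+
qed

section \<open>Classes of a single cohomological degree\<close>

lemma cohomological_part_ext:
  assumes "f \<in> cohomological_part (ext_algebra A P) i"
  shows "f \<in> gtotal (ext_algebra A P)" "f x \<noteq> 0 \<Longrightarrow> hdeg P x = i"
proof -
  interpret vector_space "gscale (ext_algebra A P)" by (rule ext_vector_space)
  have f: "f \<in> span (\<Union>s. gcomp (ext_algebra A P) (i, s))"
    using assms by (simp only: cohomological_part_def)
  have "span (\<Union>s. gcomp (ext_algebra A P) (i, s)) \<subseteq> gtotal (ext_algebra A P)"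
    unfolding gtotal_def by (rule span_mono) blast
  with f show "f \<in> gtotal (ext_algebra A P)" by blast
  have "\<forall>x. f x \<noteq> 0 \<longrightarrow> hdeg P x = i"
    using f
  proof (induction rule: span_induct_alt)
    case base
    then show ?case by (simp add: zero_fun_apply)
  next
    case (step c g h)
    then show ?case by (auto simp: plus_fun_apply ext_bidegree_def) (metis add_0 mult_zero_right)
  qed
  then show "f x \<noteq> 0 \<Longrightarrow> hdeg P x = i" by blast
qed

text \<open>A class in one cohomological degree may mix internal degrees; vanishing on each bidegree
  extends to the span.\<close>

lemma cohomological_part_linear_zero:
  assumes V: "vector_space (gscale E)" and \<kappa>: "linear_on_total E s \<kappa>"
    and 0: "\<And>x i. x \<in> gcomp E (n, i) \<Longrightarrow> \<kappa> x = 0" and g: "g \<in> cohomological_part E n"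
    and s: "\<And>c. s c 0 = 0"
  shows "\<kappa> g = 0"
proof -
  interpret vector_space "gscale E" by (rule V)
  have "g \<in> span (\<Union>i. gcomp E (n, i))" using g by (simp only: cohomological_part_def)
  then have "g \<in> gtotal E \<and> \<kappa> g = 0"
  proof (induction rule: span_induct_alt)
    case base
    show ?case using gtotal_zero[OF V] linear_on_total_zero[OF V \<kappa>] by blast
  next
    case (step c x y)
    then obtain i where "x \<in> gcomp E (n, i)" by blast
    then have x: "x \<in> gtotal E" "\<kappa> x = 0" using gcomp_gtotal[OF V] 0 by blast+
    then show ?case
      using step \<kappa> gtotal_scale[OF V x(1), of c] gtotal_add[OF V] s
      by (simp add: linear_on_total_def)
  qed
  then show ?thesis by simp
qed

theorem theorem3p7:
  fixes A :: "(int, 'k::field, 'a::ab_group_add) galgebra"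
    and \<sigma> :: "'a \<Rightarrow> 'a" and l :: nat
    and P\<^sub>A :: "('x, 'a) resolution"
    and P\<^sub>Z :: "('y, 'k poly) resolution"
    and P\<^sub>B :: "('w, 'a poly) resolution"
  assumes "connected_graded_algebra A"
    and "graded_algebra_iso A A \<sigma>"
    and "l \<ge> 1"
    and "minimal_resolution A P\<^sub>A"
    and "minimal_resolution (poly_algebra l) P\<^sub>Z"
    and "minimal_resolution (skew_extension A \<sigma> l) P\<^sub>B"
  defines "E\<^sub>A \<equiv> ext_algebra A P\<^sub>A"
    and "E\<^sub>Z \<equiv> ext_algebra (poly_algebra l) P\<^sub>Z"
    and "E\<^sub>B \<equiv> ext_algebra (skew_extension A \<sigma> l) P\<^sub>B"
    and "\<tau> \<equiv> ext_twist A \<sigma> P\<^sub>A"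
  shows "\<exists>R.
     graded_linear_iso (tensor_space E\<^sub>A E\<^sub>Z) (tensor_space E\<^sub>Z E\<^sub>A) R \<and>
     normal_twist E\<^sub>Z E\<^sub>A R \<and>
     (\<forall>i. \<forall>f\<in>cohomological_part E\<^sub>A i. \<forall>g\<in>cohomological_part E\<^sub>Z 1.
        R (tensor E\<^sub>A E\<^sub>Z f g) =
          gscale (tensor_space E\<^sub>Z E\<^sub>A) ((- 1) ^ i) (tensor E\<^sub>Z E\<^sub>A g (\<tau> f))) \<and>
     is_smash_product E\<^sub>Z E\<^sub>A R \<and>
     is_smash_product E\<^sub>A E\<^sub>Z (inv_into (gtotal (tensor_space E\<^sub>A E\<^sub>Z)) R) \<and>
     isomorphic_graded_algebras E\<^sub>B (smash E\<^sub>Z E\<^sub>A R) \<and>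
     isomorphic_graded_algebras (smash E\<^sub>Z E\<^sub>A R)
       (smash E\<^sub>A E\<^sub>Z (inv_into (gtotal (tensor_space E\<^sub>A E\<^sub>Z)) R))"
proof -
  interpret connected_algebra A by unfold_locales (rule assms(1))
  \<comment> \<open>This is the lift that \<open>ext_twist\<close> selects, so building the cone
    from it relates \<open>S\<close> to \<open>\<tau>\<close> without comparing two lifts of
    \<open>\<sigma>\<close>.\<close>
  define \<phi> where "\<phi> = (SOME \<phi>. resolution_twist A \<sigma> P\<^sub>A \<phi>)"
  have \<phi>: "resolution_twist A \<sigma> P\<^sub>A \<phi>"
    unfolding \<phi>_def by (rule someI_ex[OF twist_exists[OF assms(4,2)]])
  interpret skew_cone A \<sigma> l P\<^sub>A \<phi> by unfold_locales (fact assms(2-4) \<phi>)+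
  note CR = cone_minimal_resolution
  obtain \<zeta> \<kappa>\<^sub>0 \<kappa>\<^sub>1 where Z: "graded_algebra E\<^sub>Z" "\<zeta> \<in> gcomp E\<^sub>Z (1, - int l)" "gmult E\<^sub>Z \<zeta> \<zeta> = 0"
    "linear_on_total E\<^sub>Z (*) \<kappa>\<^sub>0" "linear_on_total E\<^sub>Z (*) \<kappa>\<^sub>1"
    "\<kappa>\<^sub>0 (gone E\<^sub>Z) = 1" "\<kappa>\<^sub>1 (gone E\<^sub>Z) = 0" "\<kappa>\<^sub>0 \<zeta> = 0" "\<kappa>\<^sub>1 \<zeta> = 1"
    "\<And>g. g \<in> gtotal E\<^sub>Z \<Longrightarrow> g = gscale E\<^sub>Z (\<kappa>\<^sub>0 g) (gone E\<^sub>Z) + gscale E\<^sub>Z (\<kappa>\<^sub>1 g) \<zeta>"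
    "\<And>g h. g \<in> gcomp E\<^sub>Z h \<Longrightarrow> \<kappa>\<^sub>0 g \<noteq> 0 \<Longrightarrow> h = 0"
    "\<And>g h. g \<in> gcomp E\<^sub>Z h \<Longrightarrow> \<kappa>\<^sub>1 g \<noteq> 0 \<Longrightarrow> h = (1, - int l)"
    using ext_poly_algebra[OF assms(3,5)] unfolding E\<^sub>Z_def by blast
  have EA: "E\<^sub>A = EA" by (simp add: E\<^sub>A_def)
  \<comment> \<open>The coordinates of a class on the cone are its restrictions to the two
    copies.\<close>
  let ?p0 = "\<lambda>F x. F (x, False)" and ?p1 = "\<lambda>F x. F (x, True)"
  have supp: "f x = 0" if "f \<in> gtotal EA" "x \<notin> rbasis P\<^sub>A" for f x
    using ext_total(1)[OF that(1)] that(2) by blast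
  have right: "gmult EC (incl f) \<omega> = shifted f" if "f \<in> gtotal EA" for f
    using supp[OF that] by (auto simp: product_\<omega> incl_def shifted_def fun_eq_iff)
  interpret X: exterior_extension E\<^sub>Z EA EC \<zeta> \<kappa>\<^sub>0 \<kappa>\<^sub>1 "(1, - int l)" incl \<omega> ?p0 ?p1 S S'
  proof
    show "graded_algebra EA" by (rule ext_graded_algebra[OF assms(4)])
    show "graded_algebra EC" by (rule B.ext_graded_algebra[OF CR])
    show "graded_algebra_hom EA EC incl" by (rule incl_hom)
    show "\<omega> \<in> gcomp EC (1, - int l)" by (rule \<omega>_comp)
    show "gmult EC \<omega> \<omega> = 0"
      unfolding ext_algebra_simps product_\<omega>
      by (auto simp: \<omega>_def shifted_def fun_eq_iff zero_fun_apply)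
    show "linear_on_total EC (gscale EA) ?p0" "linear_on_total EC (gscale EA) ?p1"
      by (auto simp: linear_on_total_def plus_fun_apply fun_eq_iff)
    fix F h assume F: "F \<in> gcomp EC h"
    obtain i s where h: "h = (i, s)" by (cases h)
    show "?p0 F \<in> gcomp EA h" using F by (fastforce simp: ext_bidegree_def)
    show "?p1 F = 0 \<or> (\<exists>h'. (1, - int l) + h' = h \<and> ?p1 F \<in> gcomp EA h')"
    proof (cases "?p1 F = 0")
      case False
      then obtain x where "F (x, True) \<noteq> 0" by (auto simp: fun_eq_iff zero_fun_apply)
      then have "ext_bidegree C (x, True) = h" using F unfolding ext_algebra_simps by blast
      \<comment> \<open>The subtraction \<open>i - 1\<close> of natural numbers is exact: the
        generator \<open>(x, True)\<close> has homological degree at least 1, and its bidegree is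
        \<open>h\<close>.\<close>
      then have "(1, - int l) + (i - 1, s + int l) = h" by (auto simp: h ext_bidegree_def)
      moreover have "?p1 F \<in> gcomp EA (i - 1, s + int l)"
        using F by (fastforce simp: h ext_bidegree_def)
      ultimately show ?thesis by blast
    qed simp
  next
    fix F assume F: "F \<in> gtotal EC"
    have "F (x, b) = 0" if "x \<notin> rbasis P\<^sub>A" for x b
      using ext_total(1)[OF F, of "(x, b)"] that by auto
    then show "F = incl (?p0 F) + gmult EC (incl (?p1 F)) \<omega>"
      by (auto simp: product_\<omega> incl_def fun_eq_iff plus_fun_apply)
  next
    fix f f' assume "f \<in> gtotal EA" "f' \<in> gtotal EA"
    then show "?p0 (incl f + gmult EC (incl f') \<omega>) = f" "?p1 (incl f + gmult EC (incl f') \<omega>) = f'"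
      unfolding right[OF \<open>f' \<in> gtotal EA\<close>] by (auto simp: incl_def shifted_def plus_fun_apply)
  next
    show "graded_linear EA EA S" "graded_linear EA EA S'"
      by (rule sign_twist_linear[OF assms(4)], rule \<phi>_props \<psi>)+
    fix f assume f: "f \<in> gtotal EA"
    show "S (S' f) = f" by (rule S_inverse[OF f])
    have "S f \<in> gtotal EA"
      by (rule graded_linear_gtotal[OF ext_vector_space ext_vector_space
            sign_twist_linear[OF assms(4) \<phi>_props(2)] f])
    \<comment> \<open>Both sides are \<open>shifted f\<close>: on the left \<open>S'\<close> undoes
      \<open>S\<close>.\<close>
    then show "gmult EC \<omega> (incl (S f)) = gmult EC (incl f) \<omega>"
      by (simp add: \<omega>_product S_inverse[OF f] right[OF f, simplified])
  qed (fact Z)+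
  obtain R where R: "graded_linear_iso (tensor_space EA E\<^sub>Z) (tensor_space E\<^sub>Z EA) R"
    "\<And>f g. f \<in> gtotal EA \<Longrightarrow> g \<in> gtotal E\<^sub>Z \<Longrightarrow> \<kappa>\<^sub>0 g = 0 \<Longrightarrow>
      R (tensor EA E\<^sub>Z f g) = tensor E\<^sub>Z EA g (S f)"
    "normal_twist E\<^sub>Z EA R" "is_smash_product E\<^sub>Z EA R"
    "is_smash_product EA E\<^sub>Z (inv_into (gtotal (tensor_space EA E\<^sub>Z)) R)"
    "isomorphic_graded_algebras EC (smash E\<^sub>Z EA R)"
    "isomorphic_graded_algebras (smash E\<^sub>Z EA R)
      (smash EA E\<^sub>Z (inv_into (gtotal (tensor_space EA E\<^sub>Z)) R))"
    by (rule X.smash_decomposition) (rule that)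
  have formula: "R (tensor E\<^sub>A E\<^sub>Z f g) =
      gscale (tensor_space E\<^sub>Z E\<^sub>A) ((- 1) ^ i) (tensor E\<^sub>Z E\<^sub>A g (\<tau> f))"
    if f: "f \<in> cohomological_part E\<^sub>A i" and g: "g \<in> cohomological_part E\<^sub>Z 1" for i f g
  proof -
    note f' = cohomological_part_ext[OF f[unfolded E\<^sub>A_def]]
    have g': "g \<in> gtotal E\<^sub>Z"
      using cohomological_part_ext(1)[OF g[unfolded E\<^sub>Z_def]] unfolding E\<^sub>Z_def .
    \<comment> \<open>\<open>\<kappa>\<^sub>0\<close> is nonzero only in bidegree
      \<open>(0, 0)\<close>, whereas \<open>g\<close> has cohomological degree 1.\<close>
    have "\<kappa>\<^sub>0 g = 0"
    proof (rule cohomological_part_linear_zero[OF X.vs(1) Z(4) _ g mult_zero_right])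
      show "\<kappa>\<^sub>0 x = 0" if "x \<in> gcomp E\<^sub>Z (1, s)" for x s
        using Z(11)[OF that] by (auto simp: zero_prod_def)
    qed
    \<comment> \<open>The class \<open>f\<close> is supported in homological degree \<open>i\<close>
      and \<open>\<phi>\<close> preserves this degree, so the sign inside \<open>S\<close> is
      constantly (-1)^i wherever the value is nonzero.\<close>
    moreover have "S f = gscale EA ((- 1) ^ i) (\<tau> f)"
    proof
      fix x
      have "hdeg P\<^sub>A x = i" if x: "x \<in> rbasis P\<^sub>A" and n: "pairing A f (\<phi> (e x)) \<noteq> 0"
        using pairing_bidegree[OF shifts_e[OF \<phi>_props(2) x] n] f'(2) by auto
      then show "S f x = gscale EA ((- 1) ^ i) (\<tau> f) x"
        by (cases "pairing A f (\<phi> (e x)) = 0")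
          (auto simp: sign_twist_def[OF assms(4)] \<tau>_def ext_twist_def Let_def \<phi>_def[symmetric] sg_mult)
    qed
    ultimately show ?thesis
      using R(2)[OF f'(1) g'] unfolding EA
      by (simp only: tensor_scale_right) (simp add: tensor_space_def)
  qed
  have "isomorphic_graded_algebras E\<^sub>B EC"
    unfolding E\<^sub>B_def by (rule B.ext_algebra_unique[OF assms(6) CR])
  then have "isomorphic_graded_algebras E\<^sub>B (smash E\<^sub>Z EA R)"
    by (rule isomorphic_graded_algebras_trans[rotated 3, OF _ R(6)])
      (simp_all only: E\<^sub>B_def ext_vector_space, simp add: smash_def vector_space_tensor_space)
  then show ?thesis
    using R formula unfolding EA by blast
qed

end
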